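(* Let $R$ be an integral domain and let $\{X_\alpha\}$ be a set of independent indeterminates over $R$. The following statements are equivalent. (1) $R[\{X_\alpha\}]$ is a $t\#$-domain. (2) $R(\{X_\alpha\})$ is a $t\#$-domain. (3) $R\langle\{X_\alpha\}\rangle$ is a $t\#$-domain. If, in addition, $R[\{X_\alpha\}]$ is $v$-coherent, then these conditions are equivalent to: $R$ is a $t\#$-domain.
   Context: For a nonzero fractional ideal $I$ of a domain $D$ with quotient field $F$: $I^{-1} = \{x \in F \mid xI \subseteq D\}$, $I_v = (I^{-1})^{-1}$, and $I_t = \bigcup J_v$, the union over all nonzero finitely generated $J \subseteq I$; $I$ is a $t$-ideal if $I = I_t$. A maximal $t$-ideal is an ideal maximal among the proper nonzero integral $t$-ideals; $t\text{-Max}(D)$ is the set of these. $D$ is a $t\#$-domain if $\bigcap_{M \in \mathcal M_1} D_M \neq \bigcap_{M \in \mathcal M_2} D_M$ for any two distinct subsets $\mathcal M_1, \mathcal M_2$ of $t\text{-Max}(D)$ (an empty intersection being $F$). $D$ is $v$-coherent if for each nonzero finitely generated ideal $I$ of $D$ there is a finitely generated (fractional) ideal $J$ with $I^{-1} = J_v$. For a polynomial $f$ over $R$, $c(f)$ is the ideal of $R$ generated by the coefficients of $f$. $R(\{X_\alpha\})$ is the ring of fractions of $R[\{X_\alpha\}]$ with respect to the multiplicatively closed set of polynomials $f$ with $c(f) = R$. $R\langle\{X_\alpha\}\rangle$ is the ring of fractions $R[\{X_\alpha\}]_S$, where $S = \{f \in R[\{X_\alpha\}] \mid c(f)_v = R\}$.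 *)

theory Defs
  imports "HOL-Library.Poly_Mapping" "HOL-Computational_Algebra.Computational_Algebra"
begin

section \<open>Ideals, \<open>v\<close>- and \<open>t\<close>-operation of a domain inside a field\<close>

text \<open>
  A domain is given as a subring \<open>D\<close> of some field \<open>'k\<close>, which may be larger than the quotient
  field of \<open>D\<close>. Its fractional ideals, localizations and overrings are then subsets of \<open>'k\<close>, too.
\<close>

definition quotient_field :: "'k::field set \<Rightarrow> 'k set" where
  "quotient_field D = {a / b | a b. a \<in> D \<and> b \<in> D \<and> b \<noteq> 0}"

definition ring_of_fractions :: "'k::field set \<Rightarrow> 'k set \<Rightarrow> 'k set" where
  "ring_of_fractions D S = {a / s | a s. a \<in> D \<and> s \<in> S}"

definition localization :: "'k::field set \<Rightarrow> 'k set \<Rightarrow> 'k set" where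
  "localization D P = ring_of_fractions D (D - P)"

definition fractional_ideal :: "'k::field set \<Rightarrow> 'k set \<Rightarrow> bool" where
  "fractional_ideal D I \<longleftrightarrow>
     I \<subseteq> quotient_field D \<and> 0 \<in> I \<and> (\<forall>x\<in>I. \<forall>y\<in>I. x + y \<in> I) \<and> (\<forall>r\<in>D. \<forall>x\<in>I. r * x \<in> I) \<and>
     (\<exists>d\<in>D. d \<noteq> 0 \<and> (\<forall>x\<in>I. d * x \<in> D))"

definition integral_ideal :: "'k::field set \<Rightarrow> 'k set \<Rightarrow> bool" where
  "integral_ideal D I \<longleftrightarrow> fractional_ideal D I \<and> I \<subseteq> D"

definition generated_ideal :: "'k::field set \<Rightarrow> 'k set \<Rightarrow> 'k set" where
  "generated_ideal D A = {\<Sum>a\<in>B. r a * a | B r. finite B \<and> B \<subseteq> A \<and> r ` B \<subseteq> D}"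

definition fg_fractional_ideal :: "'k::field set \<Rightarrow> 'k set \<Rightarrow> bool" where
  "fg_fractional_ideal D I \<longleftrightarrow>
     fractional_ideal D I \<and> (\<exists>A. finite A \<and> A \<subseteq> quotient_field D \<and> I = generated_ideal D A)"

text \<open>
  The following three operations are meaningful for nonzero fractional ideals only. In particular
  \<open>v_closure D {0} = D\<close> if \<open>D\<close> is a field, so the zero ideal has to be excluded wherever
  they are used.
\<close>

definition inverse_ideal :: "'k::field set \<Rightarrow> 'k set \<Rightarrow> 'k set" where
  "inverse_ideal D I = {x \<in> quotient_field D. \<forall>y\<in>I. x * y \<in> D}"

definition v_closure :: "'k::field set \<Rightarrow> 'k set \<Rightarrow> 'k set" where
  "v_closure D I = inverse_ideal D (inverse_ideal D I)"

definition t_closure :: "'k::field set \<Rightarrow> 'k set \<Rightarrow> 'k set" where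
  "t_closure D I = \<Union> {v_closure D J | J. fg_fractional_ideal D J \<and> J \<noteq> {0} \<and> J \<subseteq> I}"

definition t_ideal :: "'k::field set \<Rightarrow> 'k set \<Rightarrow> bool" where
  "t_ideal D I \<longleftrightarrow> fractional_ideal D I \<and> I \<noteq> {0} \<and> t_closure D I = I"

definition proper_integral_t_ideal :: "'k::field set \<Rightarrow> 'k set \<Rightarrow> bool" where
  "proper_integral_t_ideal D I \<longleftrightarrow> integral_ideal D I \<and> t_ideal D I \<and> I \<noteq> D"

definition t_Max :: "'k::field set \<Rightarrow> 'k set set" where
  "t_Max D = {M. proper_integral_t_ideal D M \<and>
                 (\<forall>N. proper_integral_t_ideal D N \<and> M \<subseteq> N \<longrightarrow> N = M)}"

text \<open>
  Intersecting with the quotient field only matters for the empty family, whose intersection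
  would otherwise be all of \<open>'k\<close>.
\<close>

definition t_sharp_domain :: "'k::field set \<Rightarrow> bool" where
  "t_sharp_domain D \<longleftrightarrow>
     (\<forall>\<M>\<^sub>1 \<M>\<^sub>2. \<M>\<^sub>1 \<subseteq> t_Max D \<and> \<M>\<^sub>2 \<subseteq> t_Max D \<and> \<M>\<^sub>1 \<noteq> \<M>\<^sub>2 \<longrightarrow>
        quotient_field D \<inter> (\<Inter>M\<in>\<M>\<^sub>1. localization D M) \<noteq>
        quotient_field D \<inter> (\<Inter>M\<in>\<M>\<^sub>2. localization D M))"

definition v_coherent :: "'k::field set \<Rightarrow> bool" where
  "v_coherent D \<longleftrightarrow>
     (\<forall>I. fg_fractional_ideal D I \<and> I \<subseteq> D \<and> I \<noteq> {0} \<longrightarrow>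
        (\<exists>J. fg_fractional_ideal D J \<and> J \<noteq> {0} \<and> inverse_ideal D I = v_closure D J))"


section \<open>Polynomials in an arbitrary set of indeterminates\<close>

text \<open>
  \<^theory>\<open>HOL-Library.Poly_Mapping\<close> makes \<open>('x \<Rightarrow>\<^sub>0 nat) \<Rightarrow>\<^sub>0 'a\<close> an integral domain only if \<open>'x\<close> is
  linearly ordered. In order not to restrict the indeterminates, they are taken from a copy
  of an arbitrary type \<open>'x\<close>, which carries some linear order provided by the well-ordering
  theorem. This order serves no other purpose.
\<close>

typedef 'x indet = "UNIV :: 'x set" morphisms indet_index Indet ..

definition indet_order :: "('x \<times> 'x) set" where
  "indet_order = (SOME r. Well_order r \<and> Field r = UNIV)"

lemma indet_order: "linear_order (indet_order :: ('x \<times> 'x) set)"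
proof -
  have "Well_order (indet_order :: ('x \<times> 'x) set) \<and> Field (indet_order :: ('x \<times> 'x) set) = UNIV"
    unfolding indet_order_def by (rule someI_ex) (rule well_ordering)
  then show ?thesis
    by (auto simp: well_order_on_def)
qed

instantiation indet :: (type) linorder
begin

definition less_eq_indet :: "'a indet \<Rightarrow> 'a indet \<Rightarrow> bool" where
  "x \<le> y \<longleftrightarrow> (indet_index x, indet_index y) \<in> indet_order"

definition less_indet :: "'a indet \<Rightarrow> 'a indet \<Rightarrow> bool" where
  "x < y \<longleftrightarrow> x \<le> y \<and> \<not> y \<le> (x :: 'a indet)"

instance
proof
  fix x y z :: "'a indet"
  note lin = indet_order[where 'x = 'a]
  show "x < y \<longleftrightarrow> x \<le> y \<and> \<not> y \<le> x"
    by (simp add: less_indet_def)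
  show "x \<le> x"
    using lin by (simp add: less_eq_indet_def order_on_defs refl_on_def)
  show "x \<le> z" if "x \<le> y" "y \<le> z"
    using lin that unfolding less_eq_indet_def order_on_defs by (meson transD)
  show "x = y" if "x \<le> y" "y \<le> x"
    using lin that unfolding less_eq_indet_def order_on_defs
    by (metis antisymD indet_index_inject)
  show "x \<le> y \<or> y \<le> x"
    using lin unfolding less_eq_indet_def order_on_defs total_on_def refl_on_def
    by (metis UNIV_I)
qed

end

type_synonym ('x, 'a) mpoly = "('x indet \<Rightarrow>\<^sub>0 nat) \<Rightarrow>\<^sub>0 'a"

text \<open>The coefficient ring \<open>R\<close> is a type \<open>'a\<close>, embedded into its field of fractions.\<close>

definition coeff_ring :: "'a::idom fract set" where
  "coeff_ring = range to_fract"

definition content :: "('x, 'a::idom) mpoly \<Rightarrow> 'a fract set" where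
  "content f = generated_ideal coeff_ring (range (\<lambda>m. to_fract (Poly_Mapping.lookup f m)))"

definition polys_in :: "'x indet set \<Rightarrow> ('x, 'a::idom) mpoly set" where
  "polys_in X = {f. \<forall>m \<in> Poly_Mapping.keys f. Poly_Mapping.keys m \<subseteq> X}"

text \<open>The rings \<open>R[X]\<close>, \<open>R(X)\<close> and \<open>R\<langle>X\<rangle>\<close> for a set \<open>X\<close> of indeterminates.\<close>

definition poly_ring :: "'x indet set \<Rightarrow> ('x, 'a::idom) mpoly fract set" where
  "poly_ring X = to_fract ` polys_in X"

definition nagata_ring :: "'x indet set \<Rightarrow> ('x, 'a::idom) mpoly fract set" where
  "nagata_ring X =
     ring_of_fractions (poly_ring X)
       (to_fract ` {f \<in> polys_in X. content f = coeff_ring})"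

definition v_nagata_ring :: "'x indet set \<Rightarrow> ('x, 'a::idom) mpoly fract set" where
  "v_nagata_ring X =
     ring_of_fractions (poly_ring X)
       (to_fract ` {f \<in> polys_in X. f \<noteq> 0 \<and> v_closure coeff_ring (content f) = coeff_ring})"

end

theory Submission
  imports Defs
begin

text \<open>
  Let \<open>D\<close> be a domain with quotient field \<open>F\<close>, and write \<open>(D : u)\<close> for the conductor
  \<open>{d \<in> D. d * u \<in> D}\<close> of \<open>u \<in> F\<close>. As \<open>u\<close> belongs to \<open>D\<^sub>M\<close> if and only if \<open>(D : u)\<close> is not
  contained in \<open>M\<close>, the domain \<open>D\<close> is a \<open>t#\<close>-domain if and only if every maximal \<open>t\<close>-ideal \<open>M\<close> is
  isolated by some \<open>u \<in> F\<close>: \<open>M\<close> contains \<open>(D : u)\<close>, and no other maximal \<open>t\<close>-ideal does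
  (\<open>t_sharp_domain_iff\<close>). A maximal \<open>t\<close>-ideal that is itself a conductor is isolated for free.

  The maximal \<open>t\<close>-ideals of \<open>R[X]\<close> are of two kinds (\<open>t_Max_poly_ring_cases\<close>): the extensions
  \<open>P[X]\<close> of the maximal \<open>t\<close>-ideals \<open>P\<close> of \<open>R\<close>, and uppers, which for some indeterminate \<open>y\<close> meet
  \<open>R[X - {y}]\<close> only in \<open>0\<close>. To see this, \<open>R[X]\<close> is regarded as \<open>B[y]\<close> with \<open>B = R[X - {y}]\<close> for
  one indeterminate at a time: if \<open>M\<close> meets each of these \<open>B\<close> nontrivially, then \<open>M\<close> contains with a
  polynomial all its coefficients with respect to each \<open>y\<close>, and therefore those in \<open>R\<close>. The tool
  for \<open>B[y]\<close> over an arbitrary domain \<open>B\<close> is a Gauss lemma localized at a prime ideal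
  (\<open>Gauss_local\<close>). It also shows that an upper is the \<open>v\<close>-closure of a finite set, hence a
  conductor (\<open>upper_eq_conductor\<close>); so \<open>R[X]\<close> is a \<open>t#\<close>-domain as soon as all \<open>P[X]\<close> are isolated.

  The rings \<open>R(X)\<close> and \<open>R\<langle>X\<rangle>\<close> are rings of fractions \<open>R[X]\<^sub>S\<close> for a set \<open>S\<close> of polynomials outside
  of all \<open>P[X]\<close>. Their maximal \<open>t\<close>-ideals are the extensions of those of \<open>R[X]\<close> that do not meet
  \<open>S\<close>, so all \<open>P[X]\<close> and some of the uppers remain. An element that isolates an ideal in \<open>R[X]\<close>
  also does so in \<open>R[X]\<^sub>S\<close>. Conversely, if \<open>u\<close> isolates \<open>P[X]\<close> among the remaining ideals, then
  \<open>w * u\<close> isolates it among all, where \<open>w\<close> is a polynomial outside of \<open>P[X]\<close> that cancels the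
  denominator of \<open>u\<close> at every upper (\<open>clear_all_upper_denominators\<close>).

  Finally, an element of the quotient field of \<open>R\<close> that isolates \<open>P\<close> also isolates \<open>P[X]\<close>. For the
  converse, \<open>v\<close>-coherence makes the conductor of an isolating \<open>u\<close> the \<open>v\<close>-closure of a finite set,
  and the coefficients of that set lead back to an element that isolates \<open>P\<close>
  (\<open>t_sharp_base_if_poly_ring\<close>).
\<close>

section \<open>Domains inside a field and their maximal \<open>t\<close>-ideals\<close>

locale subdomain =
  fixes D :: "'k::field set"
  assumes zero_mem: "0 \<in> D" and one_mem: "1 \<in> D"
    and add_mem: "\<And>x y. x \<in> D \<Longrightarrow> y \<in> D \<Longrightarrow> x + y \<in> D"
    and mult_mem: "\<And>x y. x \<in> D \<Longrightarrow> y \<in> D \<Longrightarrow> x * y \<in> D"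
    and uminus_mem: "\<And>x. x \<in> D \<Longrightarrow> - x \<in> D"

definition ideal_of :: "'k::field set \<Rightarrow> 'k set \<Rightarrow> bool" where
  "ideal_of D I \<longleftrightarrow> I \<subseteq> D \<and> 0 \<in> I \<and> (\<forall>x\<in>I. \<forall>y\<in>I. x + y \<in> I) \<and> (\<forall>r\<in>D. \<forall>x\<in>I. r * x \<in> I)"

definition prime_ideal_of :: "'k::field set \<Rightarrow> 'k set \<Rightarrow> bool" where
  "prime_ideal_of D P \<longleftrightarrow>
     ideal_of D P \<and> 1 \<notin> P \<and> (\<forall>x\<in>D. \<forall>y\<in>D. x * y \<in> P \<longrightarrow> x \<in> P \<or> y \<in> P)"

text \<open>
  An element \<open>u\<close> of the quotient field lies in the localization of \<open>D\<close> at a prime ideal \<open>M\<close> if and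
  only if the conductor is not contained in \<open>M\<close>.
\<close>

definition conductor :: "'k::field set \<Rightarrow> 'k \<Rightarrow> 'k set" where
  "conductor D u = {d \<in> D. d * u \<in> D}"

text \<open>
  The nonzero ideals whose \<open>t\<close>-closure is proper: \<open>1\<close> is not in the \<open>v\<close>-closure of any finitely generated
  subideal. Stated by multipliers \<open>u\<close>, the condition is visibly inherited by unions of chains and
  can be carried from one ring to another by transforming \<open>u\<close>. The maximal ideals of this kind are
  the maximal \<open>t\<close>-ideals (\<open>t_Max_iff\<close>).
\<close>

definition t_proper :: "'k::field set \<Rightarrow> 'k set \<Rightarrow> bool" where
  "t_proper D I \<longleftrightarrow> ideal_of D I \<and> I \<noteq> {0} \<and>
     (\<forall>A. finite A \<and> A \<subseteq> I \<longrightarrow> (\<exists>u\<in>quotient_field D - D. \<forall>a\<in>A. u * a \<in> D))"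

lemma ideal_of_subset: "ideal_of D I \<Longrightarrow> x \<in> I \<Longrightarrow> x \<in> D"
  and ideal_of_zero: "ideal_of D I \<Longrightarrow> 0 \<in> I"
  and ideal_of_add: "ideal_of D I \<Longrightarrow> x \<in> I \<Longrightarrow> y \<in> I \<Longrightarrow> x + y \<in> I"
  and ideal_of_mult: "ideal_of D I \<Longrightarrow> r \<in> D \<Longrightarrow> x \<in> I \<Longrightarrow> r * x \<in> I"
  and ideal_of_mult_right: "ideal_of D I \<Longrightarrow> r \<in> D \<Longrightarrow> x \<in> I \<Longrightarrow> x * r \<in> I"
  unfolding ideal_of_def by (auto simp: mult.commute)

lemma ideal_of_sum:
  assumes "ideal_of D I" "\<And>a. a \<in> A \<Longrightarrow> f a \<in> I"
  shows "sum f A \<in> I"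
  using assms(2) by (induction A rule: infinite_finite_induct)
    (auto intro: ideal_of_zero[OF assms(1)] ideal_of_add[OF assms(1)])

abbreviation isolates :: "'k::field set \<Rightarrow> 'k set set \<Rightarrow> 'k \<Rightarrow> 'k set \<Rightarrow> bool" where
  "isolates D \<T> u M \<equiv> conductor D u \<subseteq> M \<and> (\<forall>N\<in>\<T>. conductor D u \<subseteq> N \<longrightarrow> N = M)"

context subdomain
begin

lemma sum_mem: "(\<And>a. a \<in> A \<Longrightarrow> f a \<in> D) \<Longrightarrow> sum f A \<in> D"
  by (induction A rule: infinite_finite_induct) (auto intro: zero_mem add_mem)

lemma prod_mem: "(\<And>a. a \<in> A \<Longrightarrow> f a \<in> D) \<Longrightarrow> prod f A \<in> D"
  by (induction A rule: infinite_finite_induct) (auto intro: one_mem mult_mem)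

lemma power_mem: "x \<in> D \<Longrightarrow> x ^ n \<in> D"
  by (induction n) (auto intro: one_mem mult_mem)

lemma divide_mem_quotient_field: "a \<in> D \<Longrightarrow> b \<in> D \<Longrightarrow> b \<noteq> 0 \<Longrightarrow> a / b \<in> quotient_field D"
  unfolding quotient_field_def by blast

lemma mem_quotient_field: "a \<in> D \<Longrightarrow> a \<in> quotient_field D"
  using divide_mem_quotient_field[of a 1] one_mem by simp

lemma quotient_field_cases:
  assumes "u \<in> quotient_field D"
  obtains a b where "a \<in> D" "b \<in> D" "b \<noteq> 0" "u = a / b"
  using assms unfolding quotient_field_def by blast

lemma subdomain_quotient_field: "subdomain (quotient_field D)"
proof
  show "0 \<in> quotient_field D" "1 \<in> quotient_field D"
    using mem_quotient_field zero_mem one_mem by auto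
  fix x y assume x: "x \<in> quotient_field D" and y: "y \<in> quotient_field D"
  obtain a b where ab: "a \<in> D" "b \<in> D" "b \<noteq> 0" "x = a / b"
    using x by (rule quotient_field_cases)
  obtain c d where cd: "c \<in> D" "d \<in> D" "d \<noteq> 0" "y = c / d"
    using y by (rule quotient_field_cases)
  have "x + y = (a * d + c * b) / (b * d)" "x * y = (a * c) / (b * d)"
    using ab cd by (simp_all add: field_simps)
  then show "x + y \<in> quotient_field D" "x * y \<in> quotient_field D"
    using ab cd by (auto intro!: divide_mem_quotient_field add_mem mult_mem)
next
  fix x assume x: "x \<in> quotient_field D"
  obtain a b where ab: "a \<in> D" "b \<in> D" "b \<noteq> 0" "x = a / b"
    using x by (rule quotient_field_cases)
  then have "- x = (- a) / b" by simp
  then show "- x \<in> quotient_field D"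
    using ab divide_mem_quotient_field[of "- a" b] uminus_mem by metis
qed

lemma quotient_field_mult: "x \<in> quotient_field D \<Longrightarrow> y \<in> quotient_field D \<Longrightarrow> x * y \<in> quotient_field D"
  using subdomain.mult_mem[OF subdomain_quotient_field] .

lemma quotient_field_divide:
  assumes x: "x \<in> quotient_field D" and y: "y \<in> quotient_field D"
  shows "x / y \<in> quotient_field D"
proof (cases "y = 0")
  case True then show ?thesis using mem_quotient_field[OF zero_mem] by simp
next
  case False
  obtain a b where ab: "a \<in> D" "b \<in> D" "b \<noteq> 0" "x = a / b"
    using x by (rule quotient_field_cases)
  obtain c d where cd: "c \<in> D" "d \<in> D" "d \<noteq> 0" "y = c / d"
    using y by (rule quotient_field_cases)
  have "c \<noteq> 0" using cd False by auto
  moreover have "x / y = (a * d) / (b * c)" unfolding ab(4) cd(4) by simp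
  ultimately show ?thesis using ab cd by (auto intro!: divide_mem_quotient_field mult_mem)
qed

lemma common_denominator:
  assumes "finite A" "A \<subseteq> quotient_field D"
  shows "\<exists>c\<in>D. c \<noteq> 0 \<and> (\<forall>a\<in>A. c * a \<in> D)"
  using assms
proof (induction A rule: finite_induct)
  case empty
  then show ?case using one_mem by (intro bexI[of _ 1]) auto
next
  case (insert x A)
  then obtain c where c: "c \<in> D" "c \<noteq> 0" "\<forall>a\<in>A. c * a \<in> D" by auto
  obtain a b where ab: "a \<in> D" "b \<in> D" "b \<noteq> 0" "x = a / b"
    using insert.prems by (auto elim: quotient_field_cases)
  have "b * c * y \<in> D" if "y \<in> insert x A" for y
  proof (cases "y = x")
    case True
    then have "b * c * y = c * a" using ab by simp
    then show ?thesis using mult_mem[OF c(1) ab(1)] by metis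
  next
    case False
    then show ?thesis using that c ab mult_mem[of b "c * y"] by (simp add: mult.assoc)
  qed
  then show ?case using ab c mult_mem by (intro bexI[of _ "b * c"]) auto
qed

lemma ideal_of_whole: "ideal_of D D"
  unfolding ideal_of_def using zero_mem add_mem mult_mem by auto

lemma ideal_of_uminus: "ideal_of D I \<Longrightarrow> x \<in> I \<Longrightarrow> - x \<in> I"
  using ideal_of_mult[of D I "- 1" x] one_mem uminus_mem by auto

lemma ideal_of_diff: "ideal_of D I \<Longrightarrow> x \<in> I \<Longrightarrow> y \<in> I \<Longrightarrow> x - y \<in> I"
  using ideal_of_add[of D I x "- y"] ideal_of_uminus[of I y] by simp

lemma ideal_of_conductor:
  shows "ideal_of D (conductor D u)"
  unfolding ideal_of_def conductor_def
  using zero_mem add_mem mult_mem by (auto simp: distrib_right mult.assoc)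

definition adjoin :: "'k set \<Rightarrow> 'k \<Rightarrow> 'k set" where
  "adjoin I x = {m + r * x | m r. m \<in> I \<and> r \<in> D}"

lemma adjoin:
  assumes I: "ideal_of D I" and x: "x \<in> D"
  shows "ideal_of D (adjoin I x)" "I \<subseteq> adjoin I x" "x \<in> adjoin I x"
proof -
  show "ideal_of D (adjoin I x)"
    unfolding ideal_of_def
  proof (intro conjI ballI)
    show "adjoin I x \<subseteq> D" unfolding adjoin_def
      using ideal_of_subset[OF I] x add_mem mult_mem by blast
    have "0 = 0 + 0 * x" by simp
    then show "0 \<in> adjoin I x" unfolding adjoin_def
      using ideal_of_zero[OF I] zero_mem by blast
    fix y assume "y \<in> adjoin I x"
    then obtain m r where mr: "m \<in> I" "r \<in> D" "y = m + r * x" unfolding adjoin_def by auto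
    { fix z assume "z \<in> adjoin I x"
      then obtain m' r' where mr': "m' \<in> I" "r' \<in> D" "z = m' + r' * x" unfolding adjoin_def by auto
      have "y + z = (m + m') + (r + r') * x" using mr mr' by (simp add: algebra_simps)
      then show "y + z \<in> adjoin I x" unfolding adjoin_def
        using mr mr' ideal_of_add[OF I] add_mem by blast }
    fix s assume s: "s \<in> D"
    have "s * y = s * m + (s * r) * x" using mr by (simp add: algebra_simps)
    then show "s * y \<in> adjoin I x" unfolding adjoin_def
      using mr s ideal_of_mult[OF I] mult_mem by blast
  qed
  show "I \<subseteq> adjoin I x"
  proof
    fix m assume "m \<in> I"
    moreover have "m = m + 0 * x" by simp
    ultimately show "m \<in> adjoin I x" unfolding adjoin_def using zero_mem by blast
  qed
  have "x = 0 + 1 * x" by simp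
  then show "x \<in> adjoin I x" unfolding adjoin_def using ideal_of_zero[OF I] one_mem by blast
qed

lemma t_proper_ideal: "t_proper D I \<Longrightarrow> ideal_of D I"
  and t_proper_witness: "t_proper D I \<Longrightarrow> finite A \<Longrightarrow> A \<subseteq> I \<Longrightarrow>
        \<exists>u\<in>quotient_field D - D. \<forall>a\<in>A. u * a \<in> D"
  unfolding t_proper_def by auto

lemma t_proper_one_notin: "t_proper D I \<Longrightarrow> 1 \<notin> I"
  using t_proper_witness[of I "{1}"] by fastforce

lemma t_proper_nonzero:
  assumes "t_proper D I" obtains x where "x \<in> I" "x \<noteq> 0"
proof -
  have "0 \<in> I" "I \<noteq> {0}" using assms unfolding t_proper_def ideal_of_def by auto
  then show ?thesis using that by auto
qed

lemma t_proper_conductor: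
  assumes "u \<in> quotient_field D" "u \<notin> D"
  shows "t_proper D (conductor D u)"
  unfolding t_proper_def
proof (intro conjI allI impI)
  show "ideal_of D (conductor D u)" by (rule ideal_of_conductor)
  obtain a b where ab: "a \<in> D" "b \<in> D" "b \<noteq> 0" "u = a / b"
    using assms(1) by (rule quotient_field_cases)
  then have "b \<in> conductor D u" unfolding conductor_def by auto
  then show "conductor D u \<noteq> {0}" using ab by auto
  fix A assume "finite A \<and> A \<subseteq> conductor D u"
  then show "\<exists>u\<in>quotient_field D - D. \<forall>a\<in>A. u * a \<in> D"
    using assms by (intro bexI[of _ u]) (auto simp: conductor_def mult.commute)
qed

definition max_t_proper :: "'k set \<Rightarrow> bool" where
  "max_t_proper M \<longleftrightarrow> t_proper D M \<and> (\<forall>N. t_proper D N \<and> M \<subseteq> N \<longrightarrow> N = M)"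

lemma finite_subset_Union_chain:
  assumes ne: "\<C> \<noteq> {}" and chain: "subset.chain \<A> \<C>" and A: "finite A" "A \<subseteq> \<Union>\<C>"
  shows "\<exists>J\<in>\<C>. A \<subseteq> J"
  using A
proof (induction A rule: finite_induct)
  case (insert x A)
  then obtain J J' where J: "J \<in> \<C>" "A \<subseteq> J" "J' \<in> \<C>" "x \<in> J'" by auto
  then have "J \<subseteq> J' \<or> J' \<subseteq> J" using chain unfolding subset.chain_def by blast
  then show ?case using J by blast
qed (use ne in auto)

lemma ideal_of_Union_chain:
  assumes ne: "\<C> \<noteq> {}" and chain: "subset.chain \<A> \<C>" and ideals: "\<And>J. J \<in> \<C> \<Longrightarrow> ideal_of D J"
  shows "ideal_of D (\<Union>\<C>)"
  unfolding ideal_of_def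
proof (intro conjI ballI)
  show "\<Union>\<C> \<subseteq> D" using ideals ideal_of_subset by blast
  show "0 \<in> \<Union>\<C>" using ne ideals ideal_of_zero by blast
  show "r * x \<in> \<Union>\<C>" if "r \<in> D" "x \<in> \<Union>\<C>" for r x
    using that ideals ideal_of_mult by blast
  show "x + y \<in> \<Union>\<C>" if "x \<in> \<Union>\<C>" "y \<in> \<Union>\<C>" for x y
  proof -
    have "{x, y} \<subseteq> \<Union>\<C>" using that by blast
    then obtain J where "J \<in> \<C>" "{x, y} \<subseteq> J"
      using finite_subset_Union_chain[OF ne chain, of "{x, y}"] by blast
    then show ?thesis using ideals ideal_of_add[of D J x y] by blast
  qed
qed

lemma ex_prime_ideal:
  assumes I: "ideal_of D I" "1 \<notin> I"
  obtains P where "prime_ideal_of D P" "I \<subseteq> P"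
proof -
  let ?\<A> = "{J. ideal_of D J \<and> 1 \<notin> J \<and> I \<subseteq> J}"
  have "\<exists>M\<in>?\<A>. \<forall>N\<in>?\<A>. M \<subseteq> N \<longrightarrow> N = M"
  proof (rule subset_Zorn_nonempty)
    show "?\<A> \<noteq> {}" using I by auto
    fix \<C> assume ne: "\<C> \<noteq> {}" and chain: "subset.chain ?\<A> \<C>"
    have "\<C> \<subseteq> ?\<A>" using chain unfolding subset.chain_def by blast
    moreover from this have "ideal_of D (\<Union>\<C>)" using ideal_of_Union_chain[OF ne chain] by blast
    ultimately show "\<Union>\<C> \<in> ?\<A>" using ne by blast
  qed
  then obtain M where "M \<in> ?\<A>" and max: "\<forall>N\<in>?\<A>. M \<subseteq> N \<longrightarrow> N = M" by (rule bexE)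
  then have M: "ideal_of D M" "1 \<notin> M" "I \<subseteq> M" by simp_all
  have maximal: "N = M" if "ideal_of D N" "1 \<notin> N" "M \<subseteq> N" for N
    using max that M(3) by (metis (mono_tags, lifting) mem_Collect_eq subset_trans)
  have whole: "\<exists>m\<in>M. \<exists>r\<in>D. 1 = m + r * x" if x: "x \<in> D" "x \<notin> M" for x
  proof -
    note adj = adjoin[OF M(1) x(1)]
    have "adjoin M x \<noteq> M" using adj(3) x(2) by blast
    then have "1 \<in> adjoin M x" using maximal[OF adj(1)] adj(2) by blast
    then show ?thesis unfolding adjoin_def by blast
  qed
  have "prime_ideal_of D M" unfolding prime_ideal_of_def
  proof (intro conjI ballI impI M(1,2))
    fix x y assume x: "x \<in> D" and y: "y \<in> D" and xy: "x * y \<in> M"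
    show "x \<in> M \<or> y \<in> M"
    proof (rule disjCI)
      assume "y \<notin> M"
      then obtain m r where mr: "m \<in> M" "r \<in> D" "1 = m + r * y" using whole y by blast
      have "x = x * m + r * (x * y)"
        using arg_cong[OF mr(3), of "\<lambda>z. x * z"] by (simp add: algebra_simps)
      moreover have "x * m + r * (x * y) \<in> M"
        using ideal_of_add[OF M(1)] ideal_of_mult[OF M(1)] x mr(1,2) xy by blast
      ultimately show "x \<in> M" by simp
    qed
  qed
  then show ?thesis using that M(3) by blast
qed

lemma ex_max_t_proper:
  assumes I: "t_proper D I"
  obtains M where "max_t_proper M" "I \<subseteq> M"
proof -
  let ?\<A> = "{J. t_proper D J \<and> I \<subseteq> J}"
  have "\<exists>M\<in>?\<A>. \<forall>N\<in>?\<A>. M \<subseteq> N \<longrightarrow> N = M"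
  proof (rule subset_Zorn_nonempty)
    show "?\<A> \<noteq> {}" using I by auto
    fix \<C> assume ne: "\<C> \<noteq> {}" and chain: "subset.chain ?\<A> \<C>"
    have \<C>: "\<And>J. J \<in> \<C> \<Longrightarrow> t_proper D J \<and> I \<subseteq> J"
      using chain unfolding subset.chain_def by auto
    have "ideal_of D (\<Union>\<C>)"
      by (rule ideal_of_Union_chain[OF ne chain]) (use \<C> t_proper_ideal in blast)
    moreover have "I \<subseteq> \<Union>\<C>" using ne \<C> by auto
    moreover have "\<Union>\<C> \<noteq> {0}"
      using \<open>I \<subseteq> \<Union>\<C>\<close> I t_proper_nonzero by (metis singletonD subsetD)
    moreover have "\<exists>u\<in>quotient_field D - D. \<forall>a\<in>A. u * a \<in> D" if "finite A \<and> A \<subseteq> \<Union>\<C>" for A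
      using finite_subset_Union_chain[OF ne chain, of A] that \<C> t_proper_witness by blast
    ultimately show "\<Union>\<C> \<in> ?\<A>" unfolding t_proper_def by blast
  qed
  then show ?thesis using that unfolding max_t_proper_def by (metis (mono_tags, lifting) mem_Collect_eq order_trans)
qed

text \<open>
  Adjoining such an element keeps an ideal \<open>t\<close>-proper, because it imposes no new condition on the
  multipliers. This is the closure property that defines \<open>t\<close>-ideals.
\<close>

lemma max_t_proper_closed:
  assumes M: "max_t_proper M" and A: "finite A" "A \<subseteq> M" and x: "x \<in> D"
    and dominated: "\<And>u. u \<in> quotient_field D \<Longrightarrow> \<forall>a\<in>A. u * a \<in> D \<Longrightarrow> u * x \<in> D"
  shows "x \<in> M"
proof -
  have tp: "t_proper D M" using M unfolding max_t_proper_def by auto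
  have idl: "ideal_of D M" by (rule t_proper_ideal[OF tp])
  note adj = adjoin[OF idl x]
  have "t_proper D (adjoin M x)"
    unfolding t_proper_def
  proof (intro conjI allI impI)
    show "adjoin M x \<noteq> {0}" using adj(2) t_proper_nonzero[OF tp] by (metis singletonD subsetD)
    fix B assume B: "finite B \<and> B \<subseteq> adjoin M x"
    then have "\<forall>b\<in>B. \<exists>m r. m \<in> M \<and> r \<in> D \<and> b = m + r * x" unfolding adjoin_def by blast
    then obtain m r where mr: "\<And>b. b \<in> B \<Longrightarrow> m b \<in> M \<and> r b \<in> D \<and> b = m b + r b * x" by metis
    obtain u where u: "u \<in> quotient_field D" "u \<notin> D" "\<forall>a\<in>A \<union> m ` B. u * a \<in> D"
      using t_proper_witness[OF tp, of "A \<union> m ` B"] A B mr by blast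
    then have ux: "u * x \<in> D" using dominated by auto
    have "u * b \<in> D" if "b \<in> B" for b
    proof -
      have "u * b = u * m b + r b * (u * x)" using mr[OF that] by (metis distrib_left mult.left_commute)
      then show ?thesis using u ux mr[OF that] that add_mem mult_mem by auto
    qed
    then show "\<exists>u\<in>quotient_field D - D. \<forall>b\<in>B. u * b \<in> D" using u by auto
  qed (rule adj(1))
  then have "adjoin M x = M" using M adj(2) unfolding max_t_proper_def by auto
  then show ?thesis using adj(3) by simp
qed

text \<open>
  If \<open>a * b\<close> is in \<open>M\<close> and \<open>b\<close> is not, then adjoining \<open>b\<close> to \<open>M\<close> yields a finite set that allows only
  multipliers in \<open>D\<close>. Write its elements as \<open>m + r * b\<close>. Whenever \<open>u\<close> maps \<open>a * b\<close> and all
  the \<open>m\<close> into \<open>D\<close>, then \<open>u * a\<close> maps that finite set into \<open>D\<close>; so \<open>u * a\<close> is in \<open>D\<close>, and \<open>a\<close> belongs to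
  \<open>M\<close> by the closure property.
\<close>

lemma max_t_proper_prime:
  assumes M: "max_t_proper M"
  shows "prime_ideal_of D M"
  unfolding prime_ideal_of_def
proof (intro conjI ballI impI)
  have tp: "t_proper D M" using M unfolding max_t_proper_def by auto
  show idl: "ideal_of D M" by (rule t_proper_ideal[OF tp])
  show "1 \<notin> M" by (rule t_proper_one_notin[OF tp])
  fix a b assume a: "a \<in> D" and b: "b \<in> D" and ab: "a * b \<in> M"
  show "a \<in> M \<or> b \<in> M"
  proof (rule disjCI)
    assume bM: "b \<notin> M"
    note adj = adjoin[OF idl b]
    have "\<not> t_proper D (adjoin M b)"
      using M adj(2,3) bM unfolding max_t_proper_def by auto
    moreover have "adjoin M b \<noteq> {0}" using adj(2) t_proper_nonzero[OF tp] by (metis singletonD subsetD)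
    ultimately obtain B where B: "finite B" "B \<subseteq> adjoin M b"
      and Bu: "\<And>u. u \<in> quotient_field D \<Longrightarrow> \<forall>c\<in>B. u * c \<in> D \<Longrightarrow> u \<in> D"
      using adj(1) unfolding t_proper_def by blast
    have "\<forall>c\<in>B. \<exists>m r. m \<in> M \<and> r \<in> D \<and> c = m + r * b" using B(2) unfolding adjoin_def by blast
    then obtain m r where mr: "\<And>c. c \<in> B \<Longrightarrow> m c \<in> M \<and> r c \<in> D \<and> c = m c + r c * b" by metis
    show "a \<in> M"
    proof (rule max_t_proper_closed[OF M _ _ a])
      show "finite (insert (a * b) (m ` B))" using B by auto
      show "insert (a * b) (m ` B) \<subseteq> M" using ab mr by auto
      fix u assume u: "u \<in> quotient_field D" "\<forall>c\<in>insert (a * b) (m ` B). u * c \<in> D"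
      show "u * a \<in> D"
      proof (rule Bu)
        show "u * a \<in> quotient_field D" using u a quotient_field_mult mem_quotient_field by blast
        show "\<forall>c\<in>B. u * a * c \<in> D"
        proof
          fix c assume c: "c \<in> B"
          have "u * a * c = a * (u * m c) + r c * (u * (a * b))"
            using mr[OF c] by (metis distrib_left mult.assoc mult.left_commute)
          moreover have "a * (u * m c) \<in> D" using u a c mult_mem by auto
          moreover have "r c * (u * (a * b)) \<in> D" using u mr[OF c] mult_mem by auto
          ultimately show "u * a * c \<in> D" using add_mem by simp
        qed
      qed
    qed
  qed
qed

lemma mem_generated_ideal:
  assumes "a \<in> A" shows "a \<in> generated_ideal D A"
proof -
  have "a = (\<Sum>b\<in>{a}. 1 * b)" by simp
  then show ?thesis unfolding generated_ideal_def using assms one_mem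
    by (intro CollectI exI[of _ "{a}"] exI[of _ "\<lambda>_. 1"]) auto
qed

lemma generated_idealE:
  assumes "x \<in> generated_ideal D A"
  obtains B r where "finite B" "B \<subseteq> A" "\<forall>a\<in>B. r a \<in> D" "x = (\<Sum>a\<in>B. r a * a)"
  using assms unfolding generated_ideal_def by (auto simp: image_subset_iff)

lemma generated_idealI:
  assumes "finite B" "B \<subseteq> A" "\<forall>a\<in>B. r a \<in> D" "x = (\<Sum>a\<in>B. r a * a)"
  shows "x \<in> generated_ideal D A"
  using assms unfolding generated_ideal_def by (auto simp: image_subset_iff)

lemma generated_ideal_add:
  assumes "x \<in> generated_ideal D A" "y \<in> generated_ideal D A"
  shows "x + y \<in> generated_ideal D A"
proof -
  obtain B r where B: "finite B" "B \<subseteq> A" "\<forall>a\<in>B. r a \<in> D" "x = (\<Sum>a\<in>B. r a * a)"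
    using assms(1) by (rule generated_idealE)
  obtain C s where C: "finite C" "C \<subseteq> A" "\<forall>a\<in>C. s a \<in> D" "y = (\<Sum>a\<in>C. s a * a)"
    using assms(2) by (rule generated_idealE)
  let ?q = "\<lambda>a. (if a \<in> B then r a else 0) + (if a \<in> C then s a else 0)"
  have "x = (\<Sum>a\<in>B \<union> C. (if a \<in> B then r a else 0) * a)"
    unfolding B(4) by (rule sum.mono_neutral_cong_left) (use B C in auto)
  moreover have "y = (\<Sum>a\<in>B \<union> C. (if a \<in> C then s a else 0) * a)"
    unfolding C(4) by (rule sum.mono_neutral_cong_left) (use B C in auto)
  ultimately have "x + y = (\<Sum>a\<in>B \<union> C. ?q a * a)"
    by (simp add: sum.distrib distrib_right)
  moreover have "?q a \<in> D" for a using B(3) C(3) add_mem zero_mem by simp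
  ultimately show ?thesis using B C by (intro generated_idealI[of "B \<union> C" A ?q]) auto
qed

lemma generated_ideal_mult:
  assumes "x \<in> generated_ideal D A" "d \<in> D"
  shows "d * x \<in> generated_ideal D A"
proof -
  obtain B r where B: "finite B" "B \<subseteq> A" "\<forall>a\<in>B. r a \<in> D" "x = (\<Sum>a\<in>B. r a * a)"
    using assms(1) by (rule generated_idealE)
  have "d * x = (\<Sum>a\<in>B. (d * r a) * a)" unfolding B(4) by (simp add: sum_distrib_left mult.assoc)
  then show ?thesis using B assms(2) mult_mem
    by (intro generated_idealI[of B A "\<lambda>a. d * r a"]) auto
qed

lemma zero_mem_generated_ideal: "0 \<in> generated_ideal D A"
  unfolding generated_ideal_def by (intro CollectI exI[of _ "{}"]) auto

lemma generated_ideal_multiplier: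
  assumes "\<And>a. a \<in> A \<Longrightarrow> u * a \<in> D" "x \<in> generated_ideal D A"
  shows "u * x \<in> D"
proof -
  obtain B r where B: "finite B" "B \<subseteq> A" "\<forall>a\<in>B. r a \<in> D" "x = (\<Sum>a\<in>B. r a * a)"
    using assms(2) by (rule generated_idealE)
  have eq: "u * x = (\<Sum>a\<in>B. r a * (u * a))" unfolding B(4)
    by (simp add: sum_distrib_left mult.left_commute)
  have "r a * (u * a) \<in> D" if "a \<in> B" for a
    using that B(2,3) assms(1) mult_mem by blast
  then show ?thesis unfolding eq by (rule sum_mem)
qed

lemma generated_ideal_least:
  assumes "ideal_of D I" "A \<subseteq> I" shows "generated_ideal D A \<subseteq> I"
proof
  fix x assume "x \<in> generated_ideal D A"
  then obtain B r where B: "finite B" "B \<subseteq> A" "\<forall>a\<in>B. r a \<in> D" "x = (\<Sum>a\<in>B. r a * a)"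
    by (rule generated_idealE)
  show "x \<in> I" unfolding B(4)
    using assms B by (intro ideal_of_sum[OF assms(1)] ideal_of_mult[OF assms(1)]) auto
qed

lemma fg_generated_ideal:
  assumes "finite A" "A \<subseteq> quotient_field D"
  shows "fg_fractional_ideal D (generated_ideal D A)"
  unfolding fg_fractional_ideal_def fractional_ideal_def
proof (intro conjI ballI)
  obtain c where c: "c \<in> D" "c \<noteq> 0" "\<forall>a\<in>A. c * a \<in> D" using common_denominator[OF assms] by auto
  then show "\<exists>d\<in>D. d \<noteq> 0 \<and> (\<forall>x\<in>generated_ideal D A. d * x \<in> D)"
    using generated_ideal_multiplier[of A c] by blast
  show "generated_ideal D A \<subseteq> quotient_field D"
  proof
    fix x assume "x \<in> generated_ideal D A"
    then obtain B r where B: "finite B" "B \<subseteq> A" "\<forall>a\<in>B. r a \<in> D" "x = (\<Sum>a\<in>B. r a * a)"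
    by (rule generated_idealE)
    show "x \<in> quotient_field D" unfolding B(4)
      using B assms mem_quotient_field
      by (intro subdomain.sum_mem[OF subdomain_quotient_field] quotient_field_mult) auto
  qed
qed (use assms zero_mem_generated_ideal generated_ideal_add generated_ideal_mult in auto)

lemma inverse_generated_ideal:
  "inverse_ideal D (generated_ideal D A) = {u \<in> quotient_field D. \<forall>a\<in>A. u * a \<in> D}"
  unfolding inverse_ideal_def using mem_generated_ideal[of _ A] generated_ideal_multiplier[of A] by blast

lemma mem_v_closure_generated_iff:
  "x \<in> v_closure D (generated_ideal D A) \<longleftrightarrow>
     x \<in> quotient_field D \<and> (\<forall>u\<in>quotient_field D. (\<forall>a\<in>A. u * a \<in> D) \<longrightarrow> u * x \<in> D)"
  unfolding v_closure_def inverse_generated_ideal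
  by (auto simp: inverse_ideal_def mult.commute)

lemma fg_fractional_idealE:
  assumes "fg_fractional_ideal D J"
  obtains A where "finite A" "A \<subseteq> quotient_field D" "J = generated_ideal D A"
  using assms unfolding fg_fractional_ideal_def by blast

lemma v_closure_generated_subset_t_closure:
  assumes "finite A" "A \<subseteq> I" "I \<subseteq> quotient_field D" "ideal_of D I" "a \<in> A" "a \<noteq> 0"
  shows "v_closure D (generated_ideal D A) \<subseteq> t_closure D I"
proof -
  have "fg_fractional_ideal D (generated_ideal D A)"
    using assms by (intro fg_generated_ideal) auto
  moreover have "generated_ideal D A \<noteq> {0}" using mem_generated_ideal[of a A] assms by auto
  moreover have "generated_ideal D A \<subseteq> I" by (rule generated_ideal_least) (use assms in auto)
  ultimately show ?thesis unfolding t_closure_def by blast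
qed

lemma t_proper_if_t_ideal:
  assumes "proper_integral_t_ideal D I"
  shows "t_proper D I"
proof -
  have I: "I \<subseteq> D" "0 \<in> I" "\<forall>x\<in>I. \<forall>y\<in>I. x + y \<in> I" "\<forall>r\<in>D. \<forall>x\<in>I. r * x \<in> I"
      "I \<noteq> {0}" "t_closure D I = I" "I \<noteq> D"
    using assms unfolding proper_integral_t_ideal_def integral_ideal_def t_ideal_def
      fractional_ideal_def by auto
  have idl: "ideal_of D I" using I unfolding ideal_of_def by auto
  have one: "1 \<notin> I"
  proof
    assume "1 \<in> I"
    then have "D \<subseteq> I" using I(4) by (metis mult.right_neutral subsetI)
    then show False using I by auto
  qed
  obtain i where i: "i \<in> I" "i \<noteq> 0" using I by auto
  show ?thesis unfolding t_proper_def
  proof (intro conjI allI impI idl I(5))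
    fix A assume A: "finite A \<and> A \<subseteq> I"
    have "v_closure D (generated_ideal D (insert i A)) \<subseteq> I"
      using v_closure_generated_subset_t_closure[of "insert i A" I i] A i I(1,6) idl mem_quotient_field
      by blast
    then have "1 \<notin> v_closure D (generated_ideal D (insert i A))" using one by auto
    then show "\<exists>u\<in>quotient_field D - D. \<forall>a\<in>A. u * a \<in> D"
      unfolding mem_v_closure_generated_iff using mem_quotient_field one_mem by auto
  qed
qed

lemma t_ideal_if_max_t_proper:
  assumes M: "max_t_proper M"
  shows "proper_integral_t_ideal D M"
proof -
  have tp: "t_proper D M" using M unfolding max_t_proper_def by auto
  note idl = t_proper_ideal[OF tp]
  have sub: "M \<subseteq> D" "M \<subseteq> quotient_field D" using ideal_of_subset[OF idl] mem_quotient_field by auto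
  have frac: "fractional_ideal D M"
    unfolding fractional_ideal_def using idl sub one_mem
    by (auto simp: ideal_of_def intro!: bexI[of _ 1])
  have "M \<subseteq> t_closure D M"
  proof
    fix x assume x: "x \<in> M"
    obtain i where i: "i \<in> M" "i \<noteq> 0" using t_proper_nonzero[OF tp] .
    have "x \<in> v_closure D (generated_ideal D {i, x})"
      unfolding mem_v_closure_generated_iff using x sub by auto
    then show "x \<in> t_closure D M"
      using v_closure_generated_subset_t_closure[of "{i, x}" M i] x i sub idl by auto
  qed
  moreover have "t_closure D M \<subseteq> M"
  proof
    fix x assume "x \<in> t_closure D M"
    then obtain J where J: "fg_fractional_ideal D J" "J \<subseteq> M" "x \<in> v_closure D J"
      unfolding t_closure_def by auto
    obtain A where A: "finite A" "A \<subseteq> quotient_field D" "J = generated_ideal D A"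
      using J(1) by (rule fg_fractional_idealE)
    have AM: "A \<subseteq> M" using mem_generated_ideal J A by auto
    have x: "\<forall>u\<in>quotient_field D. (\<forall>a\<in>A. u * a \<in> D) \<longrightarrow> u * x \<in> D"
      using J(3) unfolding A(3) mem_v_closure_generated_iff by auto
    have "1 * x \<in> D" using x[rule_format, of 1] AM sub mem_quotient_field one_mem by auto
    then show "x \<in> M" using max_t_proper_closed[OF M A(1) AM] x by auto
  qed
  moreover have "M \<noteq> D" using t_proper_one_notin[OF tp] one_mem by auto
  ultimately show ?thesis
    unfolding proper_integral_t_ideal_def integral_ideal_def t_ideal_def
    using frac sub tp unfolding t_proper_def by auto
qed

lemma t_Max_iff: "M \<in> t_Max D \<longleftrightarrow> max_t_proper M"
proof
  assume M: "M \<in> t_Max D"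
  then have tp: "t_proper D M" using t_proper_if_t_ideal unfolding t_Max_def by auto
  obtain N where N: "max_t_proper N" "M \<subseteq> N" using ex_max_t_proper[OF tp] .
  then have "N = M" using M t_ideal_if_max_t_proper unfolding t_Max_def by auto
  then show "max_t_proper M" using N by simp
next
  assume M: "max_t_proper M"
  then show "M \<in> t_Max D"
    using t_ideal_if_max_t_proper[OF M] t_proper_if_t_ideal
    unfolding t_Max_def max_t_proper_def[of M] by simp
qed

lemma t_Max_t_proper: "M \<in> t_Max D \<Longrightarrow> t_proper D M"
  and t_Max_maximal: "M \<in> t_Max D \<Longrightarrow> t_proper D N \<Longrightarrow> M \<subseteq> N \<Longrightarrow> N = M"
  and t_MaxI: "t_proper D M \<Longrightarrow> (\<And>N. t_proper D N \<Longrightarrow> M \<subseteq> N \<Longrightarrow> N = M) \<Longrightarrow> M \<in> t_Max D"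
  unfolding t_Max_iff max_t_proper_def by auto

lemma t_Max_ideal: "M \<in> t_Max D \<Longrightarrow> ideal_of D M"
  using t_Max_t_proper t_proper_ideal by blast

lemmas t_Max_closed = max_t_proper_closed[folded t_Max_iff]
lemmas t_Max_prime = max_t_proper_prime[folded t_Max_iff]

lemma ex_t_Max:
  assumes "t_proper D I" obtains M where "M \<in> t_Max D" "I \<subseteq> M"
  using ex_max_t_proper[OF assms, folded t_Max_iff] .

lemma t_Max_antichain: "M \<in> t_Max D \<Longrightarrow> N \<in> t_Max D \<Longrightarrow> M \<subseteq> N \<Longrightarrow> N = M"
  using t_Max_maximal t_Max_t_proper by blast

text \<open>
  The conductor of an element outside of \<open>D\<close> is \<open>t\<close>-proper, so it is contained in some maximal
  \<open>t\<close>-ideal.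
\<close>

lemma mem_if_locally_mem:
  assumes "u \<in> quotient_field D" "\<And>M. M \<in> t_Max D \<Longrightarrow> \<exists>d\<in>D - M. d * u \<in> D"
  shows "u \<in> D"
proof (rule ccontr)
  assume "u \<notin> D"
  obtain M where "M \<in> t_Max D" "conductor D u \<subseteq> M"
    using ex_t_Max[OF t_proper_conductor[OF assms(1) \<open>u \<notin> D\<close>]] .
  then show False using assms(2) unfolding conductor_def by blast
qed

lemma mem_localization_iff:
  assumes "0 \<in> M"
  shows "u \<in> localization D M \<longleftrightarrow> \<not> conductor D u \<subseteq> M"
proof
  assume "u \<in> localization D M"
  then obtain a s where as: "a \<in> D" "s \<in> D - M" "u = a / s"
    unfolding localization_def ring_of_fractions_def by auto
  then have "s \<noteq> 0" using assms by auto
  then have "s \<in> conductor D u" using as unfolding conductor_def by auto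
  then show "\<not> conductor D u \<subseteq> M" using as by auto
next
  assume "\<not> conductor D u \<subseteq> M"
  then obtain d where d: "d \<in> D - M" "d * u \<in> D" unfolding conductor_def by auto
  then have "d \<noteq> 0" using assms by auto
  then have "u = (d * u) / d" by simp
  then show "u \<in> localization D M" unfolding localization_def ring_of_fractions_def using d by blast
qed

text \<open>
  Comparing the family of all maximal \<open>t\<close>-ideals with the family that omits \<open>M\<close> shows that the
  condition is necessary. Conversely, if \<open>M\<close> belongs to only one of two families, the element \<open>u\<close>
  that isolates \<open>M\<close> lies in exactly one of the two intersections.
\<close>

lemma t_sharp_domain_iff:
  "t_sharp_domain D \<longleftrightarrow> (\<forall>M\<in>t_Max D. \<exists>u\<in>quotient_field D.
     isolates D (t_Max D) u M)"
proof -
  let ?int = "\<lambda>\<M>. quotient_field D \<inter> (\<Inter>M\<in>\<M>. localization D M)"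
  have loc: "\<And>u M. M \<in> t_Max D \<Longrightarrow> u \<in> localization D M \<longleftrightarrow> \<not> conductor D u \<subseteq> M"
    by (rule mem_localization_iff[OF ideal_of_zero[OF t_Max_ideal]])
  show ?thesis
  proof
    assume sharp: "t_sharp_domain D"
    show "\<forall>M\<in>t_Max D. \<exists>u\<in>quotient_field D.
        isolates D (t_Max D) u M"
    proof
      fix M assume M: "M \<in> t_Max D"
      have "?int (t_Max D) \<noteq> ?int (t_Max D - {M})"
        using sharp[unfolded t_sharp_domain_def, rule_format, of "t_Max D" "t_Max D - {M}"] M by auto
      then obtain u where u: "u \<in> ?int (t_Max D - {M})" "u \<notin> ?int (t_Max D)" by blast
      then have "u \<notin> localization D M" by blast
      then have "conductor D u \<subseteq> M" using loc[OF M] by simp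
      moreover have "\<forall>N\<in>t_Max D. conductor D u \<subseteq> N \<longrightarrow> N = M" using u loc by auto
      ultimately show "\<exists>u\<in>quotient_field D.
          isolates D (t_Max D) u M"
        using u(1) by (intro bexI[of _ u]) simp_all
    qed
  next
    assume iso: "\<forall>M\<in>t_Max D. \<exists>u\<in>quotient_field D.
        isolates D (t_Max D) u M"
    have sep: "?int \<M> \<noteq> ?int \<N>" if "\<M> \<subseteq> t_Max D" "\<N> \<subseteq> t_Max D" "M \<in> \<M>" "M \<notin> \<N>" for \<M> \<N> M
    proof -
      obtain u where u: "u \<in> quotient_field D" "conductor D u \<subseteq> M"
          "\<forall>N\<in>t_Max D. conductor D u \<subseteq> N \<longrightarrow> N = M" using iso \<open>\<M> \<subseteq> t_Max D\<close> \<open>M \<in> \<M>\<close> by (meson subsetD)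
      have "u \<notin> localization D M"
        using u(2) loc[of M u] \<open>\<M> \<subseteq> t_Max D\<close> \<open>M \<in> \<M>\<close> by blast
      then have "u \<notin> ?int \<M>" using \<open>M \<in> \<M>\<close> by blast
      moreover have "u \<in> localization D N" if "N \<in> \<N>" for N
        using u(3) that \<open>\<N> \<subseteq> t_Max D\<close> \<open>M \<notin> \<N>\<close> loc[of N u] by blast
      then have "u \<in> ?int \<N>" using u(1) by simp
      ultimately show ?thesis by metis
    qed
    show "t_sharp_domain D" unfolding t_sharp_domain_def
    proof (intro allI impI)
      fix \<M> \<N> assume *: "\<M> \<subseteq> t_Max D \<and> \<N> \<subseteq> t_Max D \<and> \<M> \<noteq> \<N>"
      then consider M where "M \<in> \<M>" "M \<notin> \<N>" | M where "M \<in> \<N>" "M \<notin> \<M>" by auto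
      then show "?int \<M> \<noteq> ?int \<N>"
      proof cases
        case 1 then show ?thesis using sep[of \<M> \<N> M] * by simp
      next
        case 2 then show ?thesis using sep[of \<N> \<M> M] * by (metis)
      qed
    qed
  qed
qed

end

section \<open>Polynomials in one variable over a domain\<close>

definition polys_over :: "'k::field set \<Rightarrow> 'k poly set" where
  "polys_over B = {p. \<forall>i. coeff p i \<in> B}"

text \<open>
  The ring \<open>B[y]\<close>. For an ideal \<open>P\<close> of \<open>B\<close> in place of \<open>B\<close> it is the extended ideal \<open>P[y]\<close>.
\<close>

definition polys_at :: "'k::field set \<Rightarrow> 'k \<Rightarrow> 'k set" where
  "polys_at B y = (\<lambda>p. poly p y) ` polys_over B"

context subdomain
begin

lemma polys_over_0: "0 \<in> polys_over D"
  and polys_over_1: "1 \<in> polys_over D"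
  and polys_over_add: "p \<in> polys_over D \<Longrightarrow> q \<in> polys_over D \<Longrightarrow> p + q \<in> polys_over D"
  and polys_over_uminus: "p \<in> polys_over D \<Longrightarrow> - p \<in> polys_over D"
  and polys_over_mult: "p \<in> polys_over D \<Longrightarrow> q \<in> polys_over D \<Longrightarrow> p * q \<in> polys_over D"
  and polys_over_smult: "c \<in> D \<Longrightarrow> p \<in> polys_over D \<Longrightarrow> smult c p \<in> polys_over D"
  and polys_over_monom: "c \<in> D \<Longrightarrow> monom c n \<in> polys_over D"
  and polys_over_const: "c \<in> D \<Longrightarrow> [:c:] \<in> polys_over D"
  unfolding polys_over_def
  by (auto simp: coeff_mult coeff_pCons zero_mem one_mem split: nat.split
      intro!: add_mem mult_mem uminus_mem sum_mem)

lemma polys_over_diff: "p \<in> polys_over D \<Longrightarrow> q \<in> polys_over D \<Longrightarrow> p - q \<in> polys_over D"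
  using polys_over_add[of p "- q"] polys_over_uminus[of q] by simp

lemma polys_over_coeff: "p \<in> polys_over D \<Longrightarrow> coeff p i \<in> D"
  unfolding polys_over_def by simp

lemma polys_over_common_denominator:
  assumes "p \<in> polys_over (quotient_field D)"
  shows "\<exists>c\<in>D. c \<noteq> 0 \<and> smult c p \<in> polys_over D"
proof -
  have "coeff p ` {..degree p} \<subseteq> quotient_field D" using assms unfolding polys_over_def by auto
  then obtain c where c: "c \<in> D" "c \<noteq> 0" "\<forall>a\<in>coeff p ` {..degree p}. c * a \<in> D"
    using common_denominator[of "coeff p ` {..degree p}"] by auto
  have "c * coeff p i \<in> D" for i
  proof (cases "i \<le> degree p")
    case False
    then show ?thesis by (simp add: coeff_eq_0 zero_mem)
  qed (use c in auto)
  then show ?thesis using c unfolding polys_over_def by auto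
qed

text \<open>
  If \<open>u\<close> has degree \<open>m\<close> and \<open>c\<close> is the leading coefficient of \<open>g\<close>, then \<open>c\<close> times the leading
  coefficient of \<open>u\<close> is a coefficient of \<open>g * u\<close>. So \<open>c * u\<close> without its leading term satisfies the
  same hypothesis and has smaller degree.
\<close>

lemma power_leading_coeff_times_mem:
  assumes g: "g \<in> polys_over D" "degree g = n" and gu: "g * u \<in> polys_over D"
  shows "\<exists>K. smult (coeff g n ^ K) u \<in> polys_over D"
proof -
  let ?c = "coeff g n"
  have c: "?c \<in> D" by (rule polys_over_coeff[OF g(1)])
  have "\<exists>K. smult (?c ^ K) u \<in> polys_over D"
    if "g * u \<in> polys_over D" "\<forall>i\<ge>m. coeff u i = 0" for m u
    using that
  proof (induction m arbitrary: u)
    case 0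
    then have "u = 0" by (intro poly_eqI) auto
    then show ?case using polys_over_0 by auto
  next
    case (Suc m)
    let ?v = "smult ?c u - monom (?c * coeff u m) m"
    have deg: "degree u \<le> m" using Suc.prems(2) by (intro degree_le) auto
    have top: "?c * coeff u m \<in> D"
    proof (cases "coeff u m = 0")
      case False
      then have "degree u = m" using deg le_degree by (metis le_antisym)
      then have "coeff (g * u) (n + m) = ?c * coeff u m" using g(2) coeff_mult_degree_sum by metis
      then show ?thesis using polys_over_coeff[OF Suc.prems(1)] by metis
    qed (simp add: zero_mem)
    have "g * ?v = smult ?c (g * u) - g * monom (?c * coeff u m) m" by (simp add: algebra_simps)
    then have "g * ?v \<in> polys_over D"
      using polys_over_diff polys_over_smult[OF c Suc.prems(1)] polys_over_mult[OF g(1) polys_over_monom[OF top]]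
      by metis
    moreover have "\<forall>i\<ge>m. coeff ?v i = 0"
    proof (intro allI impI)
      fix i assume "i \<ge> m"
      then show "coeff ?v i = 0" using Suc.prems(2) by (cases "i = m") auto
    qed
    ultimately obtain K where "smult (?c ^ K) ?v \<in> polys_over D" using Suc.IH by blast
    moreover have "smult (?c ^ K) (monom (?c * coeff u m) m) \<in> polys_over D"
      by (intro polys_over_smult polys_over_monom top power_mem c)
    moreover have "smult (?c ^ Suc K) u = smult (?c ^ K) ?v + smult (?c ^ K) (monom (?c * coeff u m) m)"
      by (simp add: smult_diff_right mult.commute)
    ultimately have "smult (?c ^ Suc K) u \<in> polys_over D" using polys_over_add by metis
    then show ?case by blast
  qed
  moreover have "\<forall>i\<ge>Suc (degree u). coeff u i = 0" by (simp add: Suc_le_eq coeff_eq_0)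
  ultimately show ?thesis using gu by blast
qed

text \<open>
  A power of the leading coefficient \<open>c\<close> of \<open>g\<close> maps \<open>u\<close> into the polynomial ring; this is enough if
  \<open>c\<close> is not in \<open>P\<close>. Otherwise the power is lowered one step at a time: whenever \<open>c * v\<close> and \<open>g * v\<close>
  have coefficients in the domain, so has the product of \<open>v\<close> with \<open>g\<close> minus its leading term, and
  induction on the degree of \<open>g\<close> applies to it.
\<close>

lemma Gauss_local:
  assumes P: "prime_ideal_of D P" and g: "g \<in> polys_over D" and gP: "\<exists>i. coeff g i \<notin> P"
    and gu: "g * u \<in> polys_over D"
  shows "\<exists>r\<in>D - P. smult r u \<in> polys_over D"
proof -
  have idl: "ideal_of D P" and one: "1 \<notin> P" 
    and prime: "\<And>x y. x \<in> D \<Longrightarrow> y \<in> D \<Longrightarrow> x * y \<in> P \<Longrightarrow> x \<in> P \<or> y \<in> P"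
    using P unfolding prime_ideal_of_def by auto
  have "\<exists>r\<in>D - P. smult r u \<in> polys_over D"
    if "g \<in> polys_over D" "\<exists>i. coeff g i \<notin> P" "g * u \<in> polys_over D" "\<forall>i\<ge>n. coeff g i = 0" for n g u
    using that
  proof (induction n arbitrary: g u)
    case 0
    then show ?case using ideal_of_zero[OF idl] by auto
  next
    case (Suc n g u)
    note IH = Suc.IH and g = Suc.prems(1) and gP = Suc.prems(2) and gu = Suc.prems(3)
      and bound = Suc.prems(4)
    let ?c = "coeff g n"
    have c: "?c \<in> D" by (rule polys_over_coeff[OF g])
    show ?case
    proof (cases "?c = 0")
      case True
      then have "\<forall>i\<ge>n. coeff g i = 0" using bound by (metis Suc_leI le_less)
      then show ?thesis using IH[OF g gP gu] by blast
    next
      case False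
      then have "degree g = n"
        using bound by (intro order_antisym degree_le le_degree) auto
      then obtain K where K: "smult (?c ^ K) u \<in> polys_over D"
        using power_leading_coeff_times_mem g gu by blast
      show ?thesis
      proof (cases "?c \<in> P")
        case False
        have "?c ^ k \<notin> P" for k
          by (induction k) (use one prime[OF c] power_mem[OF c] False in auto)
        then show ?thesis using K power_mem[OF c] by blast
      next
        case True
        let ?h = "g - monom ?c n"
        have h: "?h \<in> polys_over D" by (intro polys_over_diff polys_over_monom c g)
        have hP: "\<exists>i. coeff ?h i \<notin> P"
        proof -
          obtain i where i: "coeff g i \<notin> P" using gP by auto
          then have "i \<noteq> n" using True by auto
          then show ?thesis using i by (intro exI[of _ i]) simp
        qed
        have h0: "\<forall>i\<ge>n. coeff ?h i = 0"
        proof (intro allI impI)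
          fix i assume "i \<ge> n"
          then show "coeff ?h i = 0" using bound by (cases "i = n") auto
        qed
        have "\<exists>r\<in>D - P. smult r (smult (?c ^ k) u) \<in> polys_over D" if "k \<le> K" for k
          using that
        \<comment> \<open>downwards from \<open>K\<close>; the factor \<open>r\<close> pays for each power of the leading coefficient\<close>
        proof (induction k rule: inc_induct)
          case base
          then show ?case using K one one_mem by (intro bexI[of _ 1]) auto
        next
          case (step k)
          then obtain r where r: "r \<in> D" "r \<notin> P" "smult r (smult (?c ^ Suc k) u) \<in> polys_over D" by auto
          let ?v = "smult (r * ?c ^ k) u"
          have cv: "smult ?c ?v \<in> polys_over D" using r(3) by (simp add: ac_simps)
          have "g * ?v \<in> polys_over D"
            using polys_over_smult[OF mult_mem[OF r(1) power_mem[OF c]] gu, of k] by simp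
          moreover have "monom ?c n * ?v = monom 1 n * smult ?c ?v"
            by (simp add: smult_monom flip: mult_smult_left)
          moreover have "monom 1 n * smult ?c ?v \<in> polys_over D"
            by (intro polys_over_mult polys_over_monom one_mem cv)
          ultimately have "?h * ?v \<in> polys_over D"
            using polys_over_diff unfolding left_diff_distrib by metis
          then obtain r' where r': "r' \<in> D" "r' \<notin> P" "smult r' ?v \<in> polys_over D"
            using IH[OF h hP _ h0, of ?v] by blast
          then have "smult (r' * r) (smult (?c ^ k) u) \<in> polys_over D" by (simp add: ac_simps)
          moreover have "r' * r \<in> D - P" using r r' prime mult_mem by blast
          ultimately show ?case by blast
        qed
        from this[of 0] show ?thesis by simp
      qed
    qed
  qed
  moreover have "\<forall>i\<ge>Suc (degree g). coeff g i = 0" by (simp add: Suc_le_eq coeff_eq_0)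
  ultimately show ?thesis using assms by blast
qed

end


lemma mem_generated_ideal_finite:
  "x \<in> generated_ideal D A \<Longrightarrow> \<exists>B. finite B \<and> B \<subseteq> A \<and> x \<in> generated_ideal D B" for D A
  unfolding generated_ideal_def by blast

locale polynomial_extension = base: subdomain B for B :: "'k::field set" +
  fixes y :: 'k
  assumes transcendental: "\<And>p. p \<in> polys_over B \<Longrightarrow> poly p y = 0 \<Longrightarrow> p = 0"
begin

abbreviation "D \<equiv> polys_at B y"

sublocale ext: subdomain "polys_at B y"
proof
  show "0 \<in> D" using base.polys_over_0 unfolding polys_at_def by force
  show "1 \<in> D" using base.polys_over_1 unfolding polys_at_def by force
  fix a b assume "a \<in> D" "b \<in> D"
  then obtain p q where "p \<in> polys_over B" "q \<in> polys_over B" "a = poly p y" "b = poly q y"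
    unfolding polys_at_def by auto
  then show "a + b \<in> D" "a * b \<in> D" unfolding polys_at_def
    using base.polys_over_add[of p q] base.polys_over_mult[of p q] by (auto intro: rev_image_eqI)
next
  fix a assume "a \<in> D"
  then obtain p where "p \<in> polys_over B" "a = poly p y" unfolding polys_at_def by auto
  then show "- a \<in> D" unfolding polys_at_def
    using base.polys_over_uminus[of p] by (auto intro: rev_image_eqI)
qed

lemma base_mem: "b \<in> B \<Longrightarrow> b \<in> D"
  unfolding polys_at_def using base.polys_over_const by (force intro: rev_image_eqI)

lemma poly_mem: "p \<in> polys_over B \<Longrightarrow> poly p y \<in> D"
  unfolding polys_at_def by auto

lemma quotient_field_base_mem: "u \<in> quotient_field B \<Longrightarrow> u \<in> quotient_field D"
  unfolding quotient_field_def using base_mem by blast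

lemma transcendental_quotient_field:
  assumes "p \<in> polys_over (quotient_field B)" "poly p y = 0"
  shows "p = 0"
proof -
  obtain c where c: "c \<in> B" "c \<noteq> 0" "smult c p \<in> polys_over B"
    using base.polys_over_common_denominator[OF assms(1)] by auto
  then have "smult c p = 0" using transcendental[OF c(3)] assms(2) by simp
  then show ?thesis using c by simp
qed

lemma polys_over_base_mem: "p \<in> polys_over B \<Longrightarrow> p \<in> polys_over (quotient_field B)"
  unfolding polys_over_def using base.mem_quotient_field by auto

lemma poly_mem_iff:
  assumes "p \<in> polys_over (quotient_field B)"
  shows "poly p y \<in> D \<longleftrightarrow> p \<in> polys_over B"
proof
  assume "poly p y \<in> D"
  then obtain q where q: "q \<in> polys_over B" "poly p y = poly q y" unfolding polys_at_def by auto
  have "p - q \<in> polys_over (quotient_field B)"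
    using subdomain.polys_over_diff[OF base.subdomain_quotient_field assms polys_over_base_mem[OF q(1)]] .
  then have "p - q = 0" using transcendental_quotient_field[of "p - q"] q(2) by simp
  then show "p \<in> polys_over B" using q by simp
qed (rule poly_mem)

lemma const_mem_iff: "u \<in> quotient_field B \<Longrightarrow> u \<in> D \<longleftrightarrow> u \<in> B"
proof -
  assume "u \<in> quotient_field B"
  then have "[:u:] \<in> polys_over (quotient_field B)"
    by (rule subdomain.polys_over_const[OF base.subdomain_quotient_field])
  then have "poly [:u:] y \<in> D \<longleftrightarrow> [:u:] \<in> polys_over B" by (rule poly_mem_iff)
  moreover have "[:u:] \<in> polys_over B \<Longrightarrow> u \<in> B" unfolding polys_over_def
    by (metis (mono_tags, lifting) coeff_pCons_0 mem_Collect_eq)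
  ultimately show ?thesis using base_mem by auto
qed

lemma const_times_poly_mem_iff:
  assumes "u \<in> quotient_field B" "p \<in> polys_over B"
  shows "u * poly p y \<in> D \<longleftrightarrow> (\<forall>i. u * coeff p i \<in> B)"
proof -
  have "smult u p \<in> polys_over (quotient_field B)"
    using subdomain.polys_over_smult[OF base.subdomain_quotient_field assms(1) polys_over_base_mem[OF assms(2)]] .
  then show ?thesis using poly_mem_iff[of "smult u p"] by (simp add: polys_over_def)
qed

lemma poly_if_const_denominator:
  assumes "b \<in> B" "b \<noteq> 0" "u * b \<in> D"
  obtains p where "p \<in> polys_over (quotient_field B)" "u = poly p y"
proof -
  obtain q where q: "q \<in> polys_over B" "u * b = poly q y" using assms(3) unfolding polys_at_def by auto
  have "smult (1 / b) q \<in> polys_over (quotient_field B)"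
    using subdomain.polys_over_smult[OF base.subdomain_quotient_field _ polys_over_base_mem[OF q(1)]]
      base.divide_mem_quotient_field[OF base.one_mem assms(1,2)] by auto
  moreover have "u = poly (smult (1 / b) q) y" using q(2) assms(2) by (simp flip: q(2))
  ultimately show ?thesis by (rule that)
qed

lemma ideal_of_polys_at:
  assumes P: "ideal_of B P"
  shows "ideal_of D (polys_at P y)"
  unfolding ideal_of_def
proof (intro conjI ballI)
  have sub: "polys_over P \<subseteq> polys_over B" using ideal_of_subset[OF P] unfolding polys_over_def by auto
  then show "polys_at P y \<subseteq> D" unfolding polys_at_def by auto
  have "0 \<in> polys_over P" using ideal_of_zero[OF P] unfolding polys_over_def by auto
  then show "0 \<in> polys_at P y" unfolding polys_at_def by force
  fix a assume "a \<in> polys_at P y"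
  then obtain p where p: "p \<in> polys_over P" "a = poly p y" unfolding polys_at_def by auto
  { fix b assume "b \<in> polys_at P y"
    then obtain q where q: "q \<in> polys_over P" "b = poly q y" unfolding polys_at_def by auto
    have "p + q \<in> polys_over P" using p q ideal_of_add[OF P] unfolding polys_over_def by auto
    then show "a + b \<in> polys_at P y" unfolding polys_at_def using p q by (auto intro: rev_image_eqI) }
  fix r assume "r \<in> D"
  then obtain q where q: "q \<in> polys_over B" "r = poly q y" unfolding polys_at_def by auto
  have "coeff (q * p) i \<in> P" for i
    unfolding coeff_mult using p(1) q(1) unfolding polys_over_def
    by (intro ideal_of_sum[OF P] ideal_of_mult[OF P]) auto
  then have "q * p \<in> polys_over P" unfolding polys_over_def by simp
  then show "r * a \<in> polys_at P y" unfolding polys_at_def using p q by (auto intro: rev_image_eqI)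
qed

lemma poly_mem_polys_at_iff:
  assumes "ideal_of B P" "p \<in> polys_over B"
  shows "poly p y \<in> polys_at P y \<longleftrightarrow> p \<in> polys_over P"
proof
  assume "poly p y \<in> polys_at P y"
  then obtain q where q: "q \<in> polys_over P" "poly p y = poly q y" unfolding polys_at_def by auto
  then have "q \<in> polys_over B" using ideal_of_subset[OF assms(1)] unfolding polys_over_def by auto
  then have "p - q = 0" using transcendental[of "p - q"] base.polys_over_diff[OF assms(2)] q by simp
  then show "p \<in> polys_over P" using q by simp
qed (auto simp: polys_at_def)

lemma base_mem_polys_at: "b \<in> P \<Longrightarrow> 0 \<in> P \<Longrightarrow> b \<in> polys_at P y"
proof -
  assume "b \<in> P" "0 \<in> P"
  then have "[:b:] \<in> polys_over P" unfolding polys_over_def by (auto simp: coeff_pCons split: nat.split)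
  then show ?thesis unfolding polys_at_def by (force intro: rev_image_eqI)
qed

text \<open>
  Only finitely many coefficients occur in a finite set of polynomials, and a constant multiplier for
  these is one for the polynomials.
\<close>

lemma t_proper_polys_at:
  assumes P: "t_proper B P"
  shows "t_proper D (polys_at P y)"
  unfolding t_proper_def
proof (intro conjI allI impI)
  note idl = base.t_proper_ideal[OF P]
  show "ideal_of D (polys_at P y)" by (rule ideal_of_polys_at[OF idl])
  obtain b where "b \<in> P" "b \<noteq> 0" using base.t_proper_nonzero[OF P] .
  then show "polys_at P y \<noteq> {0}" using base_mem_polys_at ideal_of_zero[OF idl] by blast
  fix A assume A: "finite A \<and> A \<subseteq> polys_at P y"
  then have "\<forall>a\<in>A. \<exists>p. p \<in> polys_over P \<and> a = poly p y" unfolding polys_at_def by auto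
  then obtain p where p: "\<And>a. a \<in> A \<Longrightarrow> p a \<in> polys_over P \<and> a = poly (p a) y" by metis
  let ?C = "\<Union>a\<in>A. coeff (p a) ` {..degree (p a)}"
  have "finite ?C" using A by auto
  moreover have "?C \<subseteq> P" using p unfolding polys_over_def by auto
  ultimately obtain u where u: "u \<in> quotient_field B" "u \<notin> B" "\<forall>c\<in>?C. u * c \<in> B"
    using base.t_proper_witness[OF P, of ?C] by auto
  have "u * a \<in> D" if "a \<in> A" for a
  proof -
    have "u * coeff (p a) i \<in> B" for i
      using u(3) that by (cases "i \<le> degree (p a)") (auto simp: coeff_eq_0 base.zero_mem)
    moreover have "p a \<in> polys_over B"
      using p[OF that] ideal_of_subset[OF idl] unfolding polys_over_def by auto
    ultimately have "u * poly (p a) y \<in> D" using const_times_poly_mem_iff[OF u(1)] by blast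
    then show ?thesis using p[OF that] by metis
  qed
  then show "\<exists>u\<in>quotient_field D - D. \<forall>a\<in>A. u * a \<in> D"
    using u(1,2) quotient_field_base_mem const_mem_iff by (intro bexI[of _ u]) auto
qed

text \<open>
  The dichotomy behind the description of the maximal \<open>t\<close>-ideals: either the ideal of all
  coefficients that occur in \<open>M\<close> is \<open>t\<close>-proper, and \<open>M\<close> is extended from \<open>B\<close>; or finitely many
  elements of \<open>M\<close> have coefficients that generate an ideal whose \<open>v\<close>-closure is \<open>B\<close>, and by
  the local Gauss lemma these elements do not leave room for a proper denominator in \<open>B\<close>.
\<close>

lemma t_Max_cases:
  assumes M: "M \<in> t_Max D"
  obtains (extended) P where "P \<in> t_Max B" "M = polys_at P y"
  | (primitive) G where "finite G" "G \<subseteq> polys_over B" "\<And>g. g \<in> G \<Longrightarrow> poly g y \<in> M"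
      "\<And>p. p \<in> polys_over (quotient_field B) \<Longrightarrow> \<forall>g\<in>G. g * p \<in> polys_over B \<Longrightarrow> p \<in> polys_over B"
proof -
  note tp = ext.t_Max_t_proper[OF M]
  define S where "S = {coeff p i | p i. p \<in> polys_over B \<and> poly p y \<in> M}"
  let ?C = "generated_ideal B S"
  have sub: "S \<subseteq> B" unfolding S_def polys_over_def by auto
  have "?C \<subseteq> B" by (rule base.generated_ideal_least[OF base.ideal_of_whole sub])
  then have idl: "ideal_of B ?C" unfolding ideal_of_def
    using base.zero_mem_generated_ideal base.generated_ideal_add base.generated_ideal_mult by blast
  have Mpoly: "\<exists>p\<in>polys_over B. x = poly p y \<and> (\<forall>i. coeff p i \<in> ?C)" if x: "x \<in> M" for x
  proof -
    obtain p where p: "p \<in> polys_over B" "x = poly p y"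
      using x ideal_of_subset[OF ext.t_proper_ideal[OF tp]] unfolding polys_at_def by blast
    then have "coeff p i \<in> ?C" for i using x unfolding S_def by (intro base.mem_generated_ideal) auto
    then show ?thesis using p by blast
  qed
  obtain x where x: "x \<in> M" "x \<noteq> 0" using ext.t_proper_nonzero[OF tp] .
  obtain p where p: "x = poly p y" "\<forall>i. coeff p i \<in> ?C" using Mpoly[OF x(1)] by blast
  have "coeff p (degree p) \<noteq> 0" using p x by auto
  then have ne: "?C \<noteq> {0}" using p(2) by (metis singletonD)
  show ?thesis
  proof (cases "t_proper B ?C")
    case True
    obtain P where P: "P \<in> t_Max B" "?C \<subseteq> P" using base.ex_t_Max[OF True] .
    have "M \<subseteq> polys_at P y"
    proof
      fix x assume "x \<in> M"
      then obtain p where p: "x = poly p y" "\<forall>i. coeff p i \<in> ?C" using Mpoly by blast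
      then have "p \<in> polys_over P" using P(2) unfolding polys_over_def by blast
      then show "x \<in> polys_at P y" using p unfolding polys_at_def by auto
    qed
    then have "polys_at P y = M"
      by (rule ext.t_Max_maximal[OF M t_proper_polys_at[OF base.t_Max_t_proper[OF P(1)]]])
    then show ?thesis using extended P by blast
  next
    case False
    then obtain A where A: "finite A" "A \<subseteq> ?C"
        and Au: "\<And>u. u \<in> quotient_field B \<Longrightarrow> \<forall>a\<in>A. u * a \<in> B \<Longrightarrow> u \<in> B"
      using idl ne unfolding t_proper_def by (smt (verit) Diff_iff)
    have "\<forall>a\<in>A. \<exists>T. finite T \<and> T \<subseteq> S \<and> a \<in> generated_ideal B T"
      using A(2) mem_generated_ideal_finite by blast
    then obtain T where T: "\<And>a. a \<in> A \<Longrightarrow> finite (T a) \<and> T a \<subseteq> S \<and> a \<in> generated_ideal B (T a)"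
      by metis
    have "\<forall>c\<in>\<Union>(T ` A). \<exists>p. p \<in> polys_over B \<and> poly p y \<in> M \<and> (\<exists>i. c = coeff p i)"
      using T unfolding S_def by blast
    then obtain g where g: "\<And>c. c \<in> \<Union>(T ` A) \<Longrightarrow>
        g c \<in> polys_over B \<and> poly (g c) y \<in> M \<and> (\<exists>i. c = coeff (g c) i)" by metis
    let ?G = "g ` \<Union>(T ` A)"
    show ?thesis
    proof (rule primitive[of ?G])
      show "finite ?G" using A T by auto
      show "?G \<subseteq> polys_over B" using g by blast
      show "poly h y \<in> M" if "h \<in> ?G" for h using that g by blast
      fix p assume p: "p \<in> polys_over (quotient_field B)" and gp: "\<forall>h\<in>?G. h * p \<in> polys_over B"
      have "coeff p i \<in> B" for i
      proof (rule base.mem_if_locally_mem)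
        show "coeff p i \<in> quotient_field B" using p unfolding polys_over_def by auto
        fix P assume P: "P \<in> t_Max B"
        note Pidl = base.t_Max_ideal[OF P]
        have "\<exists>c\<in>\<Union>(T ` A). \<exists>i. coeff (g c) i \<notin> P"
        proof (rule ccontr)
          assume no: "\<not> ?thesis"
          have TP: "\<Union>(T ` A) \<subseteq> P"
          proof
            fix c assume c: "c \<in> \<Union>(T ` A)"
            then obtain i where "c = coeff (g c) i" using g by blast
            then show "c \<in> P" using no c by metis
          qed
          have "A \<subseteq> P"
          proof
            fix a assume a: "a \<in> A"
            then have "generated_ideal B (T a) \<subseteq> P"
              using TP by (intro base.generated_ideal_least[OF Pidl]) auto
            then show "a \<in> P" using T[OF a] by blast
          qed
          then show False
            using base.t_proper_witness[OF base.t_Max_t_proper[OF P] A(1)] Au by auto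
        qed
        then obtain c j where c: "c \<in> \<Union>(T ` A)" "coeff (g c) j \<notin> P" by blast
        obtain r where r: "r \<in> B - P" "smult r p \<in> polys_over B"
          using base.Gauss_local[OF base.t_Max_prime[OF P], of "g c" p] g[OF c(1)] c gp by blast
        then have "r * coeff p i \<in> B" unfolding polys_over_def by (metis coeff_smult mem_Collect_eq)
        then show "\<exists>d\<in>B - P. d * coeff p i \<in> B" using r by blast
      qed
      then show "p \<in> polys_over B" unfolding polys_over_def by simp
    qed
  qed
qed

text \<open>
  In the primitive case, the multipliers of \<open>b\<close> have constant denominators, and \<open>G\<close> leaves
  only those without proper denominators. So \<open>1\<close> would belong to \<open>M\<close>.
\<close>

lemma t_Max_extended:
  assumes M: "M \<in> t_Max D" and b: "b \<in> M" "b \<in> B" "b \<noteq> 0"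
  shows "\<exists>P\<in>t_Max B. M = polys_at P y"
  using M
proof (cases rule: t_Max_cases)
  case (primitive G)
  have "1 \<in> M"
  proof (rule ext.t_Max_closed[OF M])
    show "finite (insert b ((\<lambda>g. poly g y) ` G))" using primitive by auto
    show "insert b ((\<lambda>g. poly g y) ` G) \<subseteq> M" using primitive b by auto
    show "1 \<in> D" by (rule ext.one_mem)
    fix u assume u: "u \<in> quotient_field D" "\<forall>a\<in>insert b ((\<lambda>g. poly g y) ` G). u * a \<in> D"
    then have "u * b \<in> D" by auto
    then obtain p where p: "p \<in> polys_over (quotient_field B)" "u = poly p y"
      using poly_if_const_denominator[OF b(2,3)] by blast
    have "g * p \<in> polys_over B" if g: "g \<in> G" for g
    proof -
      have "g * p \<in> polys_over (quotient_field B)"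
        using primitive(2) g p(1)
        by (intro subdomain.polys_over_mult[OF base.subdomain_quotient_field]) (auto intro: polys_over_base_mem)
      moreover have "poly (g * p) y \<in> D" using u(2) g p(2) by (simp add: mult.commute)
      ultimately show ?thesis using poly_mem_iff by blast
    qed
    then have "p \<in> polys_over B" using primitive(4) p(1) by blast
    then show "u * 1 \<in> D" using p(2) poly_mem by simp
  qed
  then show ?thesis using ext.t_proper_one_notin[OF ext.t_Max_t_proper[OF M]] by simp
qed blast

lemma t_Max_coeff_mem:
  assumes M: "M \<in> t_Max D" "b \<in> M" "b \<in> B" "b \<noteq> 0" and p: "p \<in> polys_over B" "poly p y \<in> M"
  shows "coeff p i \<in> M"
proof -
  obtain P where P: "P \<in> t_Max B" "M = polys_at P y" using t_Max_extended[OF M] by blast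
  note idl = base.t_Max_ideal[OF P(1)]
  have "p \<in> polys_over P" using p P(2) poly_mem_polys_at_iff[OF idl] by blast
  then have "coeff p i \<in> P" unfolding polys_over_def by auto
  then show ?thesis unfolding P(2) using base_mem_polys_at ideal_of_zero[OF idl] by blast
qed

text \<open>
  Division by an element \<open>f\<close> of least degree: over the quotient field of \<open>B\<close>, the ideal becomes
  principal.
\<close>

lemma upper_generator:
  assumes M: "ideal_of D M" "M \<noteq> {0}" and MB: "M \<inter> B \<subseteq> {0}"
  obtains f where "f \<in> polys_over B" "poly f y \<in> M" "degree f > 0"
    "\<And>h. h \<in> polys_over B \<Longrightarrow> poly h y \<in> M \<Longrightarrow>
       \<exists>c\<in>B - {0}. \<exists>z\<in>polys_over B. smult c h = f * z"
proof -
  let ?Q = "\<lambda>f. f \<in> polys_over B \<and> poly f y \<in> M \<and> f \<noteq> 0"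
  obtain x where x: "x \<in> M" "x \<noteq> 0" using M ideal_of_zero by blast
  then obtain f0 where "f0 \<in> polys_over B" "x = poly f0 y"
    using ideal_of_subset[OF M(1)] unfolding polys_at_def by blast
  then have "?Q f0" using x by auto
  then obtain f where f: "?Q f" and least: "\<And>h. ?Q h \<Longrightarrow> degree f \<le> degree h"
    using ex_has_least_nat[of ?Q f0 degree] by blast
  have pos: "degree f > 0"
  proof (rule ccontr)
    assume "\<not> degree f > 0"
    then obtain c where c: "f = [:c:]" using degree_0_id by (metis degree_eq_zeroE gr0I)
    then have "c \<in> M" "c \<in> B" "c \<noteq> 0" using f base.polys_over_coeff[of f 0] by auto
    then show False using MB by auto
  qed
  have "\<exists>c\<in>B - {0}. \<exists>z\<in>polys_over B. smult c h = f * z"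
    if "h \<in> polys_over B" "poly h y \<in> M" for h
    using that
  proof (induction "degree h" arbitrary: h rule: less_induct)
    case less
    show ?case
    proof (cases "h = 0")
      case True
      then show ?thesis using base.one_mem base.polys_over_0 by (intro bexI[of _ 1] bexI[of _ 0]) auto
    next
      case False
      then have le: "degree f \<le> degree h" using least less.prems by blast
      let ?c = "lead_coeff f" and ?m = "monom (lead_coeff h) (degree h - degree f)"
      let ?h = "smult ?c h - f * ?m"
      have cB: "?c \<in> B" "?c \<noteq> 0" using f base.polys_over_coeff by auto
      have m: "?m \<in> polys_over B"
        using base.polys_over_monom base.polys_over_coeff[OF less.prems(1)] by blast
      have hB: "?h \<in> polys_over B"
        using f cB m less.prems
        by (intro base.polys_over_diff base.polys_over_smult base.polys_over_mult) auto
      have hM: "poly ?h y \<in> M"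
        using less.prems(2) f ext.ideal_of_diff[OF M(1)] ideal_of_mult[OF M(1) base_mem[OF cB(1)]]
          ideal_of_mult_right[OF M(1) poly_mem[OF m]] by simp
      have small: "?h = 0 \<or> degree ?h < degree h"
      proof (cases "degree h = 0")
        case True
        then show ?thesis using pos le by simp
      next
        case False
        have "degree ?h \<le> degree h"
        proof (rule degree_diff_le)
          show "degree (smult ?c h) \<le> degree h" by (rule degree_smult_le)
          have "degree (f * ?m) \<le> degree f + (degree h - degree f)"
            using degree_mult_le[of f ?m] degree_monom_le[of "lead_coeff h" "degree h - degree f"] by linarith
          then show "degree (f * ?m) \<le> degree h" using le by simp
        qed
        moreover have "coeff ?h (degree h) = 0"
          using le coeff_mult_degree_sum[of f ?m] \<open>h \<noteq> 0\<close> by (simp add: degree_monom_eq)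
        ultimately show ?thesis
          using False by (metis leading_coeff_0_iff le_neq_implies_less)
      qed
      have "\<exists>c\<in>B - {0}. \<exists>z\<in>polys_over B. smult c ?h = f * z"
      proof (cases "?h = 0")
        case True
        then show ?thesis using base.one_mem base.polys_over_0 by (intro bexI[of _ 1] bexI[of _ 0]) auto
      next
        case False
        then show ?thesis using less.hyps[OF _ hB hM] small by blast
      qed
      then obtain c z where cz: "c \<in> B" "c \<noteq> 0" "z \<in> polys_over B" "smult c ?h = f * z" by blast
      have "smult (c * ?c) h = f * (z + smult c ?m)"
        using cz(4) by (simp add: smult_diff_right distrib_left eq_diff_eq add.commute diff_eq_eq)
      moreover have "z + smult c ?m \<in> polys_over B"
        using cz m by (intro base.polys_over_add base.polys_over_smult) auto
      ultimately show ?thesis using cz cB base.mult_mem by (intro bexI[of _ "c * ?c"]) auto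
    qed
  qed
  then show ?thesis using that f pos by blast
qed

text \<open>
  Up to a constant, the generator \<open>f\<close> of \<open>M\<close> divides the generator \<open>h\<close> of \<open>Q\<close>, and the cofactor has
  smaller degree than \<open>h\<close>, too small for an element of \<open>Q\<close>. So \<open>f\<close> is in \<open>Q\<close>, and constants can be
  cancelled because \<open>Q\<close> is prime.
\<close>

lemma upper_height_one:
  assumes M: "prime_ideal_of D M" and MB: "M \<inter> B \<subseteq> {0}"
    and Q: "prime_ideal_of D Q" "Q \<noteq> {0}" "Q \<subseteq> M"
  shows "Q = M"
proof -
  have idl: "ideal_of D M" "ideal_of D Q" using M Q unfolding prime_ideal_of_def by auto
  have Qprime: "\<And>a b. a \<in> D \<Longrightarrow> b \<in> D \<Longrightarrow> a * b \<in> Q \<Longrightarrow> a \<in> Q \<or> b \<in> Q"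
    using Q unfolding prime_ideal_of_def by auto
  have nz: "c \<notin> Q" if "c \<in> B - {0}" for c using that Q MB by auto
  have "M \<noteq> {0}" using Q ideal_of_zero[OF idl(2)] by blast
  then obtain f where f: "f \<in> polys_over B" "poly f y \<in> M" "degree f > 0"
    and fdvd: "\<And>h. h \<in> polys_over B \<Longrightarrow> poly h y \<in> M \<Longrightarrow>
       \<exists>c\<in>B - {0}. \<exists>z\<in>polys_over B. smult c h = f * z"
    using upper_generator[OF idl(1) _ MB] by blast
  obtain h where h: "h \<in> polys_over B" "poly h y \<in> Q" "degree h > 0"
    and hdvd: "\<And>p. p \<in> polys_over B \<Longrightarrow> poly p y \<in> Q \<Longrightarrow>
       \<exists>c\<in>B - {0}. \<exists>z\<in>polys_over B. smult c p = h * z"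
    using upper_generator[OF idl(2) Q(2)] MB Q(3) by blast
  obtain c z where cz: "c \<in> B" "c \<noteq> 0" "z \<in> polys_over B" "smult c h = f * z"
    using fdvd[OF h(1)] h(2) Q(3) by blast
  have "poly f y * poly z y \<in> Q"
    using ideal_of_mult[OF idl(2) base_mem[OF cz(1)] h(2)] cz(4) by (metis poly_mult poly_smult)
  moreover have "poly z y \<notin> Q"
  proof
    assume "poly z y \<in> Q"
    then obtain d w where dw: "d \<in> B" "d \<noteq> 0" "smult d z = h * w" using hdvd[OF cz(3)] by blast
    have ne: "h \<noteq> 0" "f \<noteq> 0" using h f by auto
    then have "f * z \<noteq> 0" using cz by (metis smult_eq_0_iff)
    then have z: "z \<noteq> 0" by auto
    then have "h * w \<noteq> 0" using dw by (metis smult_eq_0_iff)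
    then have "degree h \<le> degree z"
      using dw by (metis degree_mult_eq degree_smult_eq le_add1 mult_zero_right mult_zero_left)
    moreover have "degree h = degree f + degree z"
      using cz(2,4) ne z by (metis degree_mult_eq degree_smult_eq)
    ultimately show False using f(3) by simp
  qed
  ultimately have fQ: "poly f y \<in> Q" using Qprime poly_mem f cz by blast
  have "M \<subseteq> Q"
  proof
    fix x assume x: "x \<in> M"
    then obtain p where p: "p \<in> polys_over B" "x = poly p y"
      using ideal_of_subset[OF idl(1)] unfolding polys_at_def by blast
    then obtain d w where dw: "d \<in> B - {0}" "w \<in> polys_over B" "smult d p = f * w"
      using fdvd x by blast
    have "d * x = poly f y * poly w y" using dw(3) p by (metis poly_mult poly_smult)
    then have "d * x \<in> Q" using ideal_of_mult_right[OF idl(2) poly_mem[OF dw(2)] fQ] by simp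
    then show "x \<in> Q" using Qprime[of d x] nz dw base_mem ideal_of_subset[OF idl(1) x] by blast
  qed
  then show ?thesis using Q by auto
qed

text \<open>
  The finite set consists of a generator \<open>f\<close> over the quotient field of \<open>B\<close> and of the primitive
  elements \<open>G\<close>. If \<open>w\<close> maps it into \<open>D\<close> and \<open>h\<close> is in \<open>M\<close>, then \<open>w * h\<close> has a constant denominator,
  because \<open>f\<close> divides a constant multiple of \<open>h\<close>, and \<open>G\<close> excludes proper denominators.
\<close>

lemma upper_v_finite:
  assumes M: "M \<in> t_Max D" and MB: "M \<inter> B \<subseteq> {0}"
  obtains f A where "f \<in> polys_over B" "poly f y \<in> M" "degree f > 0"
    "\<And>h. h \<in> polys_over B \<Longrightarrow> poly h y \<in> M \<Longrightarrow>
       \<exists>c\<in>B - {0}. \<exists>z\<in>polys_over B. smult c h = f * z"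
    "finite A" "A \<subseteq> M"
    "\<And>w h. \<forall>a\<in>A. w * a \<in> D \<Longrightarrow> h \<in> M \<Longrightarrow> w * h \<in> D"
proof -
  note tp = ext.t_Max_t_proper[OF M]
  note idl = ext.t_proper_ideal[OF tp]
  have ne: "M \<noteq> {0}" using tp unfolding t_proper_def by auto
  obtain f where f: "f \<in> polys_over B" "poly f y \<in> M" "degree f > 0"
    and fdvd: "\<And>h. h \<in> polys_over B \<Longrightarrow> poly h y \<in> M \<Longrightarrow>
       \<exists>c\<in>B - {0}. \<exists>z\<in>polys_over B. smult c h = f * z"
    using upper_generator[OF idl ne MB] by blast
  from M show ?thesis
  proof (cases rule: t_Max_cases)
    case (extended P)
    obtain b where "b \<in> P" "b \<noteq> 0" using base.t_proper_nonzero[OF base.t_Max_t_proper[OF extended(1)]] .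
    moreover have "P \<subseteq> M" "P \<subseteq> B"
      using extended base_mem_polys_at base.t_Max_ideal[OF extended(1)] ideal_of_zero ideal_of_subset
      by blast+
    ultimately show ?thesis using MB by blast
  next
    case (primitive G)
    show ?thesis
    proof (rule that[OF f fdvd, of "insert (poly f y) ((\<lambda>g. poly g y) ` G)"])
      show "finite (insert (poly f y) ((\<lambda>g. poly g y) ` G))" using primitive by auto
      show "insert (poly f y) ((\<lambda>g. poly g y) ` G) \<subseteq> M" using primitive f by auto
      fix w x assume w: "\<forall>a\<in>insert (poly f y) ((\<lambda>g. poly g y) ` G). w * a \<in> D" and x: "x \<in> M"
      then obtain h where h: "h \<in> polys_over B" "x = poly h y"
        using ideal_of_subset[OF idl] unfolding polys_at_def by blast
      then obtain c z where cz: "c \<in> B - {0}" "z \<in> polys_over B" "smult c h = f * z" using fdvd x by blast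
      have "w * x * c = (w * poly f y) * poly z y"
        using cz(3) h by (metis mult.assoc mult.commute poly_mult poly_smult)
      then have "w * x * c \<in> D" using w ext.mult_mem[OF _ poly_mem[OF cz(2)]] by (metis insertI1)
      then obtain p where p: "p \<in> polys_over (quotient_field B)" "w * x = poly p y"
        using poly_if_const_denominator cz(1) by blast
      have "g * p \<in> polys_over B" if g: "g \<in> G" for g
      proof -
        have "g * p \<in> polys_over (quotient_field B)"
          using primitive(2) g p(1)
          by (intro subdomain.polys_over_mult[OF base.subdomain_quotient_field]) (auto intro: polys_over_base_mem)
        moreover have eq: "poly (g * p) y = (w * poly g y) * x" using p(2) by (simp add: ac_simps flip: p(2))
        moreover have "(w * poly g y) * x \<in> D"
          using w g ext.mult_mem[OF _ ideal_of_subset[OF idl x]] by blast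
        ultimately show ?thesis using poly_mem_iff by metis
      qed
      then have "p \<in> polys_over B" using primitive(4) p(1) by blast
      then show "w * x \<in> D" using p(2) poly_mem by simp
    qed
  qed
qed

text \<open>
  A multiplier of the finite set that determines \<open>M\<close> is a multiplier of all of \<open>M\<close>, so its conductor
  contains \<open>M\<close>, and maximality gives equality.
\<close>

lemma upper_eq_conductor:
  assumes M: "M \<in> t_Max D" and MB: "M \<inter> B \<subseteq> {0}"
  shows "\<exists>u\<in>quotient_field D - D. M = conductor D u"
proof -
  obtain A where A: "finite A" "A \<subseteq> M" "\<And>w h. \<forall>a\<in>A. w * a \<in> D \<Longrightarrow> h \<in> M \<Longrightarrow> w * h \<in> D"
    using upper_v_finite[OF M MB] by metis
  obtain u where u: "u \<in> quotient_field D" "u \<notin> D" "\<forall>a\<in>A. u * a \<in> D"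
    using ext.t_proper_witness[OF ext.t_Max_t_proper[OF M] A(1,2)] by blast
  have "M \<subseteq> conductor D u" unfolding conductor_def
    using A(3)[OF u(3)] ideal_of_subset[OF ext.t_Max_ideal[OF M]] by (auto simp: mult.commute)
  then have "conductor D u = M" by (rule ext.t_Max_maximal[OF M ext.t_proper_conductor[OF u(1,2)]])
  then show ?thesis using u by blast
qed

text \<open>
  Induction on the degree of \<open>b\<close>: if \<open>b\<close> lies in an upper \<open>M\<close> with generator \<open>f\<close>, some \<open>v = c / f\<close>
  with a constant \<open>c\<close> maps \<open>M\<close> into \<open>D\<close>, and \<open>v * b\<close> has smaller degree. The factor
  \<open>h \<in> M - M0\<close> compensates, since \<open>h / b = (v * h) / (v * b)\<close>.
\<close>

lemma clear_upper_denominators: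
  assumes M0: "prime_ideal_of D M0"
    and avoid: "\<And>M. M \<in> t_Max D \<Longrightarrow> M \<inter> B \<subseteq> {0} \<Longrightarrow> \<not> M \<subseteq> M0"
    and b: "b \<in> D" "b \<noteq> 0"
  shows "\<exists>w\<in>D - M0. \<forall>M\<in>t_Max D. M \<inter> B \<subseteq> {0} \<longrightarrow> (\<exists>d\<in>D - M. d * (w / b) \<in> D)"
proof -
  have one: "1 \<notin> M0" and prime: "\<And>x z. x \<in> D \<Longrightarrow> z \<in> D \<Longrightarrow> x * z \<in> M0 \<Longrightarrow> x \<in> M0 \<or> z \<in> M0"
    using M0 unfolding prime_ideal_of_def by auto
  have "\<exists>w\<in>D - M0. \<forall>M\<in>t_Max D. M \<inter> B \<subseteq> {0} \<longrightarrow> (\<exists>d\<in>D - M. d * (w / poly p y) \<in> D)"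
    if "p \<in> polys_over B" "p \<noteq> 0" for p
    using that
  proof (induction "degree p" arbitrary: p rule: less_induct)
    case less
    let ?b = "poly p y"
    have b0: "?b \<noteq> 0" using transcendental less.prems by auto
    show ?case
    proof (cases "\<exists>M\<in>t_Max D. M \<inter> B \<subseteq> {0} \<and> ?b \<in> M")
      case False
      then have "\<exists>d\<in>D - M. d * (1 / ?b) \<in> D" if "M \<in> t_Max D" "M \<inter> B \<subseteq> {0}" for M
        using that b0 poly_mem[OF less.prems(1)] ext.one_mem by (intro bexI[of _ ?b]) auto
      then show ?thesis using one ext.one_mem by blast
    next
      case True
      then obtain M where M: "M \<in> t_Max D" "M \<inter> B \<subseteq> {0}" "?b \<in> M" by blast
      note idl = ext.t_Max_ideal[OF M(1)]
      obtain f A where f: "f \<in> polys_over B" "poly f y \<in> M" "degree f > 0"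
        and fdvd: "\<And>h. h \<in> polys_over B \<Longrightarrow> poly h y \<in> M \<Longrightarrow>
            \<exists>c\<in>B - {0}. \<exists>z\<in>polys_over B. smult c h = f * z"
        and A: "finite A" "A \<subseteq> M" "\<And>w h. \<forall>a\<in>A. w * a \<in> D \<Longrightarrow> h \<in> M \<Longrightarrow> w * h \<in> D"
        using upper_v_finite[OF M(1,2)] by metis
      have f0: "poly f y \<noteq> 0" using transcendental[OF f(1)] f(3) by auto
      have "\<forall>a\<in>insert ?b A. \<exists>c\<in>B - {0}. c * (a / poly f y) \<in> D"
      proof
        fix a assume "a \<in> insert ?b A"
        then have a: "a \<in> M" using A M by auto
        then obtain h where h: "h \<in> polys_over B" "a = poly h y"
          using ideal_of_subset[OF idl] unfolding polys_at_def by blast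
        then obtain c z where cz: "c \<in> B - {0}" "z \<in> polys_over B" "smult c h = f * z" using fdvd a by blast
        have "c * a = poly f y * poly z y" using cz(3) h by (metis poly_mult poly_smult)
        then have "c * (a / poly f y) = poly z y" using f0 by (simp add: field_simps)
        then show "\<exists>c\<in>B - {0}. c * (a / poly f y) \<in> D" using cz poly_mem by metis
      qed
      then obtain c where c: "\<And>a. a \<in> insert ?b A \<Longrightarrow> c a \<in> B - {0} \<and> c a * (a / poly f y) \<in> D"
        by metis
      let ?c = "prod c (insert ?b A)"
      \<comment> \<open>\<open>?c\<close> is a common denominator for the quotients of \<open>A\<close> and of \<open>?b\<close> by \<open>f\<close>\<close>
      let ?v = "?c / poly f y"
      have c0: "?c \<noteq> 0" using A(1) c by auto
      have cB: "?c \<in> B" using c by (intro base.prod_mem) auto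
      have va: "?v * a \<in> D" if a: "a \<in> insert ?b A" for a
      proof -
        have "?c = c a * prod c (insert ?b A - {a})" using a A(1) by (intro prod.remove) auto
        then have "?v * a = (c a * (a / poly f y)) * prod c (insert ?b A - {a})" by simp
        moreover have "prod c (insert ?b A - {a}) \<in> D" using c by (intro base_mem base.prod_mem) auto
        ultimately show ?thesis using c[OF a] ext.mult_mem by metis
      qed
      then have "?v * ?b \<in> D" by auto
      then obtain z where z: "z \<in> polys_over B" "?v * ?b = poly z y" unfolding polys_at_def by blast
      have "poly (smult ?c p - f * z) y = 0" using z(2) f0 by (simp add: field_simps flip: z(2))
      moreover have "smult ?c p - f * z \<in> polys_over B"
        using z f less.prems cB
        by (intro base.polys_over_diff base.polys_over_smult base.polys_over_mult) auto
      ultimately have eq: "smult ?c p = f * z" using transcendental by force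
      then have z0: "z \<noteq> 0" using c0 less.prems by auto
      have "degree p = degree f + degree z"
        using eq z0 c0 f(3) degree_mult_eq[of f z] degree_smult_eq[of ?c p] by force
      then obtain w where w: "w \<in> D" "w \<notin> M0"
        and wz: "\<And>N. N \<in> t_Max D \<Longrightarrow> N \<inter> B \<subseteq> {0} \<Longrightarrow> \<exists>d\<in>D - N. d * (w / poly z y) \<in> D"
        using less.hyps[of z] z(1) z0 f(3) by auto
      obtain h where h: "h \<in> M" "h \<notin> M0" using avoid[OF M(1,2)] by auto
      have hD: "h \<in> D" using ideal_of_subset[OF idl h(1)] .
      have vh: "?v * h \<in> D" using A(3)[of ?v h] va h(1) by auto
      have "h * w \<in> D - M0" using prime h hD w ext.mult_mem by blast
      moreover have "\<exists>d\<in>D - N. d * (h * w / ?b) \<in> D" if N: "N \<in> t_Max D" "N \<inter> B \<subseteq> {0}" for N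
      proof -
        obtain d where d: "d \<in> D - N" "d * (w / poly z y) \<in> D" using wz[OF N] by blast
        have "h * w / ?b = (?v * h) * (w / poly z y)"
          using z(2)[symmetric] f0 b0 c0 by (simp add: field_simps)
        then have "d * (h * w / ?b) = (?v * h) * (d * (w / poly z y))" by (simp add: mult.left_commute)
        then have "d * (h * w / ?b) \<in> D" using ext.mult_mem[OF vh d(2)] by simp
        then show ?thesis using d by blast
      qed
      ultimately show ?thesis by blast
    qed
  qed
  moreover obtain p where "p \<in> polys_over B" "b = poly p y" using b unfolding polys_at_def by auto
  moreover have "p \<noteq> 0" using \<open>b = poly p y\<close> b(2) by auto
  ultimately show ?thesis by metis
qed

end

section \<open>Rings of fractions\<close>

locale fraction_ring = base: subdomain D for D :: "'k::field set" +
  fixes S :: "'k set"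
  assumes S_subset: "S \<subseteq> D" and S_one: "1 \<in> S" and S_zero: "0 \<notin> S"
    and S_mult: "\<And>s s'. s \<in> S \<Longrightarrow> s' \<in> S \<Longrightarrow> s * s' \<in> S"
begin

abbreviation "DS \<equiv> ring_of_fractions D S"

lemma mem_fractions_iff:
  "u \<in> ring_of_fractions I S \<longleftrightarrow> (\<exists>s\<in>S. s * u \<in> I)"
proof
  assume "u \<in> ring_of_fractions I S"
  then obtain a s where "a \<in> I" "s \<in> S" "u = a / s" unfolding ring_of_fractions_def by blast
  moreover then have "s \<noteq> 0" using S_zero by auto
  ultimately show "\<exists>s\<in>S. s * u \<in> I" by (intro bexI[of _ s]) auto
next
  assume "\<exists>s\<in>S. s * u \<in> I"
  then obtain s where s: "s \<in> S" "s * u \<in> I" by auto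
  then have "u = (s * u) / s" using S_zero by auto
  then show "u \<in> ring_of_fractions I S" unfolding ring_of_fractions_def using s by blast
qed

lemma S_mem: "s \<in> S \<Longrightarrow> s \<in> D"
  using S_subset by auto

lemma fractions_add:
  assumes I: "ideal_of D I" and x: "x \<in> ring_of_fractions I S" and y: "y \<in> ring_of_fractions I S"
  shows "x + y \<in> ring_of_fractions I S"
proof -
  obtain s s' where s: "s \<in> S" "s * x \<in> I" "s' \<in> S" "s' * y \<in> I" using x y mem_fractions_iff by auto
  have "(s * s') * (x + y) = s' * (s * x) + s * (s' * y)" by (simp add: algebra_simps)
  then have "(s * s') * (x + y) \<in> I"
    using s ideal_of_add[OF I] ideal_of_mult[OF I] S_mem by simp
  then show ?thesis using mem_fractions_iff S_mult s by blast
qed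

lemma fractions_mult:
  assumes I: "ideal_of D I" and x: "x \<in> DS" and y: "y \<in> ring_of_fractions I S"
  shows "x * y \<in> ring_of_fractions I S"
proof -
  obtain s s' where s: "s \<in> S" "s * x \<in> D" "s' \<in> S" "s' * y \<in> I" using x y mem_fractions_iff by metis
  have "(s * s') * (x * y) = (s * x) * (s' * y)" by (simp add: algebra_simps)
  then have "(s * s') * (x * y) \<in> I" using ideal_of_mult[OF I s(2,4)] by metis
  then show ?thesis using mem_fractions_iff S_mult s by blast
qed

lemma base_mem_fractions: "x \<in> I \<Longrightarrow> x \<in> ring_of_fractions I S"
  unfolding mem_fractions_iff using S_one by (intro bexI[of _ 1]) auto

sublocale loc: subdomain DS
proof
  show "0 \<in> DS" "1 \<in> DS" using base_mem_fractions base.zero_mem base.one_mem by auto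
  fix x y assume xy: "x \<in> DS" "y \<in> DS"
  show "x + y \<in> DS" "x * y \<in> DS"
    using fractions_add[OF base.ideal_of_whole xy] fractions_mult[OF base.ideal_of_whole xy] by auto
next
  fix x assume "x \<in> DS"
  then have "(- 1) * x \<in> DS"
    using base_mem_fractions[of "- 1" D] base.uminus_mem base.one_mem
    by (intro fractions_mult[OF base.ideal_of_whole]) auto
  then show "- x \<in> DS" by simp
qed

lemma quotient_field_fractions: "quotient_field DS = quotient_field D"
proof
  show "quotient_field D \<subseteq> quotient_field DS"
    unfolding quotient_field_def using base_mem_fractions by blast
  show "quotient_field DS \<subseteq> quotient_field D"
  proof
    fix u assume "u \<in> quotient_field DS"
    then obtain x y where xy: "x \<in> DS" "y \<in> DS" "u = x / y" unfolding quotient_field_def by auto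
    have "DS \<subseteq> quotient_field D"
      unfolding ring_of_fractions_def quotient_field_def using S_subset S_zero by blast
    then show "u \<in> quotient_field D" using xy base.quotient_field_divide by blast
  qed
qed

lemma ideal_of_fractions:
  assumes I: "ideal_of D I"
  shows "ideal_of DS (ring_of_fractions I S)"
  unfolding ideal_of_def
proof (intro conjI ballI)
  show "ring_of_fractions I S \<subseteq> DS"
    unfolding ring_of_fractions_def using ideal_of_subset[OF I] by blast
  show "0 \<in> ring_of_fractions I S" using base_mem_fractions ideal_of_zero[OF I] .
qed (use fractions_add[OF I] fractions_mult[OF I] in auto)

lemma common_denominator_fractions:
  assumes I: "ideal_of D I" and A: "finite A" "A \<subseteq> ring_of_fractions I S"
  shows "\<exists>s\<in>S. \<forall>a\<in>A. s * a \<in> I"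
  using A
proof (induction A rule: finite_induct)
  case empty
  then show ?case using S_one by auto
next
  case (insert x A)
  then obtain s s' where s: "s \<in> S" "\<forall>a\<in>A. s * a \<in> I" "s' \<in> S" "s' * x \<in> I"
    using mem_fractions_iff by auto
  have "(s' * s) * a \<in> I" if "a \<in> insert x A" for a
    using that s ideal_of_mult[OF I, of s' "s * a"] ideal_of_mult[OF I, of s "s' * x"] S_mem
    by (auto simp: ac_simps)
  then show ?case using S_mult s by blast
qed

lemma prime_mem_fractions_iff:
  assumes P: "prime_ideal_of D P" "P \<inter> S = {}" and x: "x \<in> D"
  shows "x \<in> ring_of_fractions P S \<longleftrightarrow> x \<in> P"
  using P x S_mem base_mem_fractions unfolding mem_fractions_iff prime_ideal_of_def by blast

lemma fractions_subset_imp: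
  assumes "M \<subseteq> D" "prime_ideal_of D N" "N \<inter> S = {}"
    "ring_of_fractions M S \<subseteq> ring_of_fractions N S"
  shows "M \<subseteq> N"
  using assms(1,4) base_mem_fractions prime_mem_fractions_iff[OF assms(2,3)] by blast

lemma conductor_fractions_subset_iff:
  assumes M: "prime_ideal_of D M" "M \<inter> S = {}"
  shows "conductor DS u \<subseteq> ring_of_fractions M S \<longleftrightarrow> conductor D u \<subseteq> M"
proof
  assume sub: "conductor DS u \<subseteq> ring_of_fractions M S"
  show "conductor D u \<subseteq> M"
  proof
    fix d assume d: "d \<in> conductor D u"
    then have "d \<in> conductor DS u" unfolding conductor_def using base_mem_fractions by auto
    then show "d \<in> M" using sub d prime_mem_fractions_iff[OF M] unfolding conductor_def by blast
  qed
next
  assume sub: "conductor D u \<subseteq> M"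
  have idl: "ideal_of D M" using M(1) unfolding prime_ideal_of_def by auto
  show "conductor DS u \<subseteq> ring_of_fractions M S"
  proof
    fix d assume "d \<in> conductor DS u"
    then obtain s s' where s: "s \<in> S" "s * d \<in> D" "s' \<in> S" "s' * (d * u) \<in> D"
      unfolding conductor_def mem_fractions_iff by auto
    have "s * (s' * (d * u)) \<in> D" "s' * (s * d) \<in> D" using s base.mult_mem S_mem by blast+
    then have "s' * s * d \<in> conductor D u" unfolding conductor_def by (simp add: ac_simps)
    then show "d \<in> ring_of_fractions M S" using sub mem_fractions_iff S_mult s by blast
  qed
qed

text \<open>
  A multiplier over the ring of fractions becomes one over \<open>D\<close> after multiplication by a common
  denominator, so contractions remain \<open>t\<close>-proper.
\<close>

lemma t_Max_contraction:
  assumes Q: "Q \<in> t_Max DS"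
  shows "t_proper D (Q \<inter> D)" "prime_ideal_of D (Q \<inter> D)" "Q \<inter> D \<inter> S = {}"
    "ring_of_fractions (Q \<inter> D) S = Q"
proof -
  note tp = loc.t_Max_t_proper[OF Q]
  note idl = loc.t_proper_ideal[OF tp]
  have prime: "1 \<notin> Q" "\<And>x y. x \<in> DS \<Longrightarrow> y \<in> DS \<Longrightarrow> x * y \<in> Q \<Longrightarrow> x \<in> Q \<or> y \<in> Q"
    using loc.t_Max_prime[OF Q] unfolding prime_ideal_of_def by auto
  have idl': "ideal_of D (Q \<inter> D)"
    using idl base.ideal_of_whole base_mem_fractions unfolding ideal_of_def by auto
  show "prime_ideal_of D (Q \<inter> D)"
    unfolding prime_ideal_of_def using idl' prime base_mem_fractions by blast
  show disj: "Q \<inter> D \<inter> S = {}"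
  proof -
    have "s \<notin> Q" if s: "s \<in> S" for s
    proof
      assume "s \<in> Q"
      moreover have "1 / s \<in> DS" unfolding ring_of_fractions_def using s base.one_mem by blast
      ultimately have "1 / s * s \<in> Q" by (intro ideal_of_mult[OF idl])
      moreover have "s \<noteq> 0" using s S_zero by auto
      ultimately show False using prime(1) by simp
    qed
    then show ?thesis by auto
  qed
  show eq: "ring_of_fractions (Q \<inter> D) S = Q"
  proof
    show "ring_of_fractions (Q \<inter> D) S \<subseteq> Q"
    proof
      fix x assume "x \<in> ring_of_fractions (Q \<inter> D) S"
      then obtain a s where as: "a \<in> Q" "s \<in> S" "x = a / s" unfolding ring_of_fractions_def by auto
      have "1 / s \<in> DS" unfolding ring_of_fractions_def using as base.one_mem by blast
      then have "1 / s * a \<in> Q" using ideal_of_mult[OF idl] as by blast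
      then show "x \<in> Q" using as by simp
    qed
    show "Q \<subseteq> ring_of_fractions (Q \<inter> D) S"
    proof
      fix x assume x: "x \<in> Q"
      then obtain s where s: "s \<in> S" "s * x \<in> D"
        using ideal_of_subset[OF idl] mem_fractions_iff[of x D] by blast
      then have "s * x \<in> Q" using ideal_of_mult[OF idl _ x] S_mem base_mem_fractions by blast
      then show "x \<in> ring_of_fractions (Q \<inter> D) S" using s mem_fractions_iff by blast
    qed
  qed
  show "t_proper D (Q \<inter> D)" unfolding t_proper_def
  proof (intro conjI allI impI idl')
    obtain x where x: "x \<in> Q" "x \<noteq> 0" using loc.t_proper_nonzero[OF tp] .
    show "Q \<inter> D \<noteq> {0}"
    proof
      assume "Q \<inter> D = {0}"
      then have "x \<in> ring_of_fractions {0} S" using eq x by simp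
      then show False using x S_zero unfolding mem_fractions_iff by auto
    qed
    fix A assume A: "finite A \<and> A \<subseteq> Q \<inter> D"
    then obtain u where u: "u \<in> quotient_field DS" "u \<notin> DS" "\<forall>a\<in>A. u * a \<in> DS"
      using loc.t_proper_witness[OF tp, of A] by blast
    then obtain s where s: "s \<in> S" "\<forall>b\<in>(\<lambda>a. u * a) ` A. s * b \<in> D"
      using common_denominator_fractions[OF base.ideal_of_whole, of "(\<lambda>a. u * a) ` A"] A by blast
    have "s * u \<in> quotient_field D"
      using u s base.quotient_field_mult base.mem_quotient_field S_mem quotient_field_fractions by blast
    moreover have "s * u \<notin> D" using u s mem_fractions_iff by blast
    ultimately show "\<exists>u\<in>quotient_field D - D. \<forall>a\<in>A. u * a \<in> D"
      using s by (intro bexI[of _ "s * u"]) (auto simp: mult.assoc)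
  qed
qed

text \<open>
  Extending a maximal \<open>t\<close>-ideal need not give a \<open>t\<close>-ideal, and contracting need not give a maximal
  one; the two hypotheses exclude these failures.
\<close>

lemma t_sharp_fractions_iff:
  assumes extend: "\<And>M. M \<in> t_Max D \<Longrightarrow> M \<inter> S = {} \<Longrightarrow> t_proper DS (ring_of_fractions M S)"
    and contract: "\<And>Q. prime_ideal_of D Q \<Longrightarrow> t_proper D Q \<Longrightarrow> Q \<inter> S = {} \<Longrightarrow>
        \<exists>M\<in>t_Max D. Q \<subseteq> M \<and> M \<inter> S = {}"
  shows "t_sharp_domain DS \<longleftrightarrow> (\<forall>M\<in>{M \<in> t_Max D. M \<inter> S = {}}. \<exists>u\<in>quotient_field D.
     isolates D {N \<in> t_Max D. N \<inter> S = {}} u M)"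
    (is "_ = ?R")
proof -
  let ?T = "{M \<in> t_Max D. M \<inter> S = {}}" and ?e = "\<lambda>M. ring_of_fractions M S"
  have prime: "prime_ideal_of D M" if "M \<in> ?T" for M using that base.t_Max_prime by blast
  have inj: "N = M" if "M \<in> ?T" "N \<in> ?T" "?e M \<subseteq> ?e N" for M N
  proof -
    have "M \<subseteq> D" using that(1) ideal_of_subset[OF base.t_Max_ideal] by blast
    then have "M \<subseteq> N" using fractions_subset_imp[OF _ prime[OF that(2)] _ that(3)] that(2) by simp
    then show ?thesis using that base.t_Max_antichain by blast
  qed
  have T: "t_Max DS = ?e ` ?T"
  proof
    show "t_Max DS \<subseteq> ?e ` ?T"
    proof
      fix Q assume Q: "Q \<in> t_Max DS"
      note c = t_Max_contraction[OF Q]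
      obtain M where M: "M \<in> ?T" "Q \<inter> D \<subseteq> M" using contract[OF c(2,1,3)] by blast
      then have "?e (Q \<inter> D) \<subseteq> ?e M" unfolding ring_of_fractions_def by blast
      then have "Q \<subseteq> ?e M" using c(4) by simp
      then have "?e M = Q" using loc.t_Max_maximal[OF Q] extend M(1) by blast
      then show "Q \<in> ?e ` ?T" using M by blast
    qed
    show "?e ` ?T \<subseteq> t_Max DS"
    proof
      fix N assume "N \<in> ?e ` ?T"
      then obtain M where M: "M \<in> ?T" "N = ?e M" by auto
      obtain Q where Q: "Q \<in> t_Max DS" "?e M \<subseteq> Q" using loc.ex_t_Max[OF extend] M by blast
      note c = t_Max_contraction[OF Q(1)]
      have "M \<subseteq> Q \<inter> D" using Q M base_mem_fractions base.t_Max_ideal ideal_of_subset by blast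
      then have "Q \<inter> D = M" using base.t_Max_maximal c(1) M(1) by blast
      then show "N \<in> t_Max DS" using c(4) M Q by metis
    qed
  qed
  have cond: "conductor DS u \<subseteq> ?e M \<longleftrightarrow> conductor D u \<subseteq> M" if "M \<in> ?T" for M u
    using conductor_fractions_subset_iff[OF prime[OF that]] that by blast
  have inj': "?e N = ?e M \<longleftrightarrow> N = M" if "M \<in> ?T" "N \<in> ?T" for M N
    using inj[OF that] by blast
  have "t_sharp_domain DS \<longleftrightarrow> (\<forall>M\<in>?T. \<exists>u\<in>quotient_field D.
      conductor DS u \<subseteq> ?e M \<and> (\<forall>N\<in>?T. conductor DS u \<subseteq> ?e N \<longrightarrow> ?e N = ?e M))"
    unfolding loc.t_sharp_domain_iff T quotient_field_fractions by simp
  also have "\<dots> \<longleftrightarrow> ?R"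
    by (intro ball_cong bex_cong refl conj_cong imp_cong) (simp_all only: cond inj')
  finally show ?thesis .
qed

end

section \<open>Polynomials in many indeterminates\<close>

abbreviation "lookup \<equiv> Poly_Mapping.lookup"
abbreviation "single \<equiv> Poly_Mapping.single"
abbreviation "keys \<equiv> Poly_Mapping.keys"

abbreviation cst :: "'a::idom \<Rightarrow> ('x, 'a) mpoly fract" where
  "cst c \<equiv> to_fract (single 0 c)"

abbreviation var :: "'x indet \<Rightarrow> ('x, 'a::idom) mpoly fract" where
  "var y \<equiv> to_fract (single (single y 1) 1)"

lemma mpoly_eq_sum: "F = (\<Sum>m\<in>keys F. single m (lookup F m))"
  for F :: "'b \<Rightarrow>\<^sub>0 'c::comm_monoid_add"
proof (rule poly_mapping_eqI)
  fix k
  have "lookup (\<Sum>m\<in>keys F. single m (lookup F m)) k =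
      (\<Sum>m\<in>keys F. if m = k then lookup F m else 0)"
    by (simp add: lookup_sum lookup_single when_def)
  also have "\<dots> = lookup F k" by (simp add: in_keys_iff)
  finally show "lookup F k = lookup (\<Sum>m\<in>keys F. single m (lookup F m)) k" ..
qed

lemma lookup_mult_sum:
  fixes F G :: "('x, 'a::idom) mpoly"
  shows "lookup (F * G) m = (\<Sum>k\<in>keys F. \<Sum>l\<in>keys G.
    (if k + l = m then lookup F k * lookup G l else 0))"
proof -
  have "F * G = (\<Sum>k\<in>keys F. single k (lookup F k)) *
      (\<Sum>l\<in>keys G. single l (lookup G l))"
    using mpoly_eq_sum[of F] mpoly_eq_sum[of G] by metis
  also have "\<dots> = (\<Sum>k\<in>keys F. \<Sum>l\<in>keys G.
      single (k + l) (lookup F k * lookup G l))"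
    by (simp add: sum_product mult_single)
  finally show ?thesis by (simp add: lookup_sum lookup_single when_def)
qed

lemma lookup_const_mult: "lookup (single 0 c * F) m = c * lookup F m"
  for F :: "('x, 'a::idom) mpoly"
  by (cases "c = 0"; cases "m \<in> keys F")
    (auto simp: lookup_mult_sum in_keys_iff if_distrib cong: if_cong)

lemma polys_in_iff: "F \<in> polys_in X \<longleftrightarrow> (\<forall>m. lookup F m \<noteq> 0 \<longrightarrow> keys m \<subseteq> X)"
  unfolding polys_in_def by (auto simp: in_keys_iff)

lemma polys_in_single: "keys m \<subseteq> X \<Longrightarrow> single m c \<in> polys_in X"
  unfolding polys_in_def by auto

lemma polys_in_mono: "X \<subseteq> Y \<Longrightarrow> polys_in X \<subseteq> polys_in Y"
  unfolding polys_in_def by auto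

lemma polys_in_add: "F \<in> polys_in X \<Longrightarrow> G \<in> polys_in X \<Longrightarrow> F + G \<in> polys_in X"
  unfolding polys_in_def using Poly_Mapping.keys_add[of F G] by auto

lemma polys_in_zero: "0 \<in> polys_in X"
  unfolding polys_in_def by auto

lemma polys_in_sum: "(\<And>i. i \<in> I \<Longrightarrow> F i \<in> polys_in X) \<Longrightarrow> sum F I \<in> polys_in X"
  by (induction I rule: infinite_finite_induct) (auto intro: polys_in_zero polys_in_add)

lemma polys_in_mult:
  assumes "F \<in> polys_in X" "G \<in> polys_in X" shows "F * G \<in> polys_in X"
  unfolding polys_in_def
proof (intro CollectI ballI)
  fix m assume "m \<in> keys (F * G)"
  then obtain k l where kl: "m = k + l" "k \<in> keys F" "l \<in> keys G"
    using Poly_Mapping.keys_mult[of F G] by blast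
  then have "keys k \<subseteq> X" "keys l \<subseteq> X" using assms unfolding polys_in_def by auto
  then show "keys m \<subseteq> X" using kl(1) Poly_Mapping.keys_add[of k l] by blast
qed

lemma subdomain_poly_ring: "subdomain (poly_ring X :: ('x, 'b::idom) mpoly fract set)"
proof
  show "0 \<in> (poly_ring X :: ('x, 'b) mpoly fract set)"
    unfolding poly_ring_def using polys_in_zero by force
  have "(1 :: ('x, 'b) mpoly) \<in> polys_in X" unfolding polys_in_def by simp
  then show "1 \<in> (poly_ring X :: ('x, 'b) mpoly fract set)" unfolding poly_ring_def by force
  fix a b :: "('x, 'b) mpoly fract" assume "a \<in> poly_ring X" "b \<in> poly_ring X"
  then obtain F G where "F \<in> polys_in X" "a = to_fract F" "G \<in> polys_in X" "b = to_fract G"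
    unfolding poly_ring_def by auto
  then have "a + b = to_fract (F + G)" "F + G \<in> polys_in X" "a * b = to_fract (F * G)" "F * G \<in> polys_in X"
    by (auto intro: polys_in_add polys_in_mult)
  then show "a + b \<in> poly_ring X" "a * b \<in> poly_ring X" unfolding poly_ring_def by (metis imageI)+
next
  fix a :: "('x, 'b) mpoly fract" assume "a \<in> poly_ring X"
  then obtain F where F: "F \<in> polys_in X" "a = to_fract F" unfolding poly_ring_def by auto
  then have "- a = to_fract (- F)" "- F \<in> polys_in X" unfolding polys_in_iff by auto
  then show "- a \<in> poly_ring X" unfolding poly_ring_def by (metis imageI)
qed

lemma to_fract_mem_poly_ring: "to_fract F \<in> poly_ring X \<longleftrightarrow> F \<in> polys_in X"
  unfolding poly_ring_def by auto

lemma poly_ring_mono: "X \<subseteq> Y \<Longrightarrow> poly_ring X \<subseteq> poly_ring Y"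
  unfolding poly_ring_def using polys_in_mono by blast

lemma cst_mem: "cst c \<in> poly_ring X"
  unfolding to_fract_mem_poly_ring by (rule polys_in_single) simp

lemma polys_in_empty: "F \<in> polys_in {} \<Longrightarrow> F = single 0 (lookup F 0)"
proof (rule poly_mapping_eqI)
  fix m assume "F \<in> polys_in {}"
  then have "lookup F m = 0" if "m \<noteq> 0" using that unfolding polys_in_iff by (metis keys_eq_empty subset_empty)
  then show "lookup F m = lookup (single 0 (lookup F 0)) m"
    by (cases "m = 0") (auto simp: lookup_single)
qed

lemma poly_ring_empty: "poly_ring {} = range cst"
proof -
  have "to_fract F \<in> range cst" if "F \<in> polys_in {}" for F :: "('x, 'b) mpoly"
    using polys_in_empty[OF that] by (metis rangeI)
  then show ?thesis using cst_mem unfolding poly_ring_def by blast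
qed

lemma cst_simps: "cst (a + b) = cst a + cst b" "cst (a * b) = cst a * cst b" "cst 0 = 0" "cst 1 = 1"
  "cst a = cst b \<longleftrightarrow> a = b"
proof -
  show "cst (a * b) = cst a * cst b" by (simp add: mult_single flip: to_fract_mult)
  show "cst a = cst b \<longleftrightarrow> a = b" by (metis lookup_single_eq to_fract_eq_iff)
qed (simp_all add: single_add)

text \<open>
  The last clause, by which every coefficient of \<open>F\<close> is one of some \<open>G i\<close>, is what inductions over
  the number of indeterminates need.
\<close>

lemma collect_powers:
  fixes F :: "('x, 'a::idom) mpoly"
  assumes "F \<in> polys_in (insert y V)"
  obtains G n where "\<forall>i. G i \<in> polys_in V" "\<forall>i\<ge>n. G i = 0"
    "F = (\<Sum>i<n. G i * single (single y i) 1)"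
    "\<forall>m. lookup F m = lookup (G (lookup m y)) (m - single y (lookup m y))"
proof -
  let ?s = "\<lambda>i. single y i"
  let ?K = "\<lambda>i. {m \<in> keys F. lookup m y = i}"
  define G where "G i = (\<Sum>m\<in>?K i. single (m - ?s i) (lookup F m))" for i
  define n where "n = Suc (Max (insert 0 ((\<lambda>m. lookup m y) ` keys F)))"
  have split: "m - ?s (lookup m y) + ?s (lookup m y) = m" for m :: "'x indet \<Rightarrow>\<^sub>0 nat"
    by (rule poly_mapping_eqI) (auto simp: lookup_add lookup_minus lookup_single when_def)
  have n: "lookup m y < n" if "m \<in> keys F" for m
    unfolding n_def less_Suc_eq_le using that by (intro Max_ge) auto
  show thesis
  proof (rule that, safe)
    show "G i \<in> polys_in V" for i
      unfolding G_def
    proof (intro polys_in_sum polys_in_single subsetI)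
      fix m z assume m: "m \<in> ?K i" and z: "z \<in> keys (m - ?s i)"
      have "z \<noteq> y" using m z by (auto simp: in_keys_iff lookup_minus)
      moreover have "z \<in> keys m" using z by (auto simp: in_keys_iff lookup_minus)
      ultimately show "z \<in> V" using assms m unfolding polys_in_def by auto
    qed
    show "G i = 0" if "i \<ge> n" for i
    proof -
      have "?K i = {}" using n that by force
      then show ?thesis unfolding G_def by (simp only: sum.empty)
    qed
    have "G i * single (?s i) 1 = (\<Sum>m\<in>?K i. single m (lookup F m))" for i
      unfolding G_def sum_distrib_right by (intro sum.cong refl) (auto simp: mult_single split)
    then have "(\<Sum>i<n. G i * single (?s i) 1) =
        (\<Sum>i<n. \<Sum>m\<in>?K i. single m (lookup F m))" by simp
    also have "\<dots> = (\<Sum>m\<in>keys F. single m (lookup F m))"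
      by (rule sum.group) (use n in auto)
    finally show "F = (\<Sum>i<n. G i * single (?s i) 1)" using mpoly_eq_sum[of F] by simp
    fix m :: "'x indet \<Rightarrow>\<^sub>0 nat"
    let ?i = "lookup m y"
    have "m' - ?s ?i = m - ?s ?i \<longleftrightarrow> m' = m" if "m' \<in> ?K ?i" for m'
      using that split[of m] split[of m'] by (metis (mono_tags, lifting) mem_Collect_eq)
    then have "lookup (G ?i) (m - ?s ?i) = (\<Sum>m'\<in>?K ?i. if m' = m then lookup F m' else 0)"
      unfolding G_def lookup_sum by (intro sum.cong refl) (auto simp: lookup_single when_def)
    also have "\<dots> = lookup F m" by (auto simp: in_keys_iff)
    finally show "lookup F m = lookup (G ?i) (m - ?s ?i)" by simp
  qed
qed

lemma to_fract_power: "to_fract (F ^ n) = to_fract F ^ n"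
  by (induction n) auto

lemma var_power: "var y ^ i = to_fract (single (single y i) 1)"
proof -
  have "single (single y 1) (1::'b) ^ i = single (single y i) 1"
    by (induction i) (simp_all add: mult_single flip: single_add)
  then show ?thesis by (simp flip: to_fract_power)
qed

lemma poly_at_var:
  fixes p :: "('x, 'a::idom) mpoly fract poly"
  assumes "\<And>i. coeff p i = to_fract (G i)" "degree p < n"
  shows "poly p (var y) = to_fract (\<Sum>i<n. G i * single (single y i) 1)"
proof -
  have "poly p (var y) = (\<Sum>i\<le>degree p. coeff p i * var y ^ i)" by (rule poly_altdef)
  also have "\<dots> = (\<Sum>i<n. coeff p i * var y ^ i)"
    using assms(2) by (intro sum.mono_neutral_left) (auto simp: coeff_eq_0)
  finally show ?thesis by (simp add: assms(1) var_power del: One_nat_def)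
qed

lemma polynomial_extension_poly_ring:
  assumes "y \<notin> V"
  shows "polynomial_extension (poly_ring V :: ('x, 'a::idom) mpoly fract set) (var y)"
proof (intro polynomial_extension.intro subdomain_poly_ring polynomial_extension_axioms.intro)
  fix p :: "('x, 'a) mpoly fract poly" assume p: "p \<in> polys_over (poly_ring V)" "poly p (var y) = 0"
  have "\<forall>i. \<exists>G. G \<in> polys_in V \<and> coeff p i = to_fract G"
    using p(1) unfolding polys_over_def poly_ring_def by blast
  then obtain G where G: "\<And>i. G i \<in> polys_in V" "\<And>i. coeff p i = to_fract (G i)" by metis
  let ?s = "\<lambda>i. single y i" and ?n = "Suc (degree p)"
  have "to_fract (\<Sum>i<?n. G i * single (?s i) 1) = poly p (var y)"
    by (rule poly_at_var[OF G(2), symmetric]) simp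
  also have "\<dots> = 0" by (rule p(2))
  finally have zero: "(\<Sum>i<?n. G i * single (?s i) 1) = 0"
    by (simp only: to_fract_eq_0_iff)
  have Gy: "lookup k y = 0" if "k \<in> keys (G i)" for k i
    using that G(1)[of i] assms unfolding polys_in_def by (metis (no_types, lifting) in_keys_iff mem_Collect_eq subsetD)
  have "lookup (G j) k = 0" if j: "j < ?n" for j k
  proof (rule ccontr)
    assume ne: "lookup (G j) k \<noteq> 0"
    then have k: "k \<in> keys (G j)" by (simp add: in_keys_iff)
    \<comment> \<open>\<open>y\<close> occurs in no \<open>G i\<close>, so its exponent in a monomial tells the summands apart\<close>
    have "lookup (G i * single (?s i) 1) (k + ?s j) = (if i = j then lookup (G j) k else 0)" for i
    proof (cases "i = j")
      case True
      then have "lookup (G i * single (?s i) 1) (k + ?s j) =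
          (\<Sum>l\<in>keys (G j). if l = k then lookup (G j) l else 0)"
        unfolding lookup_mult_sum by (intro sum.cong) auto
      then show ?thesis using True by (simp add: in_keys_iff)
    next
      case False
      have "l + ?s i \<noteq> k + ?s j" if "l \<in> keys (G i)" for l
      proof
        assume "l + ?s i = k + ?s j"
        then have "lookup (l + ?s i) y = lookup (k + ?s j) y" by simp
        then show False using Gy[OF that] Gy[OF k] False by (simp add: lookup_add)
      qed
      then show ?thesis using False by (simp add: lookup_mult_sum)
    qed
    then have "lookup (\<Sum>i<?n. G i * single (?s i) 1) (k + ?s j) = lookup (G j) k"
      using j by (simp add: lookup_sum del: sum.lessThan_Suc)
    then show False using zero ne by simp
  qed
  then have "G j = 0" if "j < ?n" for j using that by (intro poly_mapping_eqI) simp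
  then have "coeff p (degree p) = 0" using G(2) by simp
  then show "p = 0" by simp
qed

lemma poly_ring_insert:
  "poly_ring (insert y V) = polys_at (poly_ring V :: ('x, 'a::idom) mpoly fract set) (var y)"
proof
  have sub: "subdomain (poly_ring (insert y V) :: ('x, 'a) mpoly fract set)" by (rule subdomain_poly_ring)
  show "polys_at (poly_ring V) (var y) \<subseteq> (poly_ring (insert y V) :: ('x, 'a) mpoly fract set)"
  proof
    fix a :: "('x, 'a) mpoly fract" assume "a \<in> polys_at (poly_ring V) (var y)"
    then obtain p where p: "\<And>i. coeff p i \<in> poly_ring V" "a = poly p (var y)"
      unfolding polys_at_def polys_over_def by auto
    have "coeff p i \<in> poly_ring (insert y V)" for i using p(1) poly_ring_mono[of V "insert y V"] by blast
    moreover have "var y \<in> (poly_ring (insert y V) :: ('x, 'a) mpoly fract set)"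
      unfolding to_fract_mem_poly_ring by (rule polys_in_single) simp
    ultimately show "a \<in> poly_ring (insert y V)" unfolding p(2) poly_altdef
      by (intro subdomain.sum_mem[OF sub] subdomain.mult_mem[OF sub] subdomain.power_mem[OF sub])
  qed
  show "(poly_ring (insert y V) :: ('x, 'a) mpoly fract set) \<subseteq> polys_at (poly_ring V) (var y)"
  proof
    fix a :: "('x, 'a) mpoly fract" assume "a \<in> poly_ring (insert y V)"
    then obtain F where F: "F \<in> polys_in (insert y V)" "a = to_fract F" unfolding poly_ring_def by auto
    obtain G n where G: "\<forall>i. G i \<in> polys_in V" "\<forall>i\<ge>n. G i = 0"
      "F = (\<Sum>i<n. G i * single (single y i) 1)"
      by (rule collect_powers[OF F(1)])
    define p where "p = (\<Sum>i<n. monom (to_fract (G i)) i)"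
    have c: "coeff p i = to_fract (G i)" for i
      unfolding p_def using G(2) by (simp add: coeff_sum)
    have "poly p (var y) = (\<Sum>i<n. to_fract (G i) * var y ^ i)"
      unfolding p_def by (simp add: poly_sum poly_monom)
    then have "a = poly p (var y)" unfolding F(2) G(3) by (simp add: var_power del: One_nat_def)
    moreover have "p \<in> polys_over (poly_ring V)"
      unfolding polys_over_def using G(1) c by (auto simp: poly_ring_def)
    ultimately show "a \<in> polys_at (poly_ring V) (var y)" unfolding polys_at_def by auto
  qed
qed

section \<open>Maximal \<open>t\<close>-ideals of polynomial rings\<close>

text \<open>
  A copy of the coefficient ring inside the quotient field of \<open>R[X]\<close>.
\<close>

abbreviation base_ring :: "('x, 'a::idom) mpoly fract set" where
  "base_ring \<equiv> poly_ring {}"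

interpretation const: subdomain "base_ring :: ('x, 'a::idom) mpoly fract set"
  by (rule subdomain_poly_ring)

text \<open>
  The ideal \<open>P[X]\<close>.
\<close>

definition extended :: "'x indet set \<Rightarrow> ('x, 'a::idom) mpoly fract set \<Rightarrow> ('x, 'a) mpoly fract set" where
  "extended X P = to_fract ` {F \<in> polys_in X. \<forall>m. cst (lookup F m) \<in> P}"

lemma mem_extended_iff:
  "to_fract F \<in> extended X P \<longleftrightarrow> F \<in> polys_in X \<and> (\<forall>m. cst (lookup F m) \<in> P)"
  unfolding extended_def by auto

lemma poly_ring_cases:
  assumes "a \<in> poly_ring X" obtains F where "F \<in> polys_in X" "a = to_fract F"
  using assms unfolding poly_ring_def by blast

lemma base_ring_subset: "base_ring \<subseteq> poly_ring X"
  by (rule poly_ring_mono) simp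

lemma quotient_field_base_ring_subset: "quotient_field base_ring \<subseteq> quotient_field (poly_ring X)"
  unfolding quotient_field_def using base_ring_subset by blast

lemma quotient_field_base_ring_cases:
  assumes "u \<in> quotient_field base_ring"
  obtains r t where "t \<noteq> 0" "u = cst r / cst t"
proof -
  obtain a b where ab: "a \<in> base_ring" "b \<in> base_ring" "b \<noteq> 0" "u = a / b"
    using assms by (rule const.quotient_field_cases)
  then obtain r t where "a = cst r" "b = cst t" unfolding poly_ring_empty by blast
  moreover from this have "t \<noteq> 0" using ab(3) by auto
  ultimately show ?thesis using that ab(4) by blast
qed

lemma cst_mem_extended: "c \<in> P \<Longrightarrow> ideal_of base_ring P \<Longrightarrow> c \<in> extended X P"
proof -
  assume c: "c \<in> P" and P: "ideal_of base_ring P"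
  then obtain a where a: "c = cst a" using ideal_of_subset[OF P] unfolding poly_ring_empty by blast
  have "cst (lookup (single 0 a) m) \<in> P" for m
    using c a ideal_of_zero[OF P] by (cases "m = 0") (auto simp: lookup_single)
  then show "c \<in> extended X P" unfolding a mem_extended_iff by (auto intro: polys_in_single)
qed

lemma const_times_mem_poly_ring_iff:
  fixes F :: "('x, 'a::idom) mpoly"
  assumes u: "u \<in> quotient_field base_ring" and F: "F \<in> polys_in X"
  shows "u * to_fract F \<in> poly_ring X \<longleftrightarrow> (\<forall>m. u * cst (lookup F m) \<in> base_ring)"
proof
  obtain r t where rt: "t \<noteq> 0" "u = cst r / cst t" by (rule quotient_field_base_ring_cases[OF u])
  have t0: "cst t \<noteq> (0 :: ('x, 'a) mpoly fract)" using rt(1) cst_simps(3,5) by metis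
  assume "u * to_fract F \<in> poly_ring X"
  then obtain G where G: "G \<in> polys_in X" "u * to_fract F = to_fract G" by (rule poly_ring_cases)
  have "cst r * to_fract F = cst t * to_fract G" using G(2) t0 unfolding rt(2) by (simp add: field_simps)
  then have "single 0 r * F = single 0 t * G" by (simp flip: to_fract_mult)
  then have eq: "r * lookup F m = t * lookup G m" for m
    by (metis lookup_const_mult)
  have "u * cst (lookup F m) = cst (lookup G m)" for m
  proof -
    have "cst r * cst (lookup F m) = cst t * (cst (lookup G m) :: ('x, 'a) mpoly fract)"
      using eq[of m] cst_simps(2) by metis
    then show ?thesis using t0 unfolding rt(2) by (simp add: field_simps)
  qed
  then show "\<forall>m. u * cst (lookup F m) \<in> base_ring" using cst_mem by metis
next
  assume "\<forall>m. u * cst (lookup F m) \<in> base_ring"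
  then have mem: "\<And>m. u * cst (lookup F m) \<in> poly_ring X" using base_ring_subset by blast
  have "to_fract F = (\<Sum>m\<in>keys F. cst (lookup F m) * to_fract (single m 1))"
    by (subst mpoly_eq_sum) (simp add: mult_single flip: to_fract_mult)
  then have "u * to_fract F = (\<Sum>m\<in>keys F.
      (u * cst (lookup F m)) * to_fract (single m 1))"
    by (simp add: sum_distrib_left mult.assoc)
  moreover have "to_fract (single m 1) \<in> poly_ring X" if "m \<in> keys F" for m
    unfolding to_fract_mem_poly_ring using F that by (intro polys_in_single) (auto simp: polys_in_def)
  ultimately show "u * to_fract F \<in> poly_ring X"
    using mem by (metis (no_types, lifting) subdomain.sum_mem[OF subdomain_poly_ring]
        subdomain.mult_mem[OF subdomain_poly_ring])
qed

lemma const_mem_poly_ring_iff: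
  fixes u :: "('x, 'a::idom) mpoly fract"
  assumes "u \<in> quotient_field base_ring"
  shows "u \<in> poly_ring X \<longleftrightarrow> u \<in> base_ring"
proof
  assume "u \<in> poly_ring X"
  moreover have "(1 :: ('x, 'a) mpoly) \<in> polys_in X" unfolding polys_in_def by simp
  ultimately have "u * cst (lookup (1 :: ('x, 'a) mpoly) 0) \<in> base_ring"
    using const_times_mem_poly_ring_iff[OF assms, of 1 X] by (metis mult.right_neutral to_fract_1)
  then show "u \<in> base_ring" by simp
qed (use base_ring_subset in blast)

lemma ideal_of_extended:
  fixes P :: "('x, 'a::idom) mpoly fract set"
  assumes P: "ideal_of base_ring P"
  shows "ideal_of (poly_ring X) (extended X P)"
  unfolding ideal_of_def
proof (intro conjI ballI)
  show "extended X P \<subseteq> poly_ring X" unfolding extended_def poly_ring_def by auto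
  have "to_fract 0 \<in> extended X P"
    unfolding mem_extended_iff using ideal_of_zero[OF P] cst_simps(3) by (simp add: polys_in_zero)
  then show "0 \<in> extended X P" by simp
  fix a assume "a \<in> extended X P"
  then obtain F where F: "F \<in> polys_in X" "\<And>m. cst (lookup F m) \<in> P" "a = to_fract F"
    unfolding extended_def by blast
  { fix b assume "b \<in> extended X P"
    then obtain G where G: "G \<in> polys_in X" "\<And>m. cst (lookup G m) \<in> P" "b = to_fract G"
      unfolding extended_def by blast
    have "cst (lookup (F + G) m) \<in> P" for m
      using ideal_of_add[OF P F(2) G(2)] cst_simps(1) by (metis lookup_add)
    then have "to_fract (F + G) \<in> extended X P"
      unfolding mem_extended_iff using F G polys_in_add by blast
    then show "a + b \<in> extended X P" using F G by simp }
  fix r :: "('x, 'a) mpoly fract" assume "r \<in> poly_ring X"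
  then obtain H where H: "H \<in> polys_in X" "r = to_fract H" by (rule poly_ring_cases)
  have "cst (lookup (H * F) m) \<in> P" for m
  proof -
    let ?t = "\<lambda>k l. if k + l = m then lookup H k * lookup F l else 0"
    have cst_sum: "cst (\<Sum>i\<in>I. f i) = (\<Sum>i\<in>I. cst (f i) :: ('x, 'a) mpoly fract)" for I :: "('x indet \<Rightarrow>\<^sub>0 nat) set" and f
      by (induction I rule: infinite_finite_induct) (simp_all only: sum.infinite sum.empty sum.insert cst_simps not_False_eq_True)
    have "cst (?t k l) \<in> P" for k l
    proof (cases "k + l = m")
      case True
      have "cst (lookup H k) * cst (lookup F l) \<in> P"
        by (rule ideal_of_mult[OF P cst_mem F(2)])
      then show ?thesis unfolding True cst_simps(2)[symmetric] by simp
    next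
      case False
      then show ?thesis by (simp only: if_False cst_simps(3) ideal_of_zero[OF P])
    qed
    then show ?thesis unfolding lookup_mult_sum cst_sum by (intro ideal_of_sum[OF P])
  qed
  then have "to_fract (H * F) \<in> extended X P"
    unfolding mem_extended_iff using F H polys_in_mult by blast
  then show "r * a \<in> extended X P" using F H by simp
qed

text \<open>
  The multiplier can be chosen in the quotient field of \<open>R\<close>, since only the finitely many
  coefficients of \<open>A\<close> matter, and these lie in \<open>P\<close>.
\<close>

lemma t_proper_base_multiplier:
  fixes P :: "('x, 'a::idom) mpoly fract set"
  assumes P: "t_proper base_ring P" and A: "finite A" "A \<subseteq> extended X P"
  shows "\<exists>u\<in>quotient_field base_ring - base_ring. \<forall>a\<in>A. u * a \<in> poly_ring X"
proof -
  have "\<forall>a\<in>A. \<exists>F. F \<in> polys_in X \<and> (\<forall>m. cst (lookup F m) \<in> P) \<and> a = to_fract F"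
    using A(2) unfolding extended_def by blast
  then obtain F where F: "\<And>a. a \<in> A \<Longrightarrow>
      F a \<in> polys_in X \<and> (\<forall>m. cst (lookup (F a) m) \<in> P) \<and> a = to_fract (F a)" by metis
  define C :: "('x, 'a) mpoly fract set" where "C = (\<Union>a\<in>A. (\<lambda>m. cst (lookup (F a) m)) ` keys (F a))"
  have "finite C" unfolding C_def using A by auto
  moreover have "C \<subseteq> P" unfolding C_def using F by blast
  ultimately obtain u where u: "u \<in> quotient_field base_ring" "u \<notin> base_ring" "\<forall>c\<in>C. u * c \<in> base_ring"
    using const.t_proper_witness[OF P, of C] by blast
  have "u * a \<in> poly_ring X" if a: "a \<in> A" for a
  proof -
    have "u * cst (lookup (F a) m) \<in> base_ring" for m
    proof (cases "m \<in> keys (F a)")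
      case True then show ?thesis using u(3) a unfolding C_def by blast
    next
      case False
      then have "cst (lookup (F a) m) = (0 :: ('x, 'a) mpoly fract)"
        using cst_simps(3) by (metis in_keys_iff)
      then show ?thesis using const.zero_mem by (metis mult_zero_right)
    qed
    then show ?thesis using const_times_mem_poly_ring_iff[OF u(1)] F[OF a] by metis
  qed
  then show ?thesis using u(1,2) by blast
qed

lemma t_proper_extended:
  fixes P :: "('x, 'a::idom) mpoly fract set"
  assumes P: "t_proper base_ring P"
  shows "t_proper (poly_ring X) (extended X P)"
  unfolding t_proper_def
proof (intro conjI allI impI)
  note idl = const.t_proper_ideal[OF P]
  show "ideal_of (poly_ring X) (extended X P)" by (rule ideal_of_extended[OF idl])
  obtain c where "c \<in> P" "c \<noteq> 0" using const.t_proper_nonzero[OF P] .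
  then show "extended X P \<noteq> {0}" using cst_mem_extended[OF _ idl] by blast
  fix A assume "finite A \<and> A \<subseteq> extended X P"
  then obtain u where u: "u \<in> quotient_field base_ring" "u \<notin> base_ring" "\<forall>a\<in>A. u * a \<in> poly_ring X"
    using t_proper_base_multiplier[OF P, of A X] by blast
  then show "\<exists>u\<in>quotient_field (poly_ring X) - poly_ring X. \<forall>a\<in>A. u * a \<in> poly_ring X"
    using quotient_field_base_ring_subset const_mem_poly_ring_iff[OF u(1)] by blast
qed

text \<open>
  A multiplier \<open>u\<close> of the constant \<open>c\<close> is a polynomial over the quotient field of \<open>R\<close>. It is not in
  \<open>R[X]\<close>, so one of its coefficients is not in \<open>R\<close>, and this coefficient maps \<open>A\<close> into \<open>R\<close> because
  \<open>u\<close> maps \<open>A\<close> into \<open>R[X]\<close>.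
\<close>

lemma t_proper_contraction:
  fixes M :: "('x, 'a::idom) mpoly fract set"
  assumes M: "t_proper (poly_ring X) M" and c: "c \<in> M" "c \<in> base_ring" "c \<noteq> 0"
  shows "t_proper base_ring (M \<inter> base_ring)"
  unfolding t_proper_def
proof (intro conjI allI impI)
  interpret subdomain "poly_ring X :: ('x, 'a) mpoly fract set" by (rule subdomain_poly_ring)
  note idl = t_proper_ideal[OF M]
  show "ideal_of base_ring (M \<inter> base_ring)"
    unfolding ideal_of_def
    using ideal_of_zero[OF idl] ideal_of_add[OF idl] ideal_of_mult[OF idl] base_ring_subset[of X]
      const.zero_mem const.add_mem const.mult_mem by (auto simp: subset_iff)
  show "M \<inter> base_ring \<noteq> {0}" using c by blast
  fix A assume A: "finite A \<and> A \<subseteq> M \<inter> base_ring"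
  then obtain u where u: "u \<in> quotient_field (poly_ring X)" "u \<notin> poly_ring X"
      "\<forall>a\<in>insert c A. u * a \<in> poly_ring X"
    using t_proper_witness[OF M, of "insert c A"] c by blast
  obtain G where G: "G \<in> polys_in X" "u * c = to_fract G" using u(3) by (blast elim: poly_ring_cases)
  have inv: "1 / c \<in> quotient_field base_ring"
    using const.divide_mem_quotient_field const.one_mem c by blast
  have uc: "u = 1 / c * to_fract G" using G(2) c(3) by (simp flip: G(2))
  then obtain m where m: "1 / c * cst (lookup G m) \<notin> base_ring"
    using u(2) const_times_mem_poly_ring_iff[OF inv G(1)] by blast
  let ?v = "1 / c * cst (lookup G m)"
  have "?v * a \<in> base_ring" if a: "a \<in> A" for a
  proof -
    have "a \<in> base_ring" using a A by blast
    then have "1 / c * a \<in> quotient_field base_ring"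
      using const.quotient_field_mult[OF inv] const.mem_quotient_field by blast
    moreover have "1 / c * a * to_fract G \<in> poly_ring X"
    proof -
      have "1 / c * a * to_fract G = u * a" unfolding uc by (simp add: ac_simps)
      then show ?thesis using u(3) a by simp
    qed
    ultimately have "1 / c * a * cst (lookup G m) \<in> base_ring"
      using const_times_mem_poly_ring_iff[OF _ G(1)] by blast
    then show ?thesis by (simp add: ac_simps)
  qed
  moreover have "?v \<in> quotient_field base_ring"
    using const.quotient_field_mult[OF inv] const.mem_quotient_field[OF cst_mem] by blast
  ultimately show "\<exists>u\<in>quotient_field base_ring - base_ring. \<forall>a\<in>A. u * a \<in> base_ring"
    using m by blast
qed

text \<open>
  Uppers to zero in the sense of \<open>B[y]\<close> with \<open>B = R[X - {y}]\<close>. Such an ideal may meet the subring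
  for another indeterminate nontrivially, hence the dependence on \<open>y\<close>.
\<close>

definition upper_at :: "'x indet set \<Rightarrow> 'x indet \<Rightarrow> ('x, 'a::idom) mpoly fract set \<Rightarrow> bool" where
  "upper_at X y M \<longleftrightarrow> M \<inter> poly_ring (X - {y}) \<subseteq> {0}"

lemma one_variable:
  assumes "y \<in> X"
  shows "polynomial_extension (poly_ring (X - {y}) :: ('x, 'a::idom) mpoly fract set) (var y)"
    and "polys_at (poly_ring (X - {y}) :: ('x, 'a::idom) mpoly fract set) (var y) = poly_ring X"
proof -
  show "polynomial_extension (poly_ring (X - {y}) :: ('x, 'a::idom) mpoly fract set) (var y)"
    by (rule polynomial_extension_poly_ring) simp
  show "polys_at (poly_ring (X - {y}) :: ('x, 'a::idom) mpoly fract set) (var y) = poly_ring X"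
    using poly_ring_insert[of y "X - {y}", where 'a = 'a] unfolding insert_Diff[OF assms] by simp
qed

lemma upper_at_base: "upper_at X y M \<Longrightarrow> M \<inter> base_ring \<subseteq> {0}"
  unfolding upper_at_def using base_ring_subset by blast

lemma upper_not_extended:
  assumes "upper_at X y M" "P \<in> t_Max base_ring"
  shows "\<not> extended X P \<subseteq> M"
proof
  assume sub: "extended X P \<subseteq> M"
  obtain c where c: "c \<in> P" "c \<noteq> 0" using const.t_proper_nonzero[OF const.t_Max_t_proper[OF assms(2)]] .
  note idl = const.t_Max_ideal[OF assms(2)]
  have "c \<in> M" "c \<in> base_ring" using sub cst_mem_extended[OF c(1) idl] ideal_of_subset[OF idl c(1)] by auto
  then show False using upper_at_base[OF assms(1)] c(2) by blast
qed

text \<open>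
  If \<open>M\<close> is not an upper in any of the indeterminates of \<open>F\<close>, then each of them can be treated as
  the variable of a polynomial ring in one variable; collecting its powers replaces \<open>F\<close> by
  elements of \<open>M\<close> that involve one indeterminate less.
\<close>

lemma t_Max_coeffs_mem:
  fixes F :: "('x, 'a::idom) mpoly"
  assumes M: "M \<in> t_Max (poly_ring X)" and Y: "finite Y" "Y \<subseteq> X"
    and not_upper: "\<And>y. y \<in> Y \<Longrightarrow> \<not> upper_at X y M"
    and F: "F \<in> polys_in Y" "to_fract F \<in> M"
  shows "cst (lookup F m) \<in> M"
  using Y not_upper F
proof (induction Y arbitrary: F m rule: finite_induct)
  case empty
  interpret subdomain "poly_ring X :: ('x, 'a) mpoly fract set" by (rule subdomain_poly_ring)
  have eq: "F = single 0 (lookup F 0)" using polys_in_empty empty.prems by blast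
  show ?case
  proof (cases "m = 0")
    case True
    then show ?thesis using eq empty.prems by metis
  next
    case False
    then have "lookup F m = 0" by (subst eq) (simp add: lookup_single)
    then show ?thesis using ideal_of_zero[OF t_Max_ideal[OF M]] cst_simps(3) by metis
  qed
next
  case (insert y Y)
  have y: "y \<in> X" using insert.prems by auto
  interpret polynomial_extension "poly_ring (X - {y}) :: ('x, 'a) mpoly fract set" "var y"
    by (rule one_variable(1)[OF y])
  note D = one_variable(2)[OF y, where 'a = 'a]
  obtain c where c: "c \<in> M" "c \<in> poly_ring (X - {y})" "c \<noteq> 0"
    using insert.prems(2)[of y] unfolding upper_at_def by blast
  obtain G n where G: "\<forall>i. G i \<in> polys_in Y" "\<forall>i\<ge>n. G i = 0"
      "F = (\<Sum>i<n. G i * single (single y i) 1)"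
      "\<forall>m. lookup F m =
        lookup (G (lookup m y)) (m - single y (lookup m y))"
    by (rule collect_powers[OF insert.prems(3)])
  define p where "p = (\<Sum>i<n. monom (to_fract (G i)) i)"
  have coeff: "coeff p i = to_fract (G i)" for i
    unfolding p_def using G(2) by (simp add: coeff_sum)
  have "Y \<subseteq> X - {y}" using insert by auto
  then have "G i \<in> polys_in (X - {y})" for i using G(1) polys_in_mono by blast
  then have p: "p \<in> polys_over (poly_ring (X - {y}))"
    unfolding polys_over_def using coeff by (auto simp: poly_ring_def)
  have "poly p (var y) = (\<Sum>i<n. to_fract (G i) * var y ^ i)"
    unfolding p_def by (simp add: poly_sum poly_monom)
  then have "poly p (var y) = to_fract F" unfolding G(3) by (simp add: var_power del: One_nat_def)
  then have "poly p (var y) \<in> M" using insert.prems(4) by metis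
  then have "coeff p i \<in> M" for i
    using t_Max_coeff_mem[of M c p i] M c p unfolding D by blast
  then have "to_fract (G i) \<in> M" for i using coeff by metis
  then have "cst (lookup (G i) k) \<in> M" for i k
    using insert.IH[of "G i" k] insert.prems(1,2) G(1) by blast
  then show ?case using G(4) by metis
qed

lemma finite_indets: "finite (\<Union>m\<in>keys F. keys m)"
  by simp

text \<open>
  Otherwise \<open>M\<close> would contain the coefficients of \<open>F\<close> in \<open>R\<close>.
\<close>

lemma upper_at_some_indet:
  fixes F :: "('x, 'a::idom) mpoly"
  assumes M: "M \<in> t_Max (poly_ring X)" and MR: "M \<inter> base_ring \<subseteq> {0}"
    and F: "F \<in> polys_in X" "F \<noteq> 0" "to_fract F \<in> M"
  shows "\<exists>y\<in>X \<inter> (\<Union>m\<in>keys F. keys m). upper_at X y M"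
proof (rule ccontr)
  assume no: "\<not> ?thesis"
  let ?Y = "\<Union>m\<in>keys F. keys m"
  have "?Y \<subseteq> X" using F(1) unfolding polys_in_def by auto
  moreover have "F \<in> polys_in ?Y" unfolding polys_in_def by auto
  ultimately have mem: "cst (lookup F m) \<in> M" for m
    using t_Max_coeffs_mem[OF M finite_indets _ _ _ F(3)] no by blast
  obtain m where m: "lookup F m \<noteq> 0" using F(2) by (metis lookup_zero poly_mapping_eqI)
  have "cst (lookup F m) \<in> M \<inter> base_ring" using mem cst_mem by blast
  then have "cst (lookup F m) = (0 :: ('x, 'a) mpoly fract)" using MR by blast
  then show False using m cst_simps(3,5) by metis
qed

lemma t_Max_poly_ring_cases:
  fixes M :: "('x, 'a::idom) mpoly fract set"
  assumes M: "M \<in> t_Max (poly_ring X)"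
  obtains (extended) P where "P \<in> t_Max base_ring" "M = extended X P"
  | (upper) y where "y \<in> X" "upper_at X y M"
proof (cases "\<exists>y\<in>X. upper_at X y M")
  case True
  then show ?thesis using upper by blast
next
  case False
  interpret subdomain "poly_ring X :: ('x, 'a) mpoly fract set" by (rule subdomain_poly_ring)
  note tp = t_Max_t_proper[OF M]
  note idl = t_proper_ideal[OF tp]
  let ?P = "M \<inter> base_ring"
  have coeffs: "cst (lookup F m) \<in> M" if F: "F \<in> polys_in X" "to_fract F \<in> M" for F m
  proof -
    let ?Y = "\<Union>m\<in>keys F. keys m"
    have "?Y \<subseteq> X" using F(1) unfolding polys_in_def by auto
    moreover have "F \<in> polys_in ?Y" unfolding polys_in_def by auto
    ultimately show ?thesis using t_Max_coeffs_mem[OF M finite_indets _ _ _ F(2)] False by blast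
  qed
  have sub: "M \<subseteq> extended X ?P"
  proof
    fix a assume a: "a \<in> M"
    then obtain F where F: "F \<in> polys_in X" "a = to_fract F"
      using ideal_of_subset[OF idl] by (blast elim: poly_ring_cases)
    then show "a \<in> extended X ?P" using a coeffs cst_mem mem_extended_iff by blast
  qed
  obtain a where a: "a \<in> M" "a \<noteq> 0" using t_proper_nonzero[OF tp] .
  obtain F where F: "F \<in> polys_in X" "a = to_fract F"
    using a ideal_of_subset[OF idl] by (blast elim: poly_ring_cases)
  then obtain m where m: "lookup F m \<noteq> 0"
    using a(2) by (metis lookup_zero poly_mapping_eqI to_fract_0)
  have c: "cst (lookup F m) \<in> M" "cst (lookup F m) \<noteq> (0 :: ('x, 'a) mpoly fract)"
    using coeffs F a m cst_simps(3,5) by metis+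
  have P: "t_proper base_ring ?P" by (rule t_proper_contraction[OF tp c(1) cst_mem c(2)])
  have eq: "extended X ?P = M" by (rule t_Max_maximal[OF M t_proper_extended[OF P] sub])
  have "?P \<in> t_Max base_ring"
  proof (rule const.t_MaxI[OF P])
    fix P' :: "('x, 'a) mpoly fract set" assume P': "t_proper base_ring P'" "?P \<subseteq> P'"
    have "extended X ?P \<subseteq> extended X P'" using P'(2) unfolding extended_def by blast
    then have "extended X P' = M" using t_Max_maximal[OF M t_proper_extended[OF P'(1)]] eq by simp
    then have "P' \<subseteq> ?P"
      using cst_mem_extended const.t_proper_ideal[OF P'(1)] ideal_of_subset by blast
    then show "P' = ?P" using P'(2) by blast
  qed
  then show ?thesis using extended eq by blast
qed

text \<open>
  A larger maximal \<open>t\<close>-ideal is not an upper, as it contains nonzero constants; so it has the form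
  \<open>P'[X]\<close>, and \<open>P' = P\<close> by maximality of \<open>P\<close>.
\<close>

lemma t_Max_extended_base:
  fixes P :: "('x, 'a::idom) mpoly fract set"
  assumes P: "P \<in> t_Max base_ring"
  shows "extended X P \<in> t_Max (poly_ring X)"
proof -
  interpret subdomain "poly_ring X :: ('x, 'a) mpoly fract set" by (rule subdomain_poly_ring)
  obtain M where M: "M \<in> t_Max (poly_ring X)" "extended X P \<subseteq> M"
    by (rule ex_t_Max[OF t_proper_extended[OF const.t_Max_t_proper[OF P]]])
  from M(1) show ?thesis
  proof (cases rule: t_Max_poly_ring_cases)
    case (extended P')
    have "P \<subseteq> P'"
    proof
      fix c assume c: "c \<in> P"
      then obtain a where a: "c = cst a"
        using ideal_of_subset[OF const.t_Max_ideal[OF P]] unfolding poly_ring_empty by blast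
      have "cst a \<in> extended X P'" using cst_mem_extended[OF c const.t_Max_ideal[OF P]] M(2) extended(2) a by blast
      then have "cst (lookup (single 0 a :: ('x, 'a) mpoly) 0) \<in> P'" unfolding mem_extended_iff by metis
      then show "c \<in> P'" using a by simp
    qed
    then have "P' = P" using const.t_Max_antichain P extended(1) by blast
    then show ?thesis using M extended by simp
  next
    case (upper y)
    then show ?thesis using upper_not_extended[OF _ P] M(2) by blast
  qed
qed

lemma extended_inter_base:
  fixes P :: "('x, 'a::idom) mpoly fract set"
  assumes P: "ideal_of base_ring P" and c: "c \<in> base_ring" shows "c \<in> extended X P \<longleftrightarrow> c \<in> P"
proof
  obtain a where a: "c = cst a" using c unfolding poly_ring_empty by blast
  assume "c \<in> extended X P"
  then have "cst (lookup (single 0 a :: ('x, 'a) mpoly) 0) \<in> P" unfolding a mem_extended_iff by metis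
  then show "c \<in> P" using a by simp
qed (rule cst_mem_extended[OF _ P])

lemma upper_eq_conductor_poly_ring:
  fixes M :: "('x, 'a::idom) mpoly fract set"
  assumes M: "M \<in> t_Max (poly_ring X)" and y: "y \<in> X" "upper_at X y M"
  shows "\<exists>u\<in>quotient_field (poly_ring X) - poly_ring X. M = conductor (poly_ring X) u"
  using polynomial_extension.upper_eq_conductor[OF one_variable(1)[OF y(1)], where M = M]
    M y(2) unfolding one_variable(2)[OF y(1)] upper_at_def by blast

lemma upper_height_one_poly_ring:
  fixes M :: "('x, 'a::idom) mpoly fract set"
  assumes M: "M \<in> t_Max (poly_ring X)" and y: "y \<in> X" "upper_at X y M"
    and Q: "prime_ideal_of (poly_ring X) Q" "Q \<noteq> {0}" "Q \<subseteq> M"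
  shows "Q = M"
  using polynomial_extension.upper_height_one[OF one_variable(1)[OF y(1)], where M = M and Q = Q]
    subdomain.t_Max_prime[OF subdomain_poly_ring M] Q y(2)
  unfolding one_variable(2)[OF y(1)] upper_at_def by blast

text \<open>
  Only the indeterminates of the denominator matter: an upper in another indeterminate that is
  not an upper in one of them does not contain the denominator.
\<close>

lemma clear_all_upper_denominators:
  fixes M0 :: "('x, 'a::idom) mpoly fract set"
  assumes M0: "prime_ideal_of (poly_ring X) M0"
    and avoid: "\<And>M y. M \<in> t_Max (poly_ring X) \<Longrightarrow> y \<in> X \<Longrightarrow> upper_at X y M \<Longrightarrow> \<not> M \<subseteq> M0"
    and b: "b \<in> poly_ring X" "b \<noteq> 0"
  shows "\<exists>w\<in>poly_ring X - M0. \<forall>M\<in>t_Max (poly_ring X). M \<inter> base_ring \<subseteq> {0} \<longrightarrow>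
    (\<exists>d\<in>poly_ring X - M. d * (w / b) \<in> poly_ring X)"
proof -
  let ?D = "poly_ring X :: ('x, 'a) mpoly fract set"
  interpret subdomain ?D by (rule subdomain_poly_ring)
  obtain F where F: "F \<in> polys_in X" "b = to_fract F" by (rule poly_ring_cases[OF b(1)])
  let ?Y = "X \<inter> (\<Union>m\<in>keys F. keys m)"
  have "\<exists>w\<in>?D - M0. \<forall>M\<in>t_Max ?D. upper_at X y M \<longrightarrow> (\<exists>d\<in>?D - M. d * (w / b) \<in> ?D)"
    if y: "y \<in> ?Y" for y
  proof -
    have y': "y \<in> X" using y by auto
    show ?thesis
      using polynomial_extension.clear_upper_denominators[OF one_variable(1)[OF y'], where ?M0.0 = M0 and b = b]
        M0 avoid[OF _ y'] b
      unfolding one_variable(2)[OF y'] upper_at_def by blast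
  qed
  then obtain w where w: "\<And>y. y \<in> ?Y \<Longrightarrow> w y \<in> ?D - M0 \<and>
      (\<forall>M\<in>t_Max ?D. upper_at X y M \<longrightarrow> (\<exists>d\<in>?D - M. d * (w y / b) \<in> ?D))" by metis
  let ?w = "prod w ?Y"
  have fin: "finite ?Y" by simp
  have wD: "prod w I \<in> ?D - M0" if "I \<subseteq> ?Y" for I
    using finite_subset[OF that fin] that
  proof (induction I rule: finite_induct)
    case empty
    then show ?case using M0 one_mem unfolding prime_ideal_of_def by simp
  next
    case (insert y I)
    then have "w y \<in> ?D - M0" "prod w I \<in> ?D - M0" using w by auto
    then have "w y * prod w I \<in> ?D - M0" using M0 mult_mem unfolding prime_ideal_of_def by blast
    then show ?case using insert by simp
  qed
  have "\<exists>d\<in>?D - M. d * (?w / b) \<in> ?D" if M: "M \<in> t_Max ?D" "M \<inter> base_ring \<subseteq> {0}" for M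
  proof (cases "b \<in> M")
    case True
    have "F \<noteq> 0" using F b by auto
    then obtain y where y: "y \<in> ?Y" "upper_at X y M"
      using upper_at_some_indet[OF M F(1)] True F(2) by blast
    obtain d where d: "d \<in> ?D - M" "d * (w y / b) \<in> ?D" using w[OF y(1)] y(2) M(1) by blast
    have "?w = w y * prod w (?Y - {y})" by (rule prod.remove[OF fin y(1)])
    then have "d * (?w / b) = (d * (w y / b)) * prod w (?Y - {y})" by simp
    moreover have "prod w (?Y - {y}) \<in> ?D" using wD[of "?Y - {y}"] by blast
    ultimately show ?thesis using d mult_mem by metis
  next
    case False
    have "b * (?w / b) \<in> ?D" using wD[of ?Y] b by simp
    then show ?thesis using False b by blast
  qed
  then show ?thesis using wD[of ?Y] by blast
qed

section \<open>Contents\<close>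

lemma divide_mult_mem_range_iff:
  fixes j :: "'a::idom \<Rightarrow> 'k::field"
  assumes j: "\<And>a b. j (a * b) = j a * j b" "\<And>a b. j a = j b \<longleftrightarrow> a = b" "j 0 = 0" and t: "t \<noteq> 0"
  shows "j r / j t * j c \<in> range j \<longleftrightarrow> t dvd r * c"
proof -
  have t0: "j t \<noteq> 0" using t j(2,3) by metis
  have "j r / j t * j c = j d \<longleftrightarrow> r * c = t * d" for d
  proof -
    have "j r / j t * j c = j d \<longleftrightarrow> j r * j c = j t * j d" using t0 by (simp add: field_simps)
    also have "\<dots> \<longleftrightarrow> r * c = t * d" unfolding j(1)[symmetric] j(2) ..
    finally show ?thesis .
  qed
  then show ?thesis unfolding dvd_def by (auto simp: image_iff)
qed

text \<open>
  The condition \<open>c(F)\<^sub>v = R\<close>. Stated by divisibility in \<open>R\<close>, it can be read in the quotient field of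
  \<open>R\<close> as well as in that of \<open>R[X]\<close>. If \<open>R\<close> is a field, \<open>0\<close> satisfies it, too.
\<close>

definition v_primitive :: "('x, 'a::idom) mpoly \<Rightarrow> bool" where
  "v_primitive F \<longleftrightarrow> (\<forall>r t. t \<noteq> 0 \<longrightarrow> (\<forall>m. t dvd r * lookup F m) \<longrightarrow> t dvd r)"

lemma subdomain_coeff_ring: "subdomain (coeff_ring :: 'a::idom fract set)"
  unfolding coeff_ring_def
  by unfold_locales (auto simp flip: to_fract_add to_fract_mult to_fract_uminus to_fract_0 to_fract_1)

interpretation coeff: subdomain "coeff_ring :: 'a::idom fract set"
  by (rule subdomain_coeff_ring)

lemma v_primitive_iff_multiplier:
  fixes F :: "('x, 'a::idom) mpoly" and j :: "'a \<Rightarrow> 'k::field"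
  assumes j: "\<And>a b. j (a * b) = j a * j b" "\<And>a b. j a = j b \<longleftrightarrow> a = b" "j 0 = 0" "j 1 = 1"
  shows "v_primitive F \<longleftrightarrow> (\<forall>u\<in>quotient_field (range j).
    (\<forall>m. u * j (lookup F m) \<in> range j) \<longrightarrow> u \<in> range j)"
proof -
  note iff = divide_mult_mem_range_iff[of j, OF j(1-3)]
  have one: "j r / j t \<in> range j \<longleftrightarrow> t dvd r" if "t \<noteq> 0" for r t
    using iff[OF that, of r 1] j(4) by simp
  have nz: "j t \<noteq> 0 \<longleftrightarrow> t \<noteq> 0" for t using j(2,3) by metis
  have "quotient_field (range j) = {j r / j t | r t. t \<noteq> 0}"
    unfolding quotient_field_def using nz by blast
  then have "(\<forall>u\<in>quotient_field (range j). Q u) \<longleftrightarrow> (\<forall>r t. t \<noteq> 0 \<longrightarrow> Q (j r / j t))" for Q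
    by auto
  then show ?thesis unfolding v_primitive_def by (simp add: iff one del: times_divide_eq_left)
qed

lemma v_closure_content_iff:
  fixes F :: "('x, 'a::idom) mpoly"
  shows "v_closure coeff_ring (content F) = coeff_ring \<longleftrightarrow> v_primitive F"
proof -
  let ?c = "\<lambda>m. to_fract (lookup F m)"
  have mem: "x \<in> v_closure coeff_ring (content F) \<longleftrightarrow> x \<in> quotient_field coeff_ring \<and>
      (\<forall>u\<in>quotient_field coeff_ring. (\<forall>m. u * ?c m \<in> coeff_ring) \<longrightarrow> u * x \<in> coeff_ring)" for x
    unfolding content_def coeff.mem_v_closure_generated_iff by auto
  have one_qf: "(1 :: 'a fract) \<in> quotient_field coeff_ring"
    by (rule coeff.mem_quotient_field[OF coeff.one_mem])
  have "v_primitive F \<longleftrightarrow> (\<forall>u\<in>quotient_field coeff_ring. (\<forall>m. u * ?c m \<in> coeff_ring) \<longrightarrow> u \<in> coeff_ring)"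
    unfolding coeff_ring_def by (rule v_primitive_iff_multiplier) auto
  also have "\<dots> \<longleftrightarrow> 1 \<in> v_closure coeff_ring (content F)"
    unfolding mem using one_qf by simp
  also have "\<dots> \<longleftrightarrow> v_closure coeff_ring (content F) = coeff_ring"
  proof
    assume one: "1 \<in> v_closure coeff_ring (content F)"
    have "x \<in> coeff_ring" if x: "x \<in> v_closure coeff_ring (content F)" for x
    proof -
      have "1 * x \<in> coeff_ring"
        using x one_qf unfolding mem
        by (metis coeff_ring_def mult_1 rangeI)
      then show ?thesis by simp
    qed
    moreover have "x \<in> v_closure coeff_ring (content F)" if x: "x \<in> coeff_ring" for x
      using one coeff.mem_quotient_field[OF x] coeff.mult_mem[OF _ x] unfolding mem by auto
    ultimately show "v_closure coeff_ring (content F) = coeff_ring" by blast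
  qed (use coeff.one_mem in blast)
  finally show ?thesis by blast
qed

lemma content_eq_imp_v_primitive:
  fixes F :: "('x, 'a::idom) mpoly"
  assumes "content F = coeff_ring" shows "v_primitive F"
  unfolding v_closure_content_iff[symmetric] assms
proof -
  have inverse: "inverse_ideal coeff_ring coeff_ring = (coeff_ring :: 'a fract set)"
    unfolding inverse_ideal_def using coeff.mult_mem coeff.mem_quotient_field coeff.one_mem
    by (auto dest: bspec[where x = 1])
  show "v_closure coeff_ring coeff_ring = (coeff_ring :: 'a fract set)"
    unfolding v_closure_def inverse ..
qed

text \<open>
  A multiplier of the coefficients that is not in \<open>R\<close> has a \<open>t\<close>-proper conductor, so all coefficients
  lie in some maximal \<open>t\<close>-ideal. As the ideals \<open>P[X]\<close> are prime, it follows that such polynomials form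
  a multiplicative set.
\<close>

lemma v_primitive_iff_notin_extended:
  fixes F :: "('x, 'a::idom) mpoly"
  assumes F: "F \<in> polys_in X"
  shows "v_primitive F \<longleftrightarrow> (\<forall>P\<in>t_Max base_ring. to_fract F \<notin> extended X P)"
proof -
  have iff: "v_primitive F \<longleftrightarrow> (\<forall>u\<in>quotient_field base_ring. (\<forall>m. u * cst (lookup F m)
      \<in> (base_ring :: ('x, 'a) mpoly fract set)) \<longrightarrow> u \<in> base_ring)"
    unfolding poly_ring_empty by (rule v_primitive_iff_multiplier) (rule cst_simps)+
  show ?thesis
  proof
    assume v: "v_primitive F"
    show "\<forall>P\<in>t_Max base_ring. to_fract F \<notin> extended X P"
    proof
      fix P :: "('x, 'a) mpoly fract set" assume P: "P \<in> t_Max base_ring"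
      show "to_fract F \<notin> extended X P"
      proof
        assume FP: "to_fract F \<in> extended X P"
        obtain u where u: "u \<in> quotient_field base_ring" "u \<notin> base_ring" "u * to_fract F \<in> poly_ring X"
          using t_proper_base_multiplier[OF const.t_Max_t_proper[OF P], of "{to_fract F}" X] FP by blast
        then have "\<forall>m. u * cst (lookup F m) \<in> base_ring"
          using const_times_mem_poly_ring_iff[OF u(1) F] by blast
        then show False using v u(1,2) unfolding iff by blast
      qed
    qed
  next
    assume out: "\<forall>P\<in>t_Max base_ring. to_fract F \<notin> extended X P"
    show "v_primitive F"
    proof (rule ccontr)
      assume "\<not> v_primitive F"
      then obtain u :: "('x, 'a) mpoly fract" where u: "u \<in> quotient_field base_ring" "u \<notin> base_ring"
          "\<And>m. u * cst (lookup F m) \<in> base_ring" unfolding iff by blast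
      obtain P where P: "P \<in> t_Max base_ring" "conductor base_ring u \<subseteq> P"
        by (rule const.ex_t_Max[OF const.t_proper_conductor[OF u(1,2)]])
      have "cst (lookup F m) \<in> conductor base_ring u" for m
        unfolding conductor_def using cst_mem u(3)[of m] by (simp add: mult.commute)
      then have "to_fract F \<in> extended X P" unfolding mem_extended_iff using F P(2) by blast
      then show False using out P(1) by blast
    qed
  qed
qed

lemma fraction_ring_v_primitive:
  "fraction_ring (poly_ring X) (to_fract ` {F :: ('x, 'a::idom) mpoly. F \<in> polys_in X \<and> F \<noteq> 0 \<and> v_primitive F})"
  (is "fraction_ring ?D ?S")
proof (intro fraction_ring.intro subdomain_poly_ring fraction_ring_axioms.intro)
  interpret subdomain ?D by (rule subdomain_poly_ring)
  show "?S \<subseteq> ?D" unfolding poly_ring_def by blast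
  have "v_primitive (1 :: ('x, 'a) mpoly)" unfolding v_primitive_def
    by (metis lookup_one_zero mult.right_neutral)
  then have "to_fract 1 \<in> ?S" by (intro imageI) (simp add: polys_in_def)
  then show "1 \<in> ?S" by simp
  show "0 \<notin> ?S" by auto
  fix s s' assume "s \<in> ?S" "s' \<in> ?S"
  then obtain F G :: "('x, 'a) mpoly" where F: "F \<in> polys_in X" "F \<noteq> 0" "v_primitive F" "s = to_fract F"
    and G: "G \<in> polys_in X" "G \<noteq> 0" "v_primitive G" "s' = to_fract G" by blast
  have FG: "F * G \<in> polys_in X" using F G polys_in_mult by blast
  have "to_fract (F * G) \<notin> extended X P" if P: "P \<in> t_Max base_ring" for P
  proof
    assume "to_fract (F * G) \<in> extended X P"
    moreover have "prime_ideal_of ?D (extended X P)" by (rule t_Max_prime[OF t_Max_extended_base[OF P]])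
    ultimately have "to_fract F \<in> extended X P \<or> to_fract G \<in> extended X P"
      using F(1) G(1) to_fract_mem_poly_ring unfolding prime_ideal_of_def to_fract_mult by blast
    then show False using F G P v_primitive_iff_notin_extended by blast
  qed
  then have "v_primitive (F * G)" using v_primitive_iff_notin_extended[OF FG] by blast
  then have "to_fract (F * G) \<in> ?S" using FG F(2) G(2) by (intro imageI) simp
  then show "s * s' \<in> ?S" unfolding F(4) G(4) to_fract_mult .
qed

text \<open>
  Modulo \<open>P\<close> the leading monomials of \<open>F\<close> and \<open>G\<close>, that is, the largest ones whose coefficients
  are not in \<open>P\<close>, multiply to the leading monomial of the product.
\<close>

lemma coeffs_notin_prime_mult:
  fixes F G :: "('x, 'a::idom) mpoly"
  assumes P: "prime_ideal_of coeff_ring P"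
    and F: "\<exists>m. to_fract (lookup F m) \<notin> P" and G: "\<exists>m. to_fract (lookup G m) \<notin> P"
  shows "\<exists>m. to_fract (lookup (F * G) m) \<notin> P"
proof -
  have idl: "ideal_of coeff_ring P" using P unfolding prime_ideal_of_def by blast
  have range: "to_fract a \<in> coeff_ring" for a :: 'a unfolding coeff_ring_def by blast
  have top: "\<exists>k\<in>keys H. to_fract (lookup H k) \<notin> P \<and>
      (\<forall>l. k < l \<longrightarrow> to_fract (lookup H l) \<in> P)"
    if "\<exists>m. to_fract (lookup H m) \<notin> P" for H :: "('x, 'a) mpoly"
  proof -
    let ?K = "{m. to_fract (lookup H m) \<notin> P}"
    have sub: "?K \<subseteq> keys H" using ideal_of_zero[OF idl] by (auto simp: in_keys_iff)
    have fin: "finite ?K" by (rule finite_subset[OF sub]) simp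
    have ne: "?K \<noteq> {}" using that by blast
    have "Max ?K \<in> ?K" by (rule Max_in[OF fin ne])
    moreover have "to_fract (lookup H l) \<in> P" if "Max ?K < l" for l
      using Max_ge[OF fin, of l] that by (auto simp: not_less[symmetric])
    ultimately show ?thesis using sub by blast
  qed
  obtain k where k: "k \<in> keys F" "to_fract (lookup F k) \<notin> P"
      "\<And>k'. k < k' \<Longrightarrow> to_fract (lookup F k') \<in> P" using top[OF F] by blast
  obtain l where l: "l \<in> keys G" "to_fract (lookup G l) \<notin> P"
      "\<And>l'. l < l' \<Longrightarrow> to_fract (lookup G l') \<in> P" using top[OF G] by blast
  let ?t = "\<lambda>i j. to_fract (if i + j = k + l then lookup F i * lookup G j else 0)"
  have other: "?t i j \<in> P" if "i \<noteq> k \<or> j \<noteq> l" for i j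
  proof (cases "i + j = k + l")
    case True
    have "k < i \<or> l < j"
    proof (rule ccontr)
      assume "\<not> ?thesis"
      then have le: "i \<le> k" "j \<le> l" by auto
      show False
      proof (cases "i = k")
        case False
        then have "i + j < k + l" using le by (intro add_less_le_mono) auto
        then show False using True by simp
      next
        case True
        then have "i + j < k + l" using le that by (intro add_le_less_mono) auto
        then show False using \<open>i + j = k + l\<close> by simp
      qed
    qed
    then have "to_fract (lookup F i) * to_fract (lookup G j) \<in> P"
      using k(3) l(3) ideal_of_mult[OF idl range] ideal_of_mult_right[OF idl range] by blast
    then show ?thesis using True by simp
  qed (use ideal_of_zero[OF idl] in simp)
  have "to_fract (lookup (F * G) (k + l)) =
      (\<Sum>i\<in>keys F. \<Sum>j\<in>keys G. ?t i j)"
    unfolding lookup_mult_sum to_fract_sum ..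
  also have "\<dots> = (\<Sum>j\<in>keys G. ?t k j) +
      (\<Sum>i\<in>keys F - {k}. \<Sum>j\<in>keys G. ?t i j)"
    by (rule sum.remove) (use k in auto)
  also have "(\<Sum>j\<in>keys G. ?t k j) = ?t k l + (\<Sum>j\<in>keys G - {l}. ?t k j)"
    by (rule sum.remove) (use l in auto)
  finally have eq: "to_fract (lookup (F * G) (k + l)) = ?t k l + ((\<Sum>j\<in>keys G - {l}. ?t k j) +
      (\<Sum>i\<in>keys F - {k}. \<Sum>j\<in>keys G. ?t i j))" (is "_ = _ + ?rest")
    by (simp only: add.assoc)
  have rest: "?rest \<in> P"
    by (intro ideal_of_add[OF idl] ideal_of_sum[OF idl] other) auto
  have "to_fract (lookup F k) * to_fract (lookup G l) \<notin> P"
    using P k(2) l(2) range unfolding prime_ideal_of_def by blast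
  then have kl: "?t k l \<notin> P" by simp
  have diff: "to_fract (lookup (F * G) (k + l)) - ?rest = ?t k l" unfolding eq by simp
  show ?thesis
  proof (intro exI notI)
    assume "to_fract (lookup (F * G) (k + l)) \<in> P"
    then have "to_fract (lookup (F * G) (k + l)) - ?rest \<in> P"
      by (rule coeff.ideal_of_diff[OF idl _ rest])
    then show False using kl unfolding diff by (rule notE[rotated])
  qed
qed

lemma content_mult_eq_coeff_ring:
  fixes F G :: "('x, 'a::idom) mpoly"
  assumes F: "content F = coeff_ring" and G: "content G = coeff_ring"
  shows "content (F * G) = coeff_ring"
proof -
  have sub: "range (\<lambda>m. to_fract (lookup H m)) \<subseteq> coeff_ring" for H :: "('x, 'a) mpoly"
    unfolding coeff_ring_def by blast
  have le: "content H \<subseteq> coeff_ring" for H :: "('x, 'a) mpoly"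
    unfolding content_def by (rule coeff.generated_ideal_least[OF coeff.ideal_of_whole sub])
  have idl: "ideal_of coeff_ring (content H)" for H :: "('x, 'a) mpoly"
    using le[of H] coeff.zero_mem_generated_ideal coeff.generated_ideal_add coeff.generated_ideal_mult
    unfolding ideal_of_def content_def by blast
  have mem: "to_fract (lookup H m) \<in> content H" for H :: "('x, 'a) mpoly" and m
    unfolding content_def by (rule coeff.mem_generated_ideal) blast
  have "1 \<in> content (F * G)"
  proof (rule ccontr)
    assume no: "1 \<notin> content (F * G)"
    obtain P where P: "prime_ideal_of coeff_ring P" "content (F * G) \<subseteq> P"
      by (rule coeff.ex_prime_ideal[OF idl no])
    then have Pidl: "ideal_of coeff_ring P" "1 \<notin> P" unfolding prime_ideal_of_def by blast+
    have "\<exists>m. to_fract (lookup H m) \<notin> P" if "content H = coeff_ring" for H :: "('x, 'a) mpoly"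
    proof (rule ccontr)
      assume "\<not> ?thesis"
      then have "content H \<subseteq> P" unfolding content_def
        by (intro coeff.generated_ideal_least[OF Pidl(1)]) blast
      then show False using that Pidl(2) coeff.one_mem by blast
    qed
    then have "\<exists>m. to_fract (lookup (F * G) m) \<notin> P"
      using coeffs_notin_prime_mult[OF P(1)] F G by blast
    then show False using mem P(2) by blast
  qed
  then have "coeff_ring \<subseteq> content (F * G)"
    using ideal_of_mult[OF idl, of _ 1] by (metis mult.right_neutral subsetI)
  then show ?thesis using le by blast
qed

lemma fraction_ring_content:
  "fraction_ring (poly_ring X) (to_fract ` {F :: ('x, 'a::idom) mpoly. F \<in> polys_in X \<and> content F = coeff_ring})"
  (is "fraction_ring ?D ?S")
proof (intro fraction_ring.intro subdomain_poly_ring fraction_ring_axioms.intro)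
  show "?S \<subseteq> ?D" unfolding poly_ring_def by blast
  have "content (1 :: ('x, 'a) mpoly) = coeff_ring"
  proof
    show "content (1 :: ('x, 'a) mpoly) \<subseteq> coeff_ring" unfolding content_def
      by (rule coeff.generated_ideal_least[OF coeff.ideal_of_whole]) (auto simp: coeff_ring_def)
    have "to_fract (lookup (1 :: ('x, 'a) mpoly) 0) \<in> content (1 :: ('x, 'a) mpoly)"
      unfolding content_def by (rule coeff.mem_generated_ideal) (rule rangeI)
    then have "1 \<in> content (1 :: ('x, 'a) mpoly)" by simp
    then have "r * 1 \<in> content (1 :: ('x, 'a) mpoly)" if "r \<in> coeff_ring" for r
      using coeff.generated_ideal_mult that unfolding content_def by blast
    then show "coeff_ring \<subseteq> content (1 :: ('x, 'a) mpoly)" by auto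
  qed
  then have "to_fract 1 \<in> ?S" by (intro imageI) (simp add: polys_in_def)
  then show "1 \<in> ?S" by simp
  show "0 \<notin> ?S"
  proof
    assume "0 \<in> ?S"
    then obtain F :: "('x, 'a) mpoly" where "content F = coeff_ring" "0 = to_fract F" by blast
    then have "content (0 :: ('x, 'a) mpoly) = coeff_ring" by (metis to_fract_eq_0_iff)
    moreover have "content (0 :: ('x, 'a) mpoly) \<subseteq> {0}" unfolding content_def
      by (rule coeff.generated_ideal_least) (auto simp: ideal_of_def coeff.zero_mem)
    ultimately have "(1 :: 'a fract) \<in> {0}" using coeff.one_mem by blast
    then show False by simp
  qed
  fix s s' assume "s \<in> ?S" "s' \<in> ?S"
  then obtain F G :: "('x, 'a) mpoly" where "F \<in> polys_in X" "content F = coeff_ring" "s = to_fract F"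
    "G \<in> polys_in X" "content G = coeff_ring" "s' = to_fract G" by blast
  moreover from this have "to_fract (F * G) \<in> ?S" by (intro imageI) (simp add: content_mult_eq_coeff_ring polys_in_mult)
  ultimately show "s * s' \<in> ?S" by (simp only: to_fract_mult)
qed

section \<open>The \<open>t#\<close>-property of polynomial rings and their rings of fractions\<close>

text \<open>
  The hypotheses of \<open>t_sharp_fractions_iff\<close> hold for different reasons for the two kinds of maximal
  \<open>t\<close>-ideals. Extended ideals do not meet \<open>S\<close>, and their multipliers can be chosen constant; by
  primitivity, \<open>R[X]\<^sub>S\<close> contains no elements of the quotient field of \<open>R\<close> outside of \<open>R\<close>. Uppers are
  conductors, and a nonzero prime ideal below an upper is the upper itself. So only the uppers that meet
  \<open>S\<close> are lost, and isolation of \<open>P[X]\<close> is restored at these by clearing denominators.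
\<close>

lemma t_sharp_fractions_poly_ring_iff:
  fixes X :: "'x indet set" and S :: "('x, 'a::idom) mpoly fract set"
  assumes S: "fraction_ring (poly_ring X) S" "S \<subseteq> to_fract ` {F \<in> polys_in X. v_primitive F}"
  shows "t_sharp_domain (poly_ring X :: ('x, 'a) mpoly fract set) \<longleftrightarrow>
    t_sharp_domain (ring_of_fractions (poly_ring X) S)"
proof -
  let ?D = "poly_ring X :: ('x, 'a) mpoly fract set"
  interpret fraction_ring ?D S by (rule S(1))
  have prim: "to_fract F \<in> S \<Longrightarrow> F \<in> polys_in X \<and> v_primitive F" for F using S(2) by auto
  have S_cases: "\<exists>F. F \<in> polys_in X \<and> v_primitive F \<and> s = to_fract F" if "s \<in> S" for s
    using that S(2) by blast
  have disj: "extended X P \<inter> S = {}" if P: "P \<in> t_Max base_ring" for P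
    using S_cases v_primitive_iff_notin_extended P by blast
  have K: "u \<in> DS \<longleftrightarrow> u \<in> base_ring" if u: "u \<in> quotient_field base_ring" for u
  proof
    assume "u \<in> DS"
    then obtain F where F: "F \<in> polys_in X" "v_primitive F" "to_fract F * u \<in> ?D"
      unfolding mem_fractions_iff using S_cases by blast
    then have coeffs: "\<forall>m. u * cst (lookup F m) \<in> base_ring"
      using const_times_mem_poly_ring_iff[OF u] by (metis mult.commute)
    obtain r t where rt: "t \<noteq> 0" "u = cst r / cst t" by (rule quotient_field_base_ring_cases[OF u])
    have iff: "cst r / cst t * cst c \<in> (base_ring :: ('x, 'a) mpoly fract set) \<longleftrightarrow> t dvd r * c" for c
      unfolding poly_ring_empty by (rule divide_mult_mem_range_iff[OF _ _ _ rt(1)]) (rule cst_simps)+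
    have "t dvd r" using F(2) coeffs rt(1) unfolding v_primitive_def rt(2) iff by blast
    then show "u \<in> base_ring" using iff[of 1] unfolding rt(2) cst_simps(4) by simp
  qed (use base_ring_subset base_mem_fractions in blast)
  have extend: "t_proper DS (ring_of_fractions M S)" if M: "M \<in> t_Max ?D" "M \<inter> S = {}" for M
    unfolding t_proper_def
  proof (intro conjI allI impI)
    note tp = base.t_Max_t_proper[OF M(1)]
    note idl = base.t_proper_ideal[OF tp]
    show "ideal_of DS (ring_of_fractions M S)" by (rule ideal_of_fractions[OF idl])
    obtain x where "x \<in> M" "x \<noteq> 0" using base.t_proper_nonzero[OF tp] .
    then show "ring_of_fractions M S \<noteq> {0}" using base_mem_fractions by blast
    fix A assume "finite A \<and> A \<subseteq> ring_of_fractions M S"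
    then obtain s where s: "s \<in> S" "\<forall>a\<in>A. s * a \<in> M" and A: "finite A"
      using common_denominator_fractions[OF idl] by blast
    from M(1) show "\<exists>u\<in>quotient_field DS - DS. \<forall>a\<in>A. u * a \<in> DS"
    proof (cases rule: t_Max_poly_ring_cases)
      case (extended P)
      have "finite ((*) s ` A)" "(*) s ` A \<subseteq> extended X P" using A s(2) extended(2) by auto
      then obtain u where u: "u \<in> quotient_field base_ring" "u \<notin> base_ring"
          "\<forall>b\<in>(*) s ` A. u * b \<in> ?D"
        using t_proper_base_multiplier[OF const.t_Max_t_proper[OF extended(1)], of "(*) s ` A" X] by blast
      have "u * a \<in> DS" if a: "a \<in> A" for a
      proof -
        have "u * (s * a) \<in> ?D" using u(3) a by blast
        then have "s * (u * a) \<in> ?D" by (simp only: mult.left_commute)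
        then show ?thesis unfolding mem_fractions_iff using s(1) by blast
      qed
      moreover have "u \<in> quotient_field DS" "u \<notin> DS"
        using u(1,2) K quotient_field_base_ring_subset quotient_field_fractions by blast+
      ultimately show ?thesis by blast
    next
      case (upper y)
      obtain u where u: "u \<in> quotient_field ?D" "u \<notin> ?D" "M = conductor ?D u"
        using upper_eq_conductor_poly_ring[OF M(1) upper] by blast
      have "u * a \<in> DS" if a: "a \<in> A" for a
      proof -
        have "s * a * u \<in> ?D" using s(2) a u(3) unfolding conductor_def by blast
        then have "s * (u * a) \<in> ?D" by (simp add: ac_simps)
        then show ?thesis unfolding mem_fractions_iff using s(1) by blast
      qed
      moreover have "u \<notin> DS"
      proof
        assume "u \<in> DS"
        then obtain s where "s \<in> S" "s * u \<in> ?D" unfolding mem_fractions_iff by blast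
        then have "s \<in> M" unfolding u(3) conductor_def using S_mem by blast
        then show False using M(2) \<open>s \<in> S\<close> by blast
      qed
      ultimately show ?thesis using u(1) quotient_field_fractions by blast
    qed
  qed
  have contract: "\<exists>M\<in>t_Max ?D. Q \<subseteq> M \<and> M \<inter> S = {}"
    if Q: "prime_ideal_of ?D Q" "t_proper ?D Q" "Q \<inter> S = {}" for Q
  proof -
    obtain M where M: "M \<in> t_Max ?D" "Q \<subseteq> M" by (rule base.ex_t_Max[OF Q(2)])
    from M(1) show ?thesis
    proof (cases rule: t_Max_poly_ring_cases)
      case (extended P)
      then show ?thesis using disj M by blast
    next
      case (upper y)
      have "Q \<noteq> {0}" using Q(2) unfolding t_proper_def by blast
      then have "Q = M" using upper_height_one_poly_ring[OF M(1) upper Q(1)] M(2) by blast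
      then show ?thesis using M Q(3) by blast
    qed
  qed
  have DS_iff: "t_sharp_domain DS \<longleftrightarrow> (\<forall>M\<in>{M \<in> t_Max ?D. M \<inter> S = {}}. \<exists>u\<in>quotient_field ?D.
     isolates ?D {N \<in> t_Max ?D. N \<inter> S = {}} u M)"
    by (rule t_sharp_fractions_iff[OF extend contract])
  have backward: "t_sharp_domain ?D"
    if sharp: "\<forall>M\<in>{M \<in> t_Max ?D. M \<inter> S = {}}. \<exists>u\<in>quotient_field ?D.
     isolates ?D {N \<in> t_Max ?D. N \<inter> S = {}} u M"
    unfolding base.t_sharp_domain_iff
  proof
    fix M assume M: "M \<in> t_Max ?D"
    from M show "\<exists>u\<in>quotient_field ?D. isolates ?D (t_Max ?D) u M"
    proof (cases rule: t_Max_poly_ring_cases)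
      case (upper y)
      obtain u where "u \<in> quotient_field ?D" "M = conductor ?D u"
        using upper_eq_conductor_poly_ring[OF M upper] by blast
      then show ?thesis using base.t_Max_antichain[OF M] by blast
    next
      case (extended P)
      have "M \<in> {M \<in> t_Max ?D. M \<inter> S = {}}" using M extended disj by blast
      from bspec[OF sharp this] obtain u where u: "u \<in> quotient_field ?D" "conductor ?D u \<subseteq> M"
        and iso': "\<forall>N\<in>{N \<in> t_Max ?D. N \<inter> S = {}}. conductor ?D u \<subseteq> N \<longrightarrow> N = M" by (elim bexE conjE)
      have iso: "N = M" if "N \<in> t_Max ?D" "N \<inter> S = {}" "conductor ?D u \<subseteq> N" for N
        using iso' that by simp
      obtain a b where ab: "a \<in> ?D" "b \<in> ?D" "b \<noteq> 0" "u = a / b"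
        using u(1) by (rule base.quotient_field_cases)
      have prime: "prime_ideal_of ?D M" by (rule base.t_Max_prime[OF M])
      have avoid: "\<not> N \<subseteq> M" if N: "N \<in> t_Max ?D" "y \<in> X" "upper_at X y N" for N y
        using base.t_Max_antichain[OF N(1) M] upper_not_extended[OF N(3) extended(1)] extended(2) by blast
      have "\<exists>w\<in>?D - M. \<forall>N\<in>t_Max ?D. N \<inter> base_ring \<subseteq> {0} \<longrightarrow> (\<exists>d\<in>?D - N. d * (w / b) \<in> ?D)"
        by (rule clear_all_upper_denominators[OF prime _ ab(2,3)]) (rule avoid)
      then obtain w where "w \<in> ?D - M"
        and clear: "\<forall>N\<in>t_Max ?D. N \<inter> base_ring \<subseteq> {0} \<longrightarrow> (\<exists>d\<in>?D - N. d * (w / b) \<in> ?D)"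
        by (rule bexE)
      then have w: "w \<in> ?D" "w \<notin> M" by simp_all
      \<comment> \<open>\<open>w\<close> is a unit at \<open>M\<close>, so multiplication by \<open>w\<close> preserves what \<open>u\<close> does there\<close>
      have "conductor ?D (w * u) \<subseteq> M"
      proof
        fix d assume d: "d \<in> conductor ?D (w * u)"
        then have "d * w \<in> conductor ?D u" unfolding conductor_def
          using base.mult_mem w(1) by (auto simp: mult.assoc)
        then have "d * w \<in> M" using u(2) by blast
        then show "d \<in> M" using prime w d unfolding prime_ideal_of_def conductor_def by blast
      qed
      moreover have "N = M" if N: "N \<in> t_Max ?D" "conductor ?D (w * u) \<subseteq> N" for N
      proof (cases "N \<inter> S = {}")
        case True
        have "conductor ?D u \<subseteq> conductor ?D (w * u)"
        proof
          fix d assume "d \<in> conductor ?D u"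
          then have "d \<in> ?D" "w * (d * u) \<in> ?D" unfolding conductor_def using base.mult_mem w(1) by blast+
          then show "d \<in> conductor ?D (w * u)" unfolding conductor_def by (simp add: mult.left_commute)
        qed
        then show ?thesis using iso[OF N(1) True] N(2) by blast
      next
        case False
        from N(1) show ?thesis
        proof (cases rule: t_Max_poly_ring_cases)
          case (extended P')
          then show ?thesis using disj False by blast
        next
          case (upper y)
          obtain d where d: "d \<in> ?D" "d \<notin> N" "d * (w / b) \<in> ?D"
            using clear N(1) upper_at_base[OF upper(2)] by blast
          have "d * (w * u) = a * (d * (w / b))" unfolding ab(4) by simp
          then have "d \<in> conductor ?D (w * u)" unfolding conductor_def
            using d ab(1) base.mult_mem by (metis (no_types, lifting) mem_Collect_eq)
          then show ?thesis using N(2) d(2) by blast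
        qed
      qed
      moreover have "w * u \<in> quotient_field ?D"
        using base.quotient_field_mult[OF base.mem_quotient_field[OF w(1)] u(1)] .
      ultimately show ?thesis by blast
    qed
  qed
  have forward: "t_sharp_domain DS" if sharp: "t_sharp_domain ?D"
    unfolding DS_iff
  proof
    fix M assume "M \<in> {M \<in> t_Max ?D. M \<inter> S = {}}"
    then have "M \<in> t_Max ?D" by simp
    from bspec[OF sharp[unfolded base.t_sharp_domain_iff] this]
    obtain u where u: "u \<in> quotient_field ?D" "conductor ?D u \<subseteq> M"
      "\<forall>N\<in>t_Max ?D. conductor ?D u \<subseteq> N \<longrightarrow> N = M" by (elim bexE conjE)
    then show "\<exists>u\<in>quotient_field ?D. isolates ?D {N \<in> t_Max ?D. N \<inter> S = {}} u M"
      by (intro bexI[of _ u]) simp_all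
  qed
  show ?thesis
  proof
    assume "t_sharp_domain ?D"
    then show "t_sharp_domain DS" by (rule forward)
  next
    assume "t_sharp_domain DS"
    then show "t_sharp_domain ?D" by (rule backward[OF iffD1[OF DS_iff]])
  qed
qed

text \<open>
  The conductor in \<open>R[X]\<close> of a constant \<open>u\<close> is extended from the conductor in \<open>R\<close>. It contains
  nonzero constants, so it is not contained in an upper.
\<close>

lemma t_sharp_poly_ring_if_base:
  fixes X :: "'x indet set"
  assumes sharp: "t_sharp_domain (base_ring :: ('x, 'a::idom) mpoly fract set)"
  shows "t_sharp_domain (poly_ring X :: ('x, 'a) mpoly fract set)"
proof -
  let ?D = "poly_ring X :: ('x, 'a) mpoly fract set" and ?R = "base_ring :: ('x, 'a) mpoly fract set"
  interpret subdomain ?D by (rule subdomain_poly_ring)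
  show ?thesis unfolding t_sharp_domain_iff
  proof
    fix M assume M: "M \<in> t_Max ?D"
    from M show "\<exists>u\<in>quotient_field ?D. isolates ?D (t_Max ?D) u M"
    proof (cases rule: t_Max_poly_ring_cases)
      case (upper y)
      obtain u where "u \<in> quotient_field ?D" "M = conductor ?D u"
        using upper_eq_conductor_poly_ring[OF M upper] by blast
      then show ?thesis using t_Max_antichain[OF M] by blast
    next
      case (extended P)
      from bspec[OF sharp[unfolded const.t_sharp_domain_iff] extended(1)]
      obtain u where u: "u \<in> quotient_field ?R" "conductor ?R u \<subseteq> P"
        and iso: "\<forall>Q\<in>t_Max ?R. conductor ?R u \<subseteq> Q \<longrightarrow> Q = P" by (elim bexE conjE)
      have sub: "conductor ?R u \<subseteq> conductor ?D u"
        unfolding conductor_def using base_ring_subset by blast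
      have "conductor ?D u \<subseteq> M"
      proof
        fix d assume d: "d \<in> conductor ?D u"
        then obtain F where F: "F \<in> polys_in X" "d = to_fract F"
          unfolding conductor_def by (blast elim: poly_ring_cases)
        have "u * to_fract F \<in> ?D" using d F(2) unfolding conductor_def by (simp add: mult.commute)
        then have "u * cst (lookup F m) \<in> ?R" for m
          using const_times_mem_poly_ring_iff[OF u(1) F(1)] by blast
        then have "cst (lookup F m) \<in> conductor ?R u" for m
          unfolding conductor_def using cst_mem by (simp add: mult.commute)
        then show "d \<in> M" unfolding extended(2) F(2) mem_extended_iff using F(1) u(2) by blast
      qed
      moreover have "N = M" if N: "N \<in> t_Max ?D" "conductor ?D u \<subseteq> N" for N
        using N(1)
      proof (cases rule: t_Max_poly_ring_cases)
        case (extended Q)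
        have "c \<in> Q" if c: "c \<in> conductor ?R u" for c
        proof -
          have "c \<in> extended X Q" using c sub N(2) extended(2) by blast
          moreover have "c \<in> ?R" using c unfolding conductor_def by blast
          ultimately show ?thesis using extended_inter_base[OF const.t_Max_ideal[OF extended(1)]] by blast
        qed
        then have "Q = P" using iso extended(1) by blast
        then show ?thesis using extended(2) \<open>M = extended X P\<close> by simp
      next
        case (upper y)
        obtain a b where "a \<in> ?R" "b \<in> ?R" "b \<noteq> 0" "u = a / b"
          using u(1) by (rule const.quotient_field_cases)
        then have "b \<in> conductor ?R u" unfolding conductor_def by simp
        then have "b \<in> N \<inter> ?R" using sub N(2) \<open>b \<in> ?R\<close> by blast
        then show ?thesis using upper_at_base[OF upper(2)] \<open>b \<noteq> 0\<close> by blast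
      qed
      ultimately show ?thesis using u(1) quotient_field_base_ring_subset by blast
    qed
  qed
qed

text \<open>
  Let \<open>u = a / b\<close> isolate the extended ideal \<open>P[X]\<close>. The conductor of \<open>u\<close> is \<open>b\<close> times the inverse
  of \<open>(a, b)\<close>, so by \<open>v\<close>-coherence it is the \<open>v\<close>-closure of a finite set \<open>H\<close>. The coefficients of
  \<open>H\<close> are finitely many elements of \<open>P\<close>, and any element of the quotient field of \<open>R\<close> outside of
  \<open>R\<close> that maps them into \<open>R\<close> isolates \<open>P\<close>.
\<close>

lemma t_sharp_base_if_poly_ring:
  fixes X :: "'x indet set"
  assumes sharp: "t_sharp_domain (poly_ring X :: ('x, 'a::idom) mpoly fract set)"
    and coherent: "v_coherent (poly_ring X :: ('x, 'a) mpoly fract set)"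
  shows "t_sharp_domain (base_ring :: ('x, 'a) mpoly fract set)"
  unfolding const.t_sharp_domain_iff
proof
  let ?D = "poly_ring X :: ('x, 'a) mpoly fract set" and ?R = "base_ring :: ('x, 'a) mpoly fract set"
  interpret subdomain ?D by (rule subdomain_poly_ring)
  fix P assume P: "P \<in> t_Max ?R"
  note Pidl = const.t_Max_ideal[OF P]
  let ?M = "extended X P"
  have M: "?M \<in> t_Max ?D" by (rule t_Max_extended_base[OF P])
  from bspec[OF sharp[unfolded t_sharp_domain_iff] M]
  obtain u where u: "u \<in> quotient_field ?D" "conductor ?D u \<subseteq> ?M"
    and iso: "\<forall>N\<in>t_Max ?D. conductor ?D u \<subseteq> N \<longrightarrow> N = ?M" by (elim bexE conjE)
  obtain a b where ab: "a \<in> ?D" "b \<in> ?D" "b \<noteq> 0" "u = a / b"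
    using u(1) by (rule quotient_field_cases)
  let ?I = "generated_ideal ?D {a, b}"
  \<comment> \<open>the conductor of \<open>u\<close> is \<open>b\<close> times the inverse of \<open>?I\<close>\<close>
  have "fg_fractional_ideal ?D ?I" using ab mem_quotient_field by (intro fg_generated_ideal) auto
  moreover have "?I \<subseteq> ?D" by (rule generated_ideal_least[OF ideal_of_whole]) (use ab in auto)
  moreover have "?I \<noteq> {0}" using mem_generated_ideal[of b "{a, b}"] ab(3) by auto
  ultimately obtain J where J: "fg_fractional_ideal ?D J" "inverse_ideal ?D ?I = v_closure ?D J"
    using coherent unfolding v_coherent_def by blast
  obtain A where A: "finite A" "A \<subseteq> quotient_field ?D" "J = generated_ideal ?D A"
    using J(1) by (rule fg_fractional_idealE)
  have inv: "x \<in> v_closure ?D (generated_ideal ?D A) \<longleftrightarrow> x \<in> quotient_field ?D \<and> x * a \<in> ?D \<and> x * b \<in> ?D" for x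
    using J(2) unfolding A(3) inverse_generated_ideal by auto
  define H where "H = (\<lambda>x. b * x) ` A"
  have H: "H \<subseteq> conductor ?D u"
  proof
    fix h assume "h \<in> H"
    then obtain x where x: "x \<in> A" "h = b * x" unfolding H_def by blast
    have "x \<in> v_closure ?D (generated_ideal ?D A)"
      unfolding mem_v_closure_generated_iff using x A(2) by blast
    then have "x * a \<in> ?D" "x * b \<in> ?D" unfolding inv by blast+
    moreover have "h * u = x * a" unfolding ab(4) x(2) using ab(3) by simp
    moreover have "h = x * b" unfolding x(2) by (rule mult.commute)
    ultimately have "h \<in> ?D" "h * u \<in> ?D" by (simp_all only:)
    then show "h \<in> conductor ?D u" unfolding conductor_def by simp
  qed
  have dominated: "w * d \<in> ?D"
    if d: "d \<in> conductor ?D u" and w: "w \<in> quotient_field ?D" "\<forall>h\<in>H. w * h \<in> ?D" for d w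
  proof -
    have "d / b \<in> v_closure ?D (generated_ideal ?D A)"
      unfolding inv using d ab divide_mem_quotient_field[of d b] unfolding conductor_def by simp
    moreover have "w * b \<in> quotient_field ?D" using w(1) ab(2) quotient_field_mult mem_quotient_field by blast
    moreover have "\<forall>x\<in>A. w * b * x \<in> ?D" using w(2) unfolding H_def by (simp add: mult.assoc)
    ultimately have "w * b * (d / b) \<in> ?D" unfolding mem_v_closure_generated_iff by blast
    then show ?thesis using ab(3) by simp
  qed
  have fin: "finite H" unfolding H_def using A(1) by blast
  obtain v where v: "v \<in> quotient_field ?R" "v \<notin> ?R" "\<forall>h\<in>H. v * h \<in> ?D"
    using t_proper_base_multiplier[OF const.t_Max_t_proper[OF P] fin, of X] H u(2) by blast
  have isov: "Q = P" if Q: "Q \<in> t_Max ?R" "conductor ?R v \<subseteq> Q" for Q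
  proof -
    note Qidl = const.t_Max_ideal[OF Q(1)]
    have HQ: "H \<subseteq> extended X Q"
    proof
      fix h assume h: "h \<in> H"
      then obtain F where F: "F \<in> polys_in X" "h = to_fract F"
        using H unfolding conductor_def by (blast elim: poly_ring_cases)
      have "v * cst (lookup F m) \<in> ?R" for m
        using const_times_mem_poly_ring_iff[OF v(1) F(1)] v(3) h F(2) by blast
      then have "cst (lookup F m) \<in> conductor ?R v" for m
        unfolding conductor_def using cst_mem by (simp add: mult.commute)
      then show "h \<in> extended X Q" unfolding F(2) mem_extended_iff using F(1) Q(2) by blast
    qed
    have "d \<in> extended X Q" if d: "d \<in> conductor ?D u" for d
      using t_Max_closed[OF t_Max_extended_base[OF Q(1)] fin HQ, of d] dominated[OF d] d
      unfolding conductor_def by blast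
    then have "extended X Q = ?M" using iso t_Max_extended_base[OF Q(1)] by blast
    then have "Q \<subseteq> P"
      using extended_inter_base[OF Pidl] extended_inter_base[OF Qidl] ideal_of_subset[OF Qidl] by blast
    then show "Q = P" using const.t_Max_antichain[OF Q(1) P] by blast
  qed
  obtain Q where Q: "Q \<in> t_Max ?R" "conductor ?R v \<subseteq> Q"
    by (rule const.ex_t_Max[OF const.t_proper_conductor[OF v(1,2)]])
  then have "conductor ?R v \<subseteq> P" using isov by blast
  then show "\<exists>u\<in>quotient_field ?R. isolates ?R (t_Max ?R) u P"
    using v(1) isov by blast
qed

section \<open>Passing to the quotient field of the coefficient ring\<close>

locale field_embedding =
  fixes \<phi> :: "'k::field \<Rightarrow> 'l::field"
  assumes \<phi>_one: "\<phi> 1 = 1" and \<phi>_add: "\<phi> (x + y) = \<phi> x + \<phi> y" and \<phi>_mult: "\<phi> (x * y) = \<phi> x * \<phi> y"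
begin

lemma \<phi>_zero: "\<phi> 0 = 0"
proof -
  have "\<phi> 0 + \<phi> 0 = \<phi> 0 + 0" by (simp flip: \<phi>_add)
  then show ?thesis by (simp only: add_left_cancel)
qed

lemma \<phi>_uminus: "\<phi> (- x) = - \<phi> x"
  using \<phi>_add[of x "- x"] \<phi>_zero by (simp add: eq_neg_iff_add_eq_0 add.commute)

lemma \<phi>_eq_0: "\<phi> x = 0 \<longleftrightarrow> x = 0"
proof
  assume "\<phi> x = 0"
  then have "\<phi> (x * inverse x) = 0" unfolding \<phi>_mult by simp
  then show "x = 0" using \<phi>_one by (metis right_inverse zero_neq_one)
qed (simp add: \<phi>_zero)

lemma inj: "inj \<phi>"
proof (rule injI)
  fix x y assume "\<phi> x = \<phi> y"
  then have "\<phi> (x + - y) = 0" unfolding \<phi>_add \<phi>_uminus by simp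
  then show "x = y" unfolding \<phi>_eq_0 by simp
qed

lemma \<phi>_divide: "\<phi> (x / y) = \<phi> x / \<phi> y"
proof (cases "y = 0")
  case False
  then have "\<phi> (x / y) * \<phi> y = \<phi> x" by (simp flip: \<phi>_mult)
  then show ?thesis using False \<phi>_eq_0 by (metis nonzero_mult_div_cancel_right)
qed (simp add: \<phi>_zero)

lemma mem_image: "\<phi> x \<in> \<phi> ` I \<longleftrightarrow> x \<in> I"
  by (rule inj_image_mem_iff[OF inj])

lemma quotient_field_image: "quotient_field (\<phi> ` D) = \<phi> ` quotient_field D"
proof -
  have "\<phi> ` quotient_field D = {\<phi> a / \<phi> b | a b. a \<in> D \<and> b \<in> D \<and> b \<noteq> 0}"
  proof (rule set_eqI, rule iffI)
    fix x assume "x \<in> \<phi> ` quotient_field D"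
    then obtain a b where "a \<in> D" "b \<in> D" "b \<noteq> 0" "x = \<phi> (a / b)" unfolding quotient_field_def by blast
    then show "x \<in> {\<phi> a / \<phi> b | a b. a \<in> D \<and> b \<in> D \<and> b \<noteq> 0}" unfolding \<phi>_divide by blast
  next
    fix x assume "x \<in> {\<phi> a / \<phi> b | a b. a \<in> D \<and> b \<in> D \<and> b \<noteq> 0}"
    then obtain a b where "a \<in> D" "b \<in> D" "b \<noteq> 0" "x = \<phi> (a / b)" unfolding \<phi>_divide by blast
    then show "x \<in> \<phi> ` quotient_field D" unfolding quotient_field_def by blast
  qed
  also have "\<dots> = quotient_field (\<phi> ` D)"
    unfolding quotient_field_def using \<phi>_eq_0 by blast
  finally show ?thesis ..
qed

lemma conductor_image: "conductor (\<phi> ` D) (\<phi> u) = \<phi> ` conductor D u"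
  unfolding conductor_def by (auto simp: mem_image inj_eq[OF inj] simp flip: \<phi>_mult)

lemma subdomain_image:
  assumes "subdomain D" shows "subdomain (\<phi> ` D)"
proof -
  interpret subdomain D by (rule assms)
  show ?thesis
    using zero_mem one_mem add_mem mult_mem uminus_mem
    by unfold_locales (auto simp flip: \<phi>_add \<phi>_mult \<phi>_uminus intro: rev_image_eqI simp: \<phi>_one \<phi>_zero)
qed

lemma ideal_of_image: "ideal_of (\<phi> ` D) (\<phi> ` I) \<longleftrightarrow> ideal_of D I"
  unfolding ideal_of_def inj_image_subset_iff[OF inj]
  using mem_image by (auto simp flip: \<phi>_add \<phi>_mult) (metis \<phi>_zero mem_image)+

lemma t_proper_image: "t_proper (\<phi> ` D) (\<phi> ` I) \<longleftrightarrow> t_proper D I"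
proof -
  have "\<phi> ` I \<noteq> {0} \<longleftrightarrow> I \<noteq> {0}"
    using inj_image_eq_iff[OF inj, of I "{0}"] \<phi>_zero by simp
  moreover have "(\<exists>u\<in>quotient_field (\<phi> ` D) - \<phi> ` D. \<forall>a\<in>\<phi> ` A. u * a \<in> \<phi> ` D) \<longleftrightarrow>
      (\<exists>u\<in>quotient_field D - D. \<forall>a\<in>A. u * a \<in> D)" for A
    unfolding quotient_field_image image_set_diff[OF inj, symmetric]
    by (simp add: mem_image flip: \<phi>_mult)
  moreover have "(\<forall>A. finite A \<and> A \<subseteq> \<phi> ` I \<longrightarrow> Q A) \<longleftrightarrow> (\<forall>A. finite A \<and> A \<subseteq> I \<longrightarrow> Q (\<phi> ` A))" for Q
    by (metis finite_imageI finite_subset_image image_mono)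
  ultimately show ?thesis unfolding t_proper_def ideal_of_image by simp
qed

lemma t_Max_image:
  assumes "subdomain D" shows "t_Max (\<phi> ` D) = (`) \<phi> ` t_Max D"
proof -
  interpret subdomain D by (rule assms)
  interpret im: subdomain "\<phi> ` D" by (rule subdomain_image[OF assms])
  have image: "\<exists>I. N = \<phi> ` I" if "t_proper (\<phi> ` D) N" for N
    using ideal_of_subset[OF im.t_proper_ideal[OF that]] by (metis subsetI subset_image_iff)
  have "\<phi> ` M \<in> t_Max (\<phi> ` D) \<longleftrightarrow> M \<in> t_Max D" for M
  proof -
    have "(\<forall>N. t_proper (\<phi> ` D) N \<and> \<phi> ` M \<subseteq> N \<longrightarrow> N = \<phi> ` M) \<longleftrightarrow>
        (\<forall>N. t_proper (\<phi> ` D) (\<phi> ` N) \<and> \<phi> ` M \<subseteq> \<phi> ` N \<longrightarrow> \<phi> ` N = \<phi> ` M)"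
      using image by metis
    then show ?thesis
      unfolding t_Max_iff im.t_Max_iff max_t_proper_def im.max_t_proper_def t_proper_image
        inj_image_subset_iff[OF inj] inj_image_eq_iff[OF inj] by simp
  qed
  then show ?thesis using image im.t_Max_t_proper by blast
qed

lemma t_sharp_domain_image:
  assumes "subdomain D" shows "t_sharp_domain (\<phi> ` D) \<longleftrightarrow> t_sharp_domain D"
  unfolding subdomain.t_sharp_domain_iff[OF assms] subdomain.t_sharp_domain_iff[OF subdomain_image[OF assms]]
    t_Max_image[OF assms] quotient_field_image
  by (simp add: conductor_image inj_image_subset_iff[OF inj] inj_image_eq_iff[OF inj])

end

text \<open>
  The embedding of the quotient field of \<open>R\<close> into that of \<open>R[X]\<close>, defined by an arbitrary choice of
  numerator and denominator.
\<close>

definition fract_cst :: "'a::idom fract \<Rightarrow> ('x, 'a) mpoly fract" where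
  "fract_cst x = (let p = SOME p. snd p \<noteq> 0 \<and> x = to_fract (fst p) / to_fract (snd p) in cst (fst p) / cst (snd p))"

lemma fract_cst:
  fixes a b :: "'a::idom"
  assumes "b \<noteq> 0"
  shows "fract_cst (to_fract a / to_fract b) = (cst a / cst b :: ('x, 'a) mpoly fract)"
proof -
  let ?Q = "\<lambda>p. snd p \<noteq> 0 \<and> to_fract a / to_fract b = to_fract (fst p) / to_fract (snd p)"
  define p where "p = (SOME p. ?Q p)"
  have "?Q (a, b)" using assms by simp
  then have p: "?Q p" unfolding p_def by (rule someI)
  then have "to_fract (a * snd p) = to_fract (fst p * b)" using assms by (simp add: field_simps)
  then have "a * snd p = fst p * b" by (simp only: to_fract_eq_iff)
  then have "cst a * cst (snd p) = (cst (fst p) * cst b :: ('x, 'a) mpoly fract)" by (metis cst_simps(2))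
  moreover have nz: "cst b \<noteq> (0 :: ('x, 'a) mpoly fract)" "cst (snd p) \<noteq> (0 :: ('x, 'a) mpoly fract)"
    using assms p cst_simps(3,5) by metis+
  ultimately have "cst (fst p) / cst (snd p) = (cst a / cst b :: ('x, 'a) mpoly fract)"
    unfolding frac_eq_eq[OF nz(2,1)] by (simp only:)
  then show ?thesis unfolding fract_cst_def p_def[symmetric] Let_def .
qed

lemma field_embedding_fract_cst: "field_embedding (fract_cst :: 'a::idom fract \<Rightarrow> ('x, 'a) mpoly fract)"
proof
  have cases: "\<exists>a b. b \<noteq> 0 \<and> x = to_fract a / to_fract b" for x :: "'a fract"
    by (cases x) (auto simp: Fract_conv_to_fract)
  show "fract_cst (1 :: 'a fract) = (1 :: ('x, 'a) mpoly fract)"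
    using fract_cst[of 1 1] cst_simps(4) by (metis div_by_1 to_fract_1 zero_neq_one)
  fix x y :: "'a fract"
  obtain a b where ab: "b \<noteq> 0" "x = to_fract a / to_fract b" using cases by blast
  obtain c d where cd: "d \<noteq> 0" "y = to_fract c / to_fract d" using cases by blast
  have nz: "cst b \<noteq> (0 :: ('x, 'a) mpoly fract)" "cst d \<noteq> (0 :: ('x, 'a) mpoly fract)"
    using ab cd cst_simps(3,5) by metis+
  have bd: "b * d \<noteq> 0" using ab cd by simp
  have sum: "x + y = to_fract (a * d + c * b) / to_fract (b * d)" using ab cd by (simp add: field_simps)
  have "fract_cst (x + y) = (cst (a * d + c * b) / cst (b * d) :: ('x, 'a) mpoly fract)"
    unfolding sum by (rule fract_cst[OF bd])
  also have "\<dots> = cst a / cst b + cst c / cst d"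
    unfolding cst_simps(1,2) using nz by (simp add: field_simps)
  finally show "fract_cst (x + y) = (fract_cst x + fract_cst y :: ('x, 'a) mpoly fract)"
    unfolding ab(2) cd(2) fract_cst[OF ab(1)] fract_cst[OF cd(1)] .
  have prod: "x * y = to_fract (a * c) / to_fract (b * d)" using ab cd by simp
  have "fract_cst (x * y) = (cst (a * c) / cst (b * d) :: ('x, 'a) mpoly fract)"
    unfolding prod by (rule fract_cst[OF bd])
  also have "\<dots> = (cst a / cst b) * (cst c / cst d)" unfolding cst_simps(2) by simp
  finally show "fract_cst (x * y) = (fract_cst x * fract_cst y :: ('x, 'a) mpoly fract)"
    unfolding ab(2) cd(2) fract_cst[OF ab(1)] fract_cst[OF cd(1)] .
qed

lemma t_sharp_base_ring_iff:
  "t_sharp_domain (base_ring :: ('x, 'a::idom) mpoly fract set) \<longleftrightarrow> t_sharp_domain (coeff_ring :: 'a fract set)"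
proof -
  have "fract_cst (to_fract c) = (cst c :: ('x, 'a) mpoly fract)" for c :: 'a
    using fract_cst[of 1 c] cst_simps(4) by (metis div_by_1 to_fract_1 zero_neq_one)
  then have "fract_cst ` coeff_ring = (base_ring :: ('x, 'a) mpoly fract set)"
    unfolding coeff_ring_def poly_ring_empty by (simp add: image_image)
  then show ?thesis
    using field_embedding.t_sharp_domain_image[OF field_embedding_fract_cst subdomain_coeff_ring] by metis
qed

theorem theorem3p6:
  fixes X :: "'x indet set"
  defines "R \<equiv> (coeff_ring :: 'a::idom fract set)"
    and "RX \<equiv> (poly_ring X :: ('x, 'a) mpoly fract set)"
    and "RX_nagata \<equiv> (nagata_ring X :: ('x, 'a) mpoly fract set)"
    and "RX_v_nagata \<equiv> (v_nagata_ring X :: ('x, 'a) mpoly fract set)"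
  shows "(t_sharp_domain RX \<longleftrightarrow> t_sharp_domain RX_nagata) \<and>
         (t_sharp_domain RX \<longleftrightarrow> t_sharp_domain RX_v_nagata) \<and>
         (v_coherent RX \<longrightarrow> (t_sharp_domain RX \<longleftrightarrow> t_sharp_domain R))"
proof (intro conjI impI)
  show "t_sharp_domain RX \<longleftrightarrow> t_sharp_domain RX_nagata"
    unfolding RX_def RX_nagata_def nagata_ring_def
    by (rule t_sharp_fractions_poly_ring_iff[OF fraction_ring_content])
      (use content_eq_imp_v_primitive in blast)
  show "t_sharp_domain RX \<longleftrightarrow> t_sharp_domain RX_v_nagata"
    unfolding RX_def RX_v_nagata_def v_nagata_ring_def v_closure_content_iff
    by (rule t_sharp_fractions_poly_ring_iff[OF fraction_ring_v_primitive]) blast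
  assume "v_coherent RX"
  then show "t_sharp_domain RX \<longleftrightarrow> t_sharp_domain R"
    unfolding RX_def R_def
    using t_sharp_poly_ring_if_base[of X, where 'a = 'a] t_sharp_base_if_poly_ring[of X, where 'a = 'a]
      t_sharp_base_ring_iff[where 'x = 'x and 'a = 'a] by blast
qed

end
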